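(* Let $s\in(1,12]$ and $\alpha\ge 3s$. If $k\in(0,2s]$, then the function $z\mapsto \zeta(s,z)-\theta(\alpha,z)^k$ attains its minimum over $\mathbb{H}$ at $e^{i\pi/3}$, and this minimizer is unique up to the action of the modular group. If $k\in(2s,\infty)$, then this function has no minimizer over $\mathbb{H}$.
   Context: $\mathbb{H}=\{z\in\mathbb{C}:\operatorname{Im}(z)>0\}$. For $z\in\mathbb{H}$, $\alpha>0$ and $s>1$, $$\theta(\alpha,z)=\sum_{(m,n)\in\mathbb{Z}^2}e^{-\pi\alpha\frac{|mz+n|^2}{\operatorname{Im}(z)}},\qquad \zeta(s,z)=\sum_{(m,n)\in\mathbb{Z}^2\setminus\{0\}}\frac{\operatorname{Im}(z)^s}{|mz+n|^{2s}}.$$ The modular group is $\mathrm{SL}_2(\mathbb{Z})$ acting on $\mathbb{H}$ by $z\mapsto\frac{az+b}{cz+d}$; both functions are invariant under it. *)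

theory Defs
  imports "HOL-Analysis.Analysis"
begin

definition upper_half_plane :: "complex set" where
  "upper_half_plane = {z. Im z > 0}"

definition lattice_theta :: "real \<Rightarrow> complex \<Rightarrow> real" where
  "lattice_theta \<alpha> z =
     (\<Sum>\<^sub>\<infinity>(m, n)\<in>(UNIV :: (int \<times> int) set).
        exp (- pi * \<alpha> * (cmod (of_int m * z + of_int n))\<^sup>2 / Im z))"

definition epstein_zeta :: "real \<Rightarrow> complex \<Rightarrow> real" where
  "epstein_zeta s z =
     (\<Sum>\<^sub>\<infinity>(m, n)\<in>UNIV - {(0 :: int, 0 :: int)}.
        Im z powr s / cmod (of_int m * z + of_int n) powr (2 * s))"

definition modular_equiv :: "complex \<Rightarrow> complex \<Rightarrow> bool" where
  "modular_equiv z w \<longleftrightarrow>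
     (\<exists>a b c d :: int. a * d - b * c = 1 \<and>
        w = (of_int a * z + of_int b) / (of_int c * z + of_int d))"

end

theory Submission
  imports Defs "HOL-Probability.Probability"
begin

text \<open>The Mellin transform gives \<open>\<zeta>(s,z) = \<pi>\<^sup>s/\<Gamma>(s) \<integral> (\<theta>(t,z) - 1) t\<^bsup>s-1\<^esup> dt\<close> over \<open>t > 0\<close>.
  Poisson summation gives \<open>\<theta>(1/t,z) = t \<theta>(t,z)\<close>, so a lower bound for \<open>\<theta>(t,z) - \<theta>(t,\<rho>)\<close>
  with \<open>\<rho> = e\<^bsup>i\<pi>/3\<^esup>\<close> and \<open>t \<ge> 1\<close> bounds the increase of \<open>\<zeta>\<close> from below.
  By modular invariance and reflection it suffices to take \<open>z\<close> with \<open>0 \<le> Re z \<le> 1/2\<close> and \<open>|z| \<ge> 1\<close>.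

  For \<open>Im z \<le> 13/10\<close> the three pairs of shortest vectors, with exponentials \<open>a\<^sub>i = exp (-\<pi> Q\<^sub>i)\<close>, dominate:
  \<open>\<Sum>(a\<^sub>i - 3/2 a\<^sub>i\<^sup>2)\<close> is smallest for the hexagonal lattice, so the second-order terms in the increase of
  \<open>\<theta>(\<alpha>,z)\<close> are controlled by the first-order term \<open>\<Sum>a\<^sub>i - 3a\<close>, with \<open>a\<close> the common value of the \<open>a\<^sub>i\<close> at \<open>\<rho>\<close>.
  The other vectors are compared with those at \<open>\<rho>\<close> by convexity along the orbits of a rotation of order 3.
  For \<open>Im z \<ge> 13/10\<close> the vectors \<open>(0, 1)\<close> and \<open>(0, -1)\<close> already make \<open>\<zeta>\<close> grow faster than \<open>\<theta>\<^sup>k\<close>.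
  On the imaginary axis, \<open>\<theta>(\<alpha>,iy)\<^sup>k \<ge> (y/\<alpha>)\<^bsup>k/2\<^esup>\<close>, whereas \<open>\<zeta>(s,iy) = O(y\<^sup>s)\<close>;
  hence there is no minimum if \<open>k > 2s\<close>.\<close>

section \<open>Poisson summation for the Gaussian\<close>

text \<open>The difficulty is that \<zeta> and \<theta>^k both increase away from \<rho>, so two
  increases must be compared, uniformly in s, \<alpha> and k. By the mean value theorem the exponent
  k costs at most a factor 2s * 21/20, and \<alpha> \<ge> 3s keeps the shortest vectors' share of
  this cost below their gain in \<zeta>, which is of order (sqrt 3 / 2)^s. The increase of the
  remaining vectors in \<theta>(\<alpha>,z) is not estimated by itself. For 1 \<le> t \<le> 2, a
  multiple C of their sum at \<alpha> is subtracted from their sum at t, and one tangent-line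
  argument treats the difference. Whatever these vectors add to \<theta>(\<alpha>,z) is thereby also
  gained by \<zeta>, with weight C times the Mellin mass of the interval [1,2]. The bound s \<le> 12
  keeps this mass above 17/10, so that C stays small enough for convexity. The height 13/10 is a
  compromise: low enough for all terms exp (-\<pi> Q) to stay below 893/10000, high enough for two
  vectors to suffice above it.\<close>

lemma summable_exp_neg_square_nat:
  fixes a :: real
  assumes "a > 0"
  shows "summable (\<lambda>n::nat. exp (- a * (real n)\<^sup>2))"
proof (rule summable_comparison_test')
  show "summable (\<lambda>n::nat. exp (- a) ^ n)"
    using assms by (intro summable_geometric) auto
  show "norm (exp (- a * (real n)\<^sup>2)) \<le> exp (- a) ^ n" if "n \<ge> 0" for n :: nat
  proof -
    have "real n \<le> (real n)\<^sup>2"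
      by (cases n) (auto simp: power2_eq_square)
    then show ?thesis
      using assms by (simp add: exp_of_nat_mult[symmetric] mult.commute)
  qed
qed

lemma summable_on_int_even:
  fixes f :: "int \<Rightarrow> real"
  assumes "\<And>n. f n \<ge> 0" "\<And>n. f (- n) = f n" "summable (\<lambda>n::nat. f (int n))"
  shows "f summable_on UNIV"
proof -
  have s: "(\<lambda>n::nat. f (int n)) summable_on UNIV"
    using assms by (intro summable_nonneg_imp_summable_on) auto
  have "f summable_on (range int)"
    using s by (subst summable_on_reindex) (auto simp: o_def)
  moreover have "f summable_on (range (\<lambda>n::nat. - int n))"
    using s assms(2) by (subst summable_on_reindex) (auto simp: o_def inj_on_def)
  ultimately have "f summable_on (range int \<union> range (\<lambda>n::nat. - int n))"
    by (rule summable_on_union)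
  moreover have "range int \<union> range (\<lambda>n::nat. - int n) = UNIV"
    by (auto simp: image_def) (metis int_cases2)
  ultimately show ?thesis by simp
qed

lemma summable_on_exp_neg_square:
  fixes a :: real
  assumes "a > 0"
  shows "(\<lambda>n::int. exp (- a * (of_int n)\<^sup>2)) summable_on UNIV"
  using summable_exp_neg_square_nat[OF assms] by (intro summable_on_int_even) auto

text \<open>Amounts to (n + 2u)^2 \<ge> 0. It lets a single Gaussian series dominate all translates
  with bounded \<open>u\<close>, as uniform convergence requires.\<close>

lemma shifted_square_ge:
  fixes n u :: real
  assumes "\<bar>u\<bar> \<le> B"
  shows "(n + u)\<^sup>2 \<ge> n\<^sup>2 / 2 - B\<^sup>2"
proof -
  have "(n + 2 * u)\<^sup>2 \<ge> 0" by simp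
  then have "2 * (n + u)\<^sup>2 \<ge> n\<^sup>2 - 2 * u\<^sup>2"
    by (simp add: power2_eq_square algebra_simps)
  moreover have "u\<^sup>2 \<le> B\<^sup>2" using assms by (simp add: abs_le_square_iff[symmetric])
  ultimately show ?thesis by simp
qed

definition jtheta :: "real \<Rightarrow> real \<Rightarrow> real" where
  "jtheta v u = (\<Sum>\<^sub>\<infinity>n::int. exp (- (pi * v) * (of_int n + u)\<^sup>2))"

definition jtheta_dual :: "real \<Rightarrow> real \<Rightarrow> real" where
  "jtheta_dual v u = (\<Sum>\<^sub>\<infinity>j::int. exp (- (pi / v) * (of_int j)\<^sup>2) * cos (2 * pi * of_int j * u))"

lemma jtheta_term_le:
  assumes "v > 0" "\<bar>u\<bar> \<le> B"
  shows "exp (- (pi * v) * (of_int n + u)\<^sup>2) \<le> exp (pi * v * B\<^sup>2) * exp (- (pi * v / 2) * (of_int n)\<^sup>2)"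
proof -
  have "- (pi * v) * (of_int n + u)\<^sup>2 \<le> - (pi * v) * ((of_int n)\<^sup>2 / 2 - B\<^sup>2)"
    using shifted_square_ge[OF assms(2), of "of_int n"] assms(1)
    by (intro mult_left_mono_neg) auto
  then show ?thesis by (simp add: exp_add[symmetric] algebra_simps)
qed

lemma summable_jtheta:
  assumes "v > 0"
  shows "(\<lambda>n::int. exp (- (pi * v) * (of_int n + u)\<^sup>2)) summable_on UNIV"
proof (rule summable_on_comparison_test)
  show "(\<lambda>n::int. exp (pi * v * \<bar>u\<bar>\<^sup>2) * exp (- (pi * v / 2) * (of_int n)\<^sup>2)) summable_on UNIV"
    using assms by (intro summable_on_cmult_right summable_on_exp_neg_square) auto
qed (use jtheta_term_le[OF assms, of u "\<bar>u\<bar>"] in auto)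

lemma summable_jtheta_dual:
  assumes "v > 0"
  shows "(\<lambda>j::int. exp (- (pi / v) * (of_int j)\<^sup>2) * cos (2 * pi * of_int j * u)) summable_on UNIV"
proof (rule abs_summable_summable, rule summable_on_comparison_test)
  show "(\<lambda>n::int. exp (- (pi / v) * (of_int n)\<^sup>2)) summable_on UNIV"
    using assms by (intro summable_on_exp_neg_square) auto
qed (auto simp: abs_mult mult_left_le)

lemma jtheta_shift: "jtheta v (u + of_int k) = jtheta v u"
proof -
  have "bij_betw (\<lambda>n. n + k) UNIV (UNIV::int set)"
    by (rule bij_betwI[where g = "\<lambda>n. n - k"]) auto
  from infsum_reindex_bij_betw[OF this, of "\<lambda>n. exp (- (pi * v) * (of_int n + u)\<^sup>2)"]
  show ?thesis unfolding jtheta_def by (simp add: algebra_simps)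
qed

lemma jtheta_dual_shift: "jtheta_dual v (u + of_int k) = jtheta_dual v u"
proof -
  have "cos (2 * pi * of_int j * (u + of_int k)) = cos (2 * pi * of_int j * u)" for j :: int
  proof -
    have eq: "2 * pi * of_int j * (u + of_int k) = 2 * pi * of_int j * u + 2 * pi * of_int (j * k)"
      by (simp add: algebra_simps)
    show ?thesis unfolding eq cos_add cos_int_2pin sin_int_2pin by simp
  qed
  then show ?thesis unfolding jtheta_dual_def by simp
qed

text \<open>Rescaling by \<open>c = sqrt (2 * pi * v)\<close> turns the Gaussian into the standard
  normal density, whose characteristic function is known; the two integrals are its real and
  imaginary parts.\<close>

lemma gaussian_fourier:
  fixes v \<xi> :: real
  assumes "v > 0"
  shows "has_bochner_integral lborel (\<lambda>x. exp (- (pi * v) * x\<^sup>2) * cos (2 * pi * \<xi> * x))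
           (exp (- (pi / v) * \<xi>\<^sup>2) / sqrt v)"
    and "has_bochner_integral lborel (\<lambda>x. exp (- (pi * v) * x\<^sup>2) * sin (2 * pi * \<xi> * x)) 0"
proof -
  define c where "c = sqrt (2 * pi * v)"
  define t where "t = 2 * pi * \<xi> / c"
  have c: "c > 0" using assms by (simp add: c_def)
  let ?g = "\<lambda>x. std_normal_density x *\<^sub>R iexp (t * x)"
  have int: "integrable lborel ?g"
    by (rule Bochner_Integration.integrable_bound[OF integrable_normal_density[where \<mu> = 0 and \<sigma> = 1]])
       (auto simp: normal_density_nonneg)
  have "(\<integral>x. ?g x \<partial>lborel) = char std_normal_distribution t"
    unfolding char_def by (subst integral_density) (auto simp: normal_density_nonneg)
  then have val: "(\<integral>x. ?g x \<partial>lborel) = of_real (exp (- t\<^sup>2 / 2))"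
    by (simp add: char_std_normal_distribution)
  have "(\<integral>x. ?g (0 + c * x) \<partial>lborel) = of_real (exp (- t\<^sup>2 / 2) / c)"
    using lborel_integral_real_affine[of c ?g 0] c val by (simp add: scaleR_conv_of_real field_simps)
  moreover have "integrable lborel (\<lambda>x. ?g (0 + c * x))"
    using c int by (subst lborel_integrable_real_affine_iff) auto
  ultimately have hb: "has_bochner_integral lborel (\<lambda>x. ?g (0 + c * x)) (of_real (exp (- t\<^sup>2 / 2) / c))"
    by (simp only: has_bochner_integral_iff)
  have t: "t\<^sup>2 / 2 = pi / v * \<xi>\<^sup>2"
    using assms by (simp add: t_def c_def power_divide power_mult_distrib power2_eq_square)
  have c': "sqrt (2 * pi) / c = 1 / sqrt v"
    using assms by (simp add: c_def real_sqrt_mult)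
  have g: "sqrt (2 * pi) *\<^sub>R ?g (0 + c * x) = of_real (exp (- (pi * v) * x\<^sup>2)) * iexp (2 * pi * \<xi> * x)" for x
  proof -
    have e1: "t * (0 + c * x) = 2 * pi * \<xi> * x" using c by (simp add: t_def)
    have "(c * x)\<^sup>2 / 2 = pi * v * x\<^sup>2" using assms by (simp add: c_def power_mult_distrib)
    then have e2: "sqrt (2 * pi) * std_normal_density (0 + c * x) = exp (- (pi * v) * x\<^sup>2)"
      unfolding std_normal_density_def by (simp add: minus_divide_left[symmetric])
    show ?thesis unfolding e1 scaleR_scaleR e2 by (simp only: scaleR_conv_of_real)
  qed
  have e3: "exp (- t\<^sup>2 / 2) = exp (- (pi / v) * \<xi>\<^sup>2)" using t by simp
  have "sqrt (2 * pi) * (exp (- t\<^sup>2 / 2) / c) = exp (- t\<^sup>2 / 2) * (sqrt (2 * pi) / c)" by simp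
  also have "\<dots> = exp (- (pi / v) * \<xi>\<^sup>2) / sqrt v" unfolding c' e3 by simp
  finally have val2: "sqrt (2 * pi) *\<^sub>R (of_real (exp (- t\<^sup>2 / 2) / c) :: complex) = of_real (exp (- (pi / v) * \<xi>\<^sup>2) / sqrt v)"
    by (simp only: scaleR_conv_of_real of_real_mult[symmetric])
  have hb2: "has_bochner_integral lborel (\<lambda>x. of_real (exp (- (pi * v) * x\<^sup>2)) * iexp (2 * pi * \<xi> * x))
      (of_real (exp (- (pi / v) * \<xi>\<^sup>2) / sqrt v))"
    using has_bochner_integral_scaleR_right[OF hb, of "sqrt (2 * pi)"] by (simp only: g val2)
  have e: "of_real r * iexp s = Complex (r * cos s) (r * sin s)" for r s
    by (simp add: complex_eq_iff Re_exp Im_exp)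
  show "has_bochner_integral lborel (\<lambda>x. exp (- (pi * v) * x\<^sup>2) * cos (2 * pi * \<xi> * x))
           (exp (- (pi / v) * \<xi>\<^sup>2) / sqrt v)"
    using has_bochner_integral_bounded_linear[OF bounded_linear_Re hb2] by (simp only: e complex.sel Re_complex_of_real)
  show "has_bochner_integral lborel (\<lambda>x. exp (- (pi * v) * x\<^sup>2) * sin (2 * pi * \<xi> * x)) 0"
    using has_bochner_integral_bounded_linear[OF bounded_linear_Im hb2] by (simp only: e complex.sel Im_complex_of_real)
qed

text \<open>Unordered sums are limits over finite sets. Along these half-open ranges the unit
  intervals from n to n + 1 fit together to the interval from -N to N.\<close>

lemma filterlim_int_intervals:
  "filterlim (\<lambda>N::nat. {- int N..<int N}) (finite_subsets_at_top UNIV) sequentially"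
  unfolding filterlim_finite_subsets_at_top
proof safe
  fix X :: "int set"
  assume X: "finite X"
  obtain N0 where N0: "\<And>x. x \<in> X \<Longrightarrow> \<bar>x\<bar> < int N0"
  proof -
    have "finite (abs ` X)" using X by simp
    then obtain B where "\<And>y. y \<in> abs ` X \<Longrightarrow> y \<le> B"
      by (meson bdd_above.E bdd_above_finite)
    then show ?thesis
      by (intro that[of "nat (B + 1)"]) force
  qed
  show "\<forall>\<^sub>F N in sequentially. finite {- int N..<int N} \<and> X \<subseteq> {- int N..<int N} \<and> {- int N..<int N} \<subseteq> UNIV"
    using eventually_ge_at_top[of N0]
  proof eventually_elim
    case (elim N)
    have "x \<in> {- int N..<int N}" if "x \<in> X" for x
      using N0[OF that] elim by auto
    then show ?case by auto
  qed
qed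

text \<open>Unfolding: the unit intervals tile the line. The majorant \<open>M\<close> permits
  termwise integration, and integrability of \<open>F\<close> identifies the limit of the integrals
  over symmetric intervals.\<close>

lemma integral_periodization:
  fixes F :: "real \<Rightarrow> real"
  assumes cont: "continuous_on UNIV F"
    and bound: "\<And>n u. u \<in> {0..1} \<Longrightarrow> \<bar>F (of_int n + u)\<bar> \<le> M n"
    and M: "M summable_on (UNIV :: int set)"
    and I: "has_bochner_integral lborel F I"
  shows "integral {0..1} (\<lambda>u. \<Sum>\<^sub>\<infinity>n. F (of_int n + u)) = I"
proof -
  have ci: "F integrable_on {a..b}" for a b
    by (intro integrable_continuous_interval continuous_on_subset[OF cont]) auto
  have U: "uniform_limit {0..1} (\<lambda>X u. \<Sum>n\<in>X. F (of_int n + u)) (\<lambda>u. \<Sum>\<^sub>\<infinity>n. F (of_int n + u))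
             (finite_subsets_at_top UNIV)"
    using bound by (intro Weierstrass_m_test_general[OF _ M]) auto
  have C: "continuous_on {0..1} (\<lambda>u. \<Sum>n\<in>X. F (of_int n + u))" for X
    by (intro continuous_intros continuous_on_compose2[OF cont]) auto
  obtain J K where J: "\<And>X. ((\<lambda>u. \<Sum>n\<in>X. F (of_int n + u)) has_integral J X) {0..1}"
    and K: "((\<lambda>u. \<Sum>\<^sub>\<infinity>n. F (of_int n + u)) has_integral K) {0..1}"
    and lim: "(J \<longlongrightarrow> K) (finite_subsets_at_top UNIV)"
    using uniform_limit_integral[OF U C] by (metis finite_subsets_at_top_neq_bot)
  have J_eq: "J {- int N..<int N} = integral {- real N..real N} F" for N
  proof -
    have step: "((\<lambda>u. F (of_int n + u)) has_integral integral {of_int n..of_int n + 1} F) {0..1}" for n :: int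
    proof -
      have "(F has_integral integral {of_int n..of_int n + 1} F) {of_int n..of_int n + 1}"
        using ci by (rule integrable_integral)
      then have "(F has_integral integral {of_int n..of_int n + 1} F) (cbox (of_int n) (of_int n + 1))"
        by simp
      from has_integral_affinity[OF this, of 1 "of_int n"]
      have "((\<lambda>u. F (u + of_int n)) has_integral integral {of_int n..of_int n + 1} F)
              ((\<lambda>x. x + - of_int n) ` {of_int n..of_int n + 1})"
        by simp
      moreover have "(\<lambda>x::real. x + - of_int n) ` {of_int n..of_int n + 1} = {0..1}"
        by (simp only: image_add_atLeastAtMost') simp
      ultimately have "((\<lambda>u. F (u + of_int n)) has_integral integral {of_int n..of_int n + 1} F) {0..1}"
        by (simp only:)
      then show ?thesis by (simp add: add.commute)
    qed
    have "((\<lambda>u. \<Sum>n\<in>{- int N..<int N}. F (of_int n + u)) has_integral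
            (\<Sum>n\<in>{- int N..<int N}. integral {of_int n..of_int n + 1} F)) {0..1}"
      by (intro has_integral_sum step) auto
    then have "J {- int N..<int N} = (\<Sum>n\<in>{- int N..<int N}. integral {of_int n..of_int n + 1} F)"
      using J has_integral_unique by blast
    also have "\<dots> = integral {- real N..real N} F"
    proof (induction N)
      case (Suc N)
      have "{- int (Suc N)..<int (Suc N)} = insert (- int (Suc N)) (insert (int N) {- int N..<int N})"
        by auto
      then have "(\<Sum>n\<in>{- int (Suc N)..<int (Suc N)}. integral {of_int n..of_int n + 1} F)
         = integral {- real (Suc N)..- real N} F + (integral {real N..real (Suc N)} F + integral {- real N..real N} F)"
        using Suc by (simp add: algebra_simps)
      also have "integral {real N..real (Suc N)} F + integral {- real N..real N} F = integral {- real N..real (Suc N)} F"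
        using Henstock_Kurzweil_Integration.integral_combine[of "- real N" "real N" "real (Suc N)" F] ci by simp
      also have "integral {- real (Suc N)..- real N} F + \<dots> = integral {- real (Suc N)..real (Suc N)} F"
        using Henstock_Kurzweil_Integration.integral_combine[of "- real (Suc N)" "- real N" "real (Suc N)" F] ci by simp
      finally show ?case .
    qed auto
    finally show ?thesis .
  qed
  have "(\<lambda>N. J {- int N..<int N}) \<longlonglongrightarrow> K"
    using filterlim_compose[OF lim filterlim_int_intervals] .
  then have L1: "(\<lambda>N. integral {- real N..real N} F) \<longlonglongrightarrow> K"
    by (simp add: J_eq)
  have intF: "integrable lborel F" and IF: "(\<integral>x. F x \<partial>lborel) = I"
    using I by (auto simp: has_bochner_integral_iff)
  have L2: "(\<lambda>N. integral {- real N..real N} F) \<longlonglongrightarrow> I"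
  proof -
    have "(\<lambda>N. \<integral>x. indicator {- real N..real N} x *\<^sub>R F x \<partial>lborel) \<longlonglongrightarrow> (\<integral>x. F x \<partial>lborel)"
    proof (rule integral_dominated_convergence[where w = "\<lambda>x. \<bar>F x\<bar>"])
      show "AE x in lborel. (\<lambda>N. indicator {- real N..real N} x *\<^sub>R F x) \<longlonglongrightarrow> F x"
      proof (rule AE_I2)
        fix x :: real
        obtain N0 :: nat where "\<bar>x\<bar> \<le> real N0" using real_arch_simple by blast
        then have "eventually (\<lambda>N. indicator {- real N..real N} x *\<^sub>R F x = F x) sequentially"
          by (intro eventually_sequentiallyI[of N0]) (auto simp: indicator_def)
        then show "(\<lambda>N. indicator {- real N..real N} x *\<^sub>R F x) \<longlonglongrightarrow> F x"
          by (rule tendsto_eventually)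
      qed
    qed (use intF in \<open>auto simp: indicator_def\<close>)
    moreover have "(\<integral>x. indicator {- real N..real N} x *\<^sub>R F x \<partial>lborel) = integral {- real N..real N} F" for N
    proof -
      have "set_integrable lborel {- real N..real N} F"
        unfolding set_integrable_def by (intro integrable_mult_indicator intF) auto
      from set_borel_integral_eq_integral(2)[OF this] show ?thesis
        unfolding set_lebesgue_integral_def by simp
    qed
    ultimately show ?thesis using IF by simp
  qed
  have "K = I" using L1 L2 by (rule LIMSEQ_unique)
  then show ?thesis using K by (simp add: integral_unique)
qed

section \<open>Uniqueness of Fourier coefficients\<close>

definition null_fourier :: "(real \<Rightarrow> real) \<Rightarrow> bool" where
  "null_fourier H \<longleftrightarrow> continuous_on UNIV H \<and>
     (\<forall>j::int. integral {0..1} (\<lambda>u. H u * cos (2 * pi * of_int j * u)) = 0 \<and>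
               integral {0..1} (\<lambda>u. H u * sin (2 * pi * of_int j * u)) = 0)"

text \<open>The factor is a trigonometric polynomial of degree 1, so the new coefficients at j are
  combinations of the old ones at j - 1, j and j + 1, all of which vanish.\<close>

lemma null_fourier_mult_kernel:
  assumes "null_fourier H"
  shows "null_fourier (\<lambda>u. H u * ((1 + cos (2 * pi * (u - w))) / 2))"
proof -
  have cont: "continuous_on UNIV H" using assms by (simp add: null_fourier_def)
  define C where "C = (\<lambda>j::int. \<lambda>u. H u * cos (2 * pi * of_int j * u))"
  define S where "S = (\<lambda>j::int. \<lambda>u. H u * sin (2 * pi * of_int j * u))"
  have C: "(C j has_integral 0) {0..1}" for j
    unfolding C_def using assms
    by (intro integrable_integral[THEN has_integral_eq_rhs] integrable_continuous_interval continuous_intros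
          continuous_on_subset[OF cont]) (auto simp: null_fourier_def)
  have S: "(S j has_integral 0) {0..1}" for j
    unfolding S_def using assms
    by (intro integrable_integral[THEN has_integral_eq_rhs] integrable_continuous_interval continuous_intros
          continuous_on_subset[OF cont]) (auto simp: null_fourier_def)
  have k: "cos (2 * pi * (u - w)) = cos (2 * pi * w) * cos (2 * pi * u) + sin (2 * pi * w) * sin (2 * pi * u)" for u
    using cos_diff[of "2 * pi * u" "2 * pi * w"] by (simp add: algebra_simps)
  have shift: "2 * pi * of_int (j + 1) * u = 2 * pi * of_int j * u + 2 * pi * u"
    "2 * pi * of_int (j - 1) * u = 2 * pi * of_int j * u - 2 * pi * u" for j u
    by (simp_all add: algebra_simps)
  have eqC: "H u * ((1 + cos (2 * pi * (u - w))) / 2) * cos (2 * pi * of_int j * u)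
      = 1/2 * C j u + (cos (2 * pi * w) / 4 * (C (j + 1) u + C (j - 1) u)
        + sin (2 * pi * w) / 4 * (S (j + 1) u - S (j - 1) u))" for u j
    unfolding C_def S_def shift k cos_add cos_diff sin_add sin_diff by (simp add: field_simps)
  have hC: "((\<lambda>u. 1/2 * C j u + (cos (2 * pi * w) / 4 * (C (j + 1) u + C (j - 1) u)
        + sin (2 * pi * w) / 4 * (S (j + 1) u - S (j - 1) u))) has_integral
        (1/2 * 0 + (cos (2 * pi * w) / 4 * (0 + 0) + sin (2 * pi * w) / 4 * (0 - 0)))) {0..1}" for j
    by (intro has_integral_add has_integral_diff has_integral_mult_right C S)
  have 1: "integral {0..1} (\<lambda>u. H u * ((1 + cos (2 * pi * (u - w))) / 2) * cos (2 * pi * of_int j * u)) = 0" for j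
    unfolding eqC integral_unique[OF hC] by simp
  have eqS: "H u * ((1 + cos (2 * pi * (u - w))) / 2) * sin (2 * pi * of_int j * u)
      = 1/2 * S j u + (cos (2 * pi * w) / 4 * (S (j + 1) u + S (j - 1) u)
        + sin (2 * pi * w) / 4 * (C (j - 1) u - C (j + 1) u))" for u j
    unfolding C_def S_def shift k cos_add cos_diff sin_add sin_diff by (simp add: field_simps)
  have hS: "((\<lambda>u. 1/2 * S j u + (cos (2 * pi * w) / 4 * (S (j + 1) u + S (j - 1) u)
        + sin (2 * pi * w) / 4 * (C (j - 1) u - C (j + 1) u))) has_integral
        (1/2 * 0 + (cos (2 * pi * w) / 4 * (0 + 0) + sin (2 * pi * w) / 4 * (0 - 0)))) {0..1}" for j
    by (intro has_integral_add has_integral_diff has_integral_mult_right C S)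
  have 2: "integral {0..1} (\<lambda>u. H u * ((1 + cos (2 * pi * (u - w))) / 2) * sin (2 * pi * of_int j * u)) = 0" for j
    unfolding eqS integral_unique[OF hS] by simp
  have 3: "continuous_on UNIV (\<lambda>u. H u * ((1 + cos (2 * pi * (u - w))) / 2))"
    by (intro continuous_intros cont) auto
  show ?thesis using 1 2 3 by (simp add: null_fourier_def)
qed

lemma null_fourier_mult_kernel_power:
  assumes "null_fourier H"
  shows "null_fourier (\<lambda>u. H u * ((1 + cos (2 * pi * (u - w))) / 2) ^ N)"
proof (induction N)
  case (Suc N)
  show ?case using null_fourier_mult_kernel[OF Suc, of w] by (simp add: mult_ac)
qed (use assms in auto)

text \<open>The kernel \<open>((1 + cos (2\<pi>(u - w)))/2)\<^sup>N\<close> is a trigonometric polynomial that concentrates at \<open>w\<close>,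
  so \<open>H w > 0\<close> would make one of the vanishing integrals positive.\<close>

lemma null_fourier_nonpos:
  assumes H: "null_fourier H" and w: "0 < w" "w < 1"
  shows "H w \<le> 0"
proof (rule ccontr)
  assume "\<not> H w \<le> 0"
  then have pos: "H w > 0" by simp
  define \<eta> where "\<eta> = H w / 2"
  have cont: "continuous_on UNIV H" using H by (simp add: null_fourier_def)
  then have "isCont H w" by (simp add: continuous_on_eq_continuous_at)
  then obtain d0 where d0: "d0 > 0" "\<And>u. \<bar>u - w\<bar> < d0 \<Longrightarrow> \<bar>H u - H w\<bar> < \<eta>"
    unfolding continuous_at_eps_delta using pos by (metis \<eta>_def dist_real_def half_gt_zero)
  define \<delta> where "\<delta> = min (d0 / 2) (min (w / 2) ((1 - w) / 2))"
  have \<delta>: "\<delta> > 0" "\<delta> < d0" "\<delta> < w" "\<delta> < 1 - w" using d0 w by (auto simp: \<delta>_def min_def field_simps)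
  then have \<delta>2: "\<delta> < 1/2" by linarith
  have H_pos: "H u \<ge> \<eta>" if "\<bar>u - w\<bar> \<le> \<delta>" for u
    using d0(2)[of u] that \<delta> by (simp add: \<eta>_def abs_if split: if_splits)
  obtain B where B: "\<And>u. u \<in> {0..1} \<Longrightarrow> \<bar>H u\<bar> \<le> B" "B > 0"
  proof -
    have "compact (H ` {0..1})"
      by (intro compact_continuous_image continuous_on_subset[OF cont]) auto
    then obtain B where "\<And>u. u \<in> {0..1} \<Longrightarrow> \<bar>H u\<bar> \<le> B"
      by (metis bounded_iff compact_imp_bounded image_eqI real_norm_def)
    then show ?thesis by (intro that[of "max B 1"]) force+
  qed
  define k where "k = (\<lambda>u. (1 + cos (2 * pi * (u - w))) / 2)"
  \<comment> \<open>\<open>c1\<close> bounds the kernel from below within distance \<delta>/2 of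
    \<open>w\<close>, and \<open>c2\<close> bounds it from above at distance at least \<delta>.
    Since \<open>c2 < c1\<close>, high powers separate the two regions.\<close>
  define c1 where "c1 = (1 + cos (pi * \<delta>)) / 2"
  define c2 where "c2 = (1 + cos (2 * pi * \<delta>)) / 2"
  have k0: "k u \<ge> 0" for u unfolding k_def by (smt (verit) cos_ge_minus_one divide_nonneg_nonneg)
  have cabs: "cos x = cos \<bar>x\<bar>" for x :: real by (simp add: abs_if)
  have k1: "k u \<ge> c1" if "\<bar>u - w\<bar> \<le> \<delta> / 2" for u
  proof -
    have "cos (pi * \<delta>) \<le> cos \<bar>2 * pi * (u - w)\<bar>"
    proof (rule cos_monotone_0_pi_le)
      show "\<bar>2 * pi * (u - w)\<bar> \<le> pi * \<delta>" using that by (simp add: abs_mult)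
      show "pi * \<delta> \<le> pi" using \<delta>2 by simp
    qed auto
    then show ?thesis by (simp add: k_def c1_def cabs[symmetric])
  qed
  have k2: "k u \<le> c2" if "\<bar>u - w\<bar> \<ge> \<delta>" "u \<in> {0..1}" for u
  proof -
    have le: "\<bar>u - w\<bar> \<le> 1 - \<delta>" using that \<delta> w by (auto simp: abs_if)
    have "cos \<bar>2 * pi * (u - w)\<bar> \<le> cos (2 * pi * \<delta>)"
    proof (cases "\<bar>u - w\<bar> \<le> 1/2")
      case True
      show ?thesis
        by (rule cos_monotone_0_pi_le) (use True that \<delta> in \<open>auto simp: abs_mult\<close>)
    next
      case False
      have "cos \<bar>2 * pi * (u - w)\<bar> = cos (2 * pi - 2 * pi * \<bar>u - w\<bar>)"
        by (simp add: abs_mult)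
      also have "\<dots> = cos (2 * pi * (1 - \<bar>u - w\<bar>))" by (simp add: algebra_simps)
      also have "\<dots> \<le> cos (2 * pi * \<delta>)"
        by (rule cos_monotone_0_pi_le) (use False le \<delta> in auto)
      finally show ?thesis .
    qed
    then show ?thesis by (simp add: k_def c2_def cabs[symmetric])
  qed
  have c21: "c2 < c1"
    unfolding c1_def c2_def using \<delta> \<delta>2 by (auto intro!: cos_monotone_0_pi)
  have c20: "c2 > 0"
  proof -
    have "cos (2 * pi * \<delta>) > cos pi" using \<delta> \<delta>2 by (intro cos_monotone_0_pi) auto
    then show ?thesis by (simp add: c2_def)
  qed
  define I where "I = {w - \<delta> / 2..w + \<delta> / 2}"
  \<comment> \<open>On \<open>I\<close>, of length \<delta>, the integrand is at least \<eta> *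
    c1^N; elsewhere within distance \<delta> it is nonnegative; further away it is at least -B *
    c2^N. A vanishing integral forces this inequality, which fails for large N.\<close>
  have main: "\<eta> * \<delta> * c1 ^ N \<le> B * c2 ^ N" for N
  proof -
    have "null_fourier (\<lambda>u. H u * k u ^ N)"
      unfolding k_def using H by (rule null_fourier_mult_kernel_power)
    then have z: "integral {0..1} (\<lambda>u. H u * k u ^ N) = 0"
      unfolding null_fourier_def by (auto dest!: spec[of _ 0])
    have i1: "(\<lambda>u. H u * k u ^ N) integrable_on {0..1}"
      unfolding k_def
      by (intro integrable_continuous_interval continuous_intros continuous_on_subset[OF cont]) auto
    have sub: "I \<subseteq> {0..1}" using \<delta> by (auto simp: I_def)
    have "((\<lambda>u::real. \<eta> * c1 ^ N) has_integral (\<delta> *\<^sub>R (\<eta> * c1 ^ N))) I"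
      using has_integral_const_real[of "\<eta> * c1 ^ N" "w - \<delta> / 2" "w + \<delta> / 2"] \<delta> by (simp add: I_def)
    then have "((\<lambda>u. if u \<in> I then \<eta> * c1 ^ N else 0) has_integral (\<delta> *\<^sub>R (\<eta> * c1 ^ N))) {0..1}"
      using sub by (simp add: has_integral_restrict)
    moreover have "((\<lambda>u::real. B * c2 ^ N) has_integral (1 *\<^sub>R (B * c2 ^ N))) {0..1}"
      using has_integral_const_real[of "B * c2 ^ N" 0 1] by simp
    ultimately have i2: "((\<lambda>u::real. (if u \<in> I then \<eta> * c1 ^ N else 0) - B * c2 ^ N) has_integral
        (\<delta> *\<^sub>R (\<eta> * c1 ^ N) - 1 *\<^sub>R (B * c2 ^ N))) {0..1}"
      by (rule has_integral_diff)
    have "(if u \<in> I then \<eta> * c1 ^ N else 0) - B * c2 ^ N \<le> H u * k u ^ N" if u: "u \<in> {0..1}" for u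
    proof -
      consider "u \<in> I" | "u \<notin> I" "\<bar>u - w\<bar> \<le> \<delta>" | "u \<notin> I" "\<bar>u - w\<bar> \<ge> \<delta>" by linarith
      then show ?thesis
      proof cases
        case 1
        then have "\<bar>u - w\<bar> \<le> \<delta> / 2" by (auto simp: I_def abs_if)
        then have "\<eta> * c1 ^ N \<le> H u * k u ^ N"
          using k1 H_pos[of u] \<delta> c21 c20 pos
          by (intro mult_mono power_mono) (auto simp: \<eta>_def)
        then show ?thesis using 1 B(2) c20 by (smt (verit) mult_nonneg_nonneg zero_le_power)
      next
        case 2
        have "0 \<le> H u * k u ^ N" using H_pos[OF 2(2)] pos k0 by (intro mult_nonneg_nonneg) (auto simp: \<eta>_def)
        moreover have "0 \<le> B * c2 ^ N" using B c20 by simp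
        ultimately show ?thesis using 2 by simp
      next
        case 3
        have "\<bar>H u * k u ^ N\<bar> \<le> B * c2 ^ N"
          unfolding abs_mult using B(1)[OF u] k2[OF 3(2) u] k0[of u] B(2)
          by (intro mult_mono) (auto simp: power_mono)
        then show ?thesis using 3 by simp
      qed
    qed
    then have "\<delta> *\<^sub>R (\<eta> * c1 ^ N) - 1 *\<^sub>R (B * c2 ^ N) \<le> integral {0..1} (\<lambda>u. H u * k u ^ N)"
      by (intro has_integral_le[OF i2 integrable_integral[OF i1]])
    then show ?thesis using z by (simp add: mult_ac)
  qed
  have "c1 / c2 > 1" using c21 c20 by simp
  then obtain N where N: "B / (\<eta> * \<delta>) < (c1 / c2) ^ N" using real_arch_pow by blast
  have "\<eta> * \<delta> > 0" using pos \<delta> by (simp add: \<eta>_def)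
  then have "B * c2 ^ N < \<eta> * \<delta> * c1 ^ N"
    using N c20 by (simp add: field_simps power_divide)
  with main[of N] show False by simp
qed

lemma null_fourier_eq_0:
  assumes H: "null_fourier H" and w: "0 < w" "w < 1"
  shows "H w = 0"
proof -
  have "null_fourier (\<lambda>u. - H u)"
    using H unfolding null_fourier_def by (simp add: continuous_on_minus)
  from null_fourier_nonpos[OF this w] null_fourier_nonpos[OF H w] show ?thesis by simp
qed

section \<open>Continuity and Fourier coefficients of the two theta series\<close>

lemma continuous_on_jtheta:
  assumes "v > 0"
  shows "continuous_on {- B..B} (jtheta v)"
proof -
  have U: "uniform_limit {- B..B} (\<lambda>X u. \<Sum>n\<in>X. exp (- (pi * v) * (of_int n + u)\<^sup>2)) (jtheta v)
             (finite_subsets_at_top UNIV)"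
    unfolding jtheta_def
  proof (rule Weierstrass_m_test_general)
    show "(\<lambda>n::int. exp (pi * v * B\<^sup>2) * exp (- (pi * v / 2) * (of_int n)\<^sup>2)) summable_on UNIV"
      using assms by (intro summable_on_cmult_right summable_on_exp_neg_square) auto
    show "norm (exp (- (pi * v) * (of_int n + u)\<^sup>2)) \<le> exp (pi * v * B\<^sup>2) * exp (- (pi * v / 2) * (of_int n)\<^sup>2)"
      if "u \<in> {- B..B}" for n u
      using jtheta_term_le[OF assms, of u B n] that by (auto simp: abs_le_iff)
  qed
  show ?thesis
    by (rule uniform_limit_theorem[OF _ U]) (auto intro!: always_eventually continuous_intros)
qed

lemma continuous_on_UNIV_intervalsI:
  fixes f :: "real \<Rightarrow> 'a::topological_space"
  assumes "\<And>B. continuous_on {- B..B} f"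
  shows "continuous_on UNIV f"
proof (rule continuous_at_imp_continuous_on, rule ballI)
  fix x :: real
  have "continuous_on {- (\<bar>x\<bar> + 1)<..<\<bar>x\<bar> + 1} f"
    by (rule continuous_on_subset[OF assms[of "\<bar>x\<bar> + 1"]]) auto
  then show "isCont f x"
    by (subst (asm) continuous_on_eq_continuous_at) (auto dest!: bspec[of _ _ x])
qed

lemma uniform_limit_jtheta_dual:
  assumes "v > 0"
  shows "uniform_limit UNIV (\<lambda>X u. \<Sum>j\<in>X. exp (- (pi / v) * (of_int j)\<^sup>2) * cos (2 * pi * of_int j * u))
           (jtheta_dual v) (finite_subsets_at_top UNIV)"
  unfolding jtheta_dual_def
proof (rule Weierstrass_m_test_general)
  show "(\<lambda>n::int. exp (- (pi / v) * (of_int n)\<^sup>2)) summable_on UNIV"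
    using assms by (intro summable_on_exp_neg_square) auto
qed (auto simp: abs_mult mult_left_le)

lemma continuous_on_jtheta_dual:
  assumes "v > 0"
  shows "continuous_on UNIV (jtheta_dual v)"
  by (rule uniform_limit_theorem[OF _ uniform_limit_jtheta_dual[OF assms]])
     (auto intro!: always_eventually continuous_intros)

lemma integral_cos_cos:
  fixes i j :: int
  shows "integral {0..1} (\<lambda>u. cos (2 * pi * of_int i * u) * cos (2 * pi * of_int j * u))
           = (if i = j then 1/2 else 0) + (if i = - j then 1/2 else 0)"
proof -
  have base: "((\<lambda>u. cos (2 * pi * of_int n * u)) has_integral (if n = 0 then 1 else 0)) {0..1}" for n :: int
  proof (cases "n = 0")
    case False
    have "((\<lambda>u. cos (2 * pi * of_int n * u)) has_integral
        (sin (2 * pi * of_int n * 1) / (2 * pi * of_int n) - sin (2 * pi * of_int n * 0) / (2 * pi * of_int n))) {0..1}"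
      using False
      by (intro fundamental_theorem_of_calculus)
         (auto intro!: derivative_eq_intros simp: has_real_derivative_iff_has_vector_derivative[symmetric])
    then show ?thesis using False by (simp add: sin_int_2pin)
  next
    case True
    then show ?thesis using has_integral_const_real[of "1::real" 0 1] by simp
  qed
  have eq: "cos (2 * pi * of_int i * u) * cos (2 * pi * of_int j * u)
    = 1/2 * (cos (2 * pi * of_int (i - j) * u) + cos (2 * pi * of_int (i + j) * u))" for u
    using cos_times_cos[of "2 * pi * of_int i * u" "2 * pi * of_int j * u"] by (simp add: algebra_simps)
  have "((\<lambda>u. cos (2 * pi * of_int i * u) * cos (2 * pi * of_int j * u)) has_integral
     (1/2 * ((if i - j = 0 then 1 else 0) + (if i + j = 0 then 1 else 0)))) {0..1}"
    unfolding eq by (intro has_integral_mult_right has_integral_add base)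
  then show ?thesis by (auto simp: integral_unique eq_neg_iff_add_eq_0)
qed

lemma integral_cos_sin:
  fixes i j :: int
  shows "integral {0..1} (\<lambda>u. cos (2 * pi * of_int i * u) * sin (2 * pi * of_int j * u)) = 0"
proof -
  have base: "((\<lambda>u. sin (2 * pi * of_int n * u)) has_integral 0) {0..1}" for n :: int
  proof (cases "n = 0")
    case False
    have "((\<lambda>u. sin (2 * pi * of_int n * u)) has_integral
        (- cos (2 * pi * of_int n * 1) / (2 * pi * of_int n) - - cos (2 * pi * of_int n * 0) / (2 * pi * of_int n))) {0..1}"
      using False
      by (intro fundamental_theorem_of_calculus)
         (auto intro!: derivative_eq_intros simp: has_real_derivative_iff_has_vector_derivative[symmetric])
    then show ?thesis using False by (simp add: cos_int_2pin)
  qed auto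
  have eq: "cos (2 * pi * of_int i * u) * sin (2 * pi * of_int j * u)
    = 1/2 * (sin (2 * pi * of_int (i + j) * u) - sin (2 * pi * of_int (i - j) * u))" for u
    using cos_times_sin[of "2 * pi * of_int i * u" "2 * pi * of_int j * u"] by (simp add: algebra_simps)
  have "((\<lambda>u. cos (2 * pi * of_int i * u) * sin (2 * pi * of_int j * u)) has_integral
     (1/2 * (0 - 0))) {0..1}"
    unfolding eq by (intro has_integral_mult_right has_integral_diff base)
  then show ?thesis by (simp add: integral_unique)
qed

text \<open>Termwise integration by uniform convergence. The factor \<open>g\<close> stands for a
  cosine or a sine of integral frequency, for which orthogonality leaves at most two terms.\<close>

lemma jtheta_dual_fourier:
  fixes j :: int
  assumes "v > 0" and g: "continuous_on {0..1} g" "\<And>u. \<bar>g u\<bar> \<le> 1"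
  shows "integral {0..1} (\<lambda>u. jtheta_dual v u * g u)
     = (\<Sum>\<^sub>\<infinity>i::int. exp (- (pi / v) * (of_int i)\<^sup>2) * integral {0..1} (\<lambda>u. cos (2 * pi * of_int i * u) * g u))"
proof -
  define e where "e = (\<lambda>i::int. exp (- (pi / v) * (of_int i)\<^sup>2))"
  have U: "uniform_limit {0..1} (\<lambda>X u. \<Sum>i\<in>X. e i * (cos (2 * pi * of_int i * u) * g u))
           (\<lambda>u. jtheta_dual v u * g u) (finite_subsets_at_top UNIV)"
  proof (rule Weierstrass_m_test_general')
    show "(\<lambda>n::int. e n) summable_on UNIV"
      unfolding e_def using assms by (intro summable_on_exp_neg_square) auto
    show "norm (e i * (cos (2 * pi * of_int i * u) * g u)) \<le> e i" for i u
      using mult_mono[OF abs_cos_le_one[of "2 * pi * of_int i * u"] g(2)[of u]]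
      by (simp add: abs_mult e_def mult_left_le)
    show "((\<lambda>i. e i * (cos (2 * pi * of_int i * u) * g u)) has_sum jtheta_dual v u * g u) UNIV" for u
      using has_sum_cmult_left[OF has_sum_infsum[OF summable_jtheta_dual[OF assms(1), of u]], of "g u"]
      by (simp add: e_def jtheta_dual_def mult_ac)
  qed
  have ci: "(\<lambda>u. cos (2 * pi * of_int i * u) * g u) integrable_on {0..1}" for i :: int
    by (intro integrable_continuous_interval continuous_intros g)
  obtain J K where J: "\<And>X. ((\<lambda>u. \<Sum>i\<in>X. e i * (cos (2 * pi * of_int i * u) * g u)) has_integral J X) {0..1}"
    and K: "((\<lambda>u. jtheta_dual v u * g u) has_integral K) {0..1}"
    and lim: "(J \<longlongrightarrow> K) (finite_subsets_at_top UNIV)"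
    by (rule uniform_limit_integral[OF U]) (auto intro!: continuous_intros g)
  have "J X = (\<Sum>i\<in>X. e i * integral {0..1} (\<lambda>u. cos (2 * pi * of_int i * u) * g u))" if "finite X" for X
  proof -
    have "((\<lambda>u. \<Sum>i\<in>X. e i * (cos (2 * pi * of_int i * u) * g u)) has_integral
        (\<Sum>i\<in>X. e i * integral {0..1} (\<lambda>u. cos (2 * pi * of_int i * u) * g u))) {0..1}"
      using that by (intro has_integral_sum has_integral_mult_right integrable_integral ci)
    then show ?thesis using J has_integral_unique by blast
  qed
  then have "((\<lambda>X. \<Sum>i\<in>X. e i * integral {0..1} (\<lambda>u. cos (2 * pi * of_int i * u) * g u)) \<longlongrightarrow> K)
      (finite_subsets_at_top UNIV)"
    using lim by (rule_tac Lim_transform_eventually[OF lim]) (auto intro!: eventually_finite_subsets_at_top_weakI)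
  then have "((\<lambda>i. e i * integral {0..1} (\<lambda>u. cos (2 * pi * of_int i * u) * g u)) has_sum K) UNIV"
    by (simp add: has_sum_def)
  then show ?thesis using K by (simp add: infsumI integral_unique e_def)
qed

text \<open>Both sides are continuous, have period 1 and share their Fourier coefficients: on the
  left by unfolding onto the line and the Fourier transform of the Gaussian, on the right by
  orthogonality.\<close>

theorem jtheta_functional_equation:
  assumes v: "v > 0"
  shows "jtheta v u = jtheta_dual v u / sqrt v"
proof -
  define H where "H = (\<lambda>u. jtheta v u - jtheta_dual v u / sqrt v)"
  have cT: "continuous_on UNIV (jtheta v)"
    by (intro continuous_on_UNIV_intervalsI continuous_on_jtheta v)
  have cD: "continuous_on UNIV (jtheta_dual v)"
    by (intro continuous_on_jtheta_dual v)
  have cH: "continuous_on UNIV H"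
    unfolding H_def by (intro continuous_intros cT cD) (use v in auto)
  define G where "G = (\<lambda>x. exp (- (pi * v) * x\<^sup>2))"
  have cG: "continuous_on UNIV G" unfolding G_def by (intro continuous_intros)
  have G_bound: "\<bar>G (of_int n + u)\<bar> \<le> exp (pi * v * 1\<^sup>2) * exp (- (pi * v / 2) * (of_int n)\<^sup>2)"
    if "u \<in> {0..1}" for n u
    using jtheta_term_le[OF v, of u 1 n] that by (simp add: G_def)
  have G_sum: "(\<lambda>n::int. exp (pi * v * 1\<^sup>2) * exp (- (pi * v / 2) * (of_int n)\<^sup>2)) summable_on UNIV"
    using v by (intro summable_on_cmult_right summable_on_exp_neg_square) auto
  have T: "integral {0..1} (\<lambda>u. jtheta v u * g u) = I"
    if g: "continuous_on UNIV g" "\<And>u. \<bar>g u\<bar> \<le> 1" "\<And>n u. g (of_int n + u) = g u"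
      and I: "has_bochner_integral lborel (\<lambda>x. G x * g x) I" for g I
  proof -
    have "integral {0..1} (\<lambda>u. \<Sum>\<^sub>\<infinity>n. G (of_int n + u) * g (of_int n + u)) = I"
    proof (rule integral_periodization[OF _ _ G_sum I])
      show "continuous_on UNIV (\<lambda>x. G x * g x)" by (intro continuous_intros cG g)
      show "\<bar>G (of_int n + u) * g (of_int n + u)\<bar> \<le> exp (pi * v * 1\<^sup>2) * exp (- (pi * v / 2) * (of_int n)\<^sup>2)"
        if "u \<in> {0..1}" for n u
        using mult_mono[OF G_bound[OF that, of n] g(2)[of "of_int n + u"]] by (simp add: abs_mult)
    qed
    moreover have "(\<Sum>\<^sub>\<infinity>n. G (of_int n + u) * g (of_int n + u)) = jtheta v u * g u" for u
      unfolding g(3) jtheta_def G_def by (rule infsum_cmult_left')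
    ultimately show ?thesis by simp
  qed
  have shift: "2 * pi * of_int j * (of_int n + u) = 2 * pi * of_int j * u + 2 * pi * of_int (j * n)" for j n :: int and u :: real
    by (simp add: algebra_simps)
  have pc: "cos (2 * pi * of_int j * (of_int n + u)) = cos (2 * pi * of_int j * u)" for j n :: int and u :: real
    unfolding shift cos_add cos_int_2pin sin_int_2pin by simp
  have ps: "sin (2 * pi * of_int j * (of_int n + u)) = sin (2 * pi * of_int j * u)" for j n :: int and u :: real
    unfolding shift sin_add cos_int_2pin sin_int_2pin by simp
  have Tc: "integral {0..1} (\<lambda>u. jtheta v u * cos (2 * pi * of_int j * u)) = exp (- (pi / v) * (of_int j)\<^sup>2) / sqrt v" for j :: int
    by (rule T) (use gaussian_fourier(1)[OF v, of "of_int j"] pc in \<open>auto intro!: continuous_intros simp: G_def\<close>)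
  have Ts: "integral {0..1} (\<lambda>u. jtheta v u * sin (2 * pi * of_int j * u)) = 0" for j :: int
    by (rule T) (use gaussian_fourier(2)[OF v, of "of_int j"] ps in \<open>auto intro!: continuous_intros simp: G_def\<close>)
  have Dc: "integral {0..1} (\<lambda>u. jtheta_dual v u * cos (2 * pi * of_int j * u)) = exp (- (pi / v) * (of_int j)\<^sup>2)" for j :: int
  proof -
    have "integral {0..1} (\<lambda>u. jtheta_dual v u * cos (2 * pi * of_int j * u))
      = (\<Sum>\<^sub>\<infinity>i::int. exp (- (pi / v) * (of_int i)\<^sup>2) * ((if i = j then 1/2 else 0) + (if i = - j then 1/2 else 0)))"
      by (subst jtheta_dual_fourier[OF v]) (auto intro!: continuous_intros simp: integral_cos_cos)
    also have "\<dots> = (\<Sum>\<^sub>\<infinity>i\<in>{j, - j}. exp (- (pi / v) * (of_int i)\<^sup>2) * ((if i = j then 1/2 else 0) + (if i = - j then 1/2 else 0)))"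
      by (rule infsum_cong_neutral) auto
    also have "\<dots> = exp (- (pi / v) * (of_int j)\<^sup>2)"
      by (cases "j = 0") auto
    finally show ?thesis .
  qed
  have Ds: "integral {0..1} (\<lambda>u. jtheta_dual v u * sin (2 * pi * of_int j * u)) = 0" for j :: int
    by (subst jtheta_dual_fourier[OF v]) (auto intro!: continuous_intros simp: integral_cos_sin)
  have split: "integral {0..1} (\<lambda>u. H u * g u) = integral {0..1} (\<lambda>u. jtheta v u * g u) - integral {0..1} (\<lambda>u. jtheta_dual v u * g u) / sqrt v"
    if "continuous_on UNIV g" for g
  proof -
    have "(\<lambda>u. jtheta v u * g u) integrable_on {0..1}" "(\<lambda>u. jtheta_dual v u * g u) integrable_on {0..1}"
      by (rule integrable_continuous_interval, rule continuous_on_mult;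
          rule continuous_on_subset[where s = UNIV]; use cT cD that in simp)+
    then have "((\<lambda>u. jtheta v u * g u - jtheta_dual v u * g u / sqrt v) has_integral
      (integral {0..1} (\<lambda>u. jtheta v u * g u) - integral {0..1} (\<lambda>u. jtheta_dual v u * g u) / sqrt v)) {0..1}"
      by (intro has_integral_diff has_integral_divide integrable_integral)
    moreover have "H u * g u = jtheta v u * g u - jtheta_dual v u * g u / sqrt v" for u
      by (simp add: H_def algebra_simps)
    ultimately show ?thesis by (simp add: integral_unique)
  qed
  have nf: "null_fourier H"
    unfolding null_fourier_def
  proof (intro conjI allI cH)
    fix j :: int
    show "integral {0..1} (\<lambda>u. H u * cos (2 * pi * of_int j * u)) = 0"
      by (subst split) (auto intro!: continuous_intros simp only: Tc Dc)
    show "integral {0..1} (\<lambda>u. H u * sin (2 * pi * of_int j * u)) = 0"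
      by (subst split) (auto intro!: continuous_intros simp only: Ts Ds)
  qed
  define w where "w = u + of_int (- \<lfloor>u\<rfloor>)"
  have Hw: "H w = H u" unfolding w_def H_def jtheta_shift jtheta_dual_shift ..
  have w: "0 \<le> w" "w < 1" unfolding w_def by (simp_all add: floor_le_iff) linarith+
  have "H w = 0"
  proof (cases "w = 0")
    case False
    then show ?thesis using null_fourier_eq_0[OF nf] w by simp
  next
    \<comment> \<open>Uniqueness has been shown at interior points only; the value at 0 is the limit
      from the right.\<close>
    case True
    have "(H \<longlongrightarrow> H 0) (at_right 0)"
      using cH by (simp add: continuous_on_eq_continuous_at continuous_at_imp_continuous_at_within continuous_within[symmetric])
    moreover have "\<forall>\<^sub>F x in at_right 0. H x = 0"
      by (rule eventually_at_rightI[of 0 1]) (use null_fourier_eq_0[OF nf] in auto)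
    ultimately have "((\<lambda>_. 0) \<longlongrightarrow> H 0) (at_right (0::real))"
      using tendsto_cong[of H "\<lambda>_. 0"] by blast
    then have "H 0 = 0" by (simp add: tendsto_const_iff)
    then show ?thesis using True by simp
  qed
  then show ?thesis using Hw by (simp add: H_def)
qed

section \<open>Bounds for the one-dimensional theta function\<close>

lemma jtheta_pos:
  assumes "v > 0"
  shows "jtheta v u > 0"
proof -
  have "0 < exp (- (pi * v) * (of_int 0 + u)\<^sup>2)" by simp
  also have "\<dots> = (\<Sum>\<^sub>\<infinity>n\<in>{0::int}. exp (- (pi * v) * (of_int n + u)\<^sup>2))" by simp
  also have "\<dots> \<le> jtheta v u"
    unfolding jtheta_def by (rule infsum_mono2[OF _ summable_jtheta[OF assms]]) auto
  finally show ?thesis .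
qed

text \<open>Visible only on the dual side: all Fourier coefficients are positive, and every cosine
  is largest at 0.\<close>

lemma jtheta_le_jtheta_0:
  assumes "v > 0"
  shows "jtheta v u \<le> jtheta v 0"
proof -
  have "jtheta_dual v u \<le> jtheta_dual v 0"
    unfolding jtheta_dual_def
    by (rule infsum_mono[OF summable_jtheta_dual[OF assms] summable_jtheta_dual[OF assms]]) simp
  then show ?thesis using assms by (simp add: jtheta_functional_equation divide_right_mono)
qed

lemma jtheta_inverse:
  assumes "v > 0"
  shows "jtheta v 0 = jtheta (1 / v) 0 / sqrt v"
  by (subst jtheta_functional_equation[OF assms]) (simp add: jtheta_dual_def jtheta_def)

text \<open>From (n + 1)^2 \<ge> 1 + 3n the terms on either side of 0 are dominated by a geometric
  series of ratio exp (-3 pi v).\<close>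

lemma jtheta_upper:
  assumes "v > 0"
  shows "jtheta v 0 \<le> 1 + 2 * exp (- (pi * v)) / (1 - exp (- (3 * pi * v)))"
proof -
  define f where "f = (\<lambda>n::int. exp (- (pi * v) * (of_int n)\<^sup>2))"
  define q where "q = exp (- (3 * pi * v))"
  have q: "0 < q" "q < 1" using assms by (auto simp: q_def)
  have s: "f summable_on UNIV" unfolding f_def using assms by (intro summable_on_exp_neg_square) auto
  have bound: "f (int (Suc n)) \<le> exp (- (pi * v)) * q ^ n" for n
  proof -
    have "(1 + real n)\<^sup>2 \<ge> 1 + 3 * real n"
      by (cases n) (auto simp: power2_eq_square algebra_simps)
    then have "- (pi * v) * (1 + real n)\<^sup>2 \<le> - (pi * v) * (1 + 3 * real n)"
      using assms by (intro mult_left_mono_neg) auto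
    then show ?thesis
      by (simp add: f_def q_def exp_of_nat_mult[symmetric] exp_add[symmetric] algebra_simps)
  qed
  have hs: "((\<lambda>n. exp (- (pi * v)) * q ^ n) has_sum (exp (- (pi * v)) * (1 / (1 - q)))) UNIV"
    using q geometric_sums[of q] by (intro has_sum_cmult_right sums_nonneg_imp_has_sum) auto
  have pos: "infsum f {1..} \<le> exp (- (pi * v)) * (1 / (1 - q))"
  proof -
    have b: "bij_betw (\<lambda>n. int (Suc n)) UNIV {1..}"
      by (rule bij_betwI[where g = "\<lambda>k. nat (k - 1)"]) auto
    have s1: "f summable_on {1..}" using s summable_on_subset_banach by blast
    have "infsum f {1..} = (\<Sum>\<^sub>\<infinity>n. f (int (Suc n)))"
      using infsum_reindex_bij_betw[OF b] by metis
    also have "\<dots> \<le> (\<Sum>\<^sub>\<infinity>n. exp (- (pi * v)) * q ^ n)"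
    proof (rule infsum_mono)
      show "(\<lambda>n. f (int (Suc n))) summable_on UNIV"
        using summable_on_reindex_bij_betw[OF b, of f] s1 by simp
      show "(\<lambda>n. exp (- (pi * v)) * q ^ n) summable_on UNIV"
        using hs by (auto simp: summable_on_def)
    qed (use bound in auto)
    also have "\<dots> = exp (- (pi * v)) * (1 / (1 - q))" using hs by (rule infsumI)
    finally show ?thesis .
  qed
  have neg: "infsum f {..-1} = infsum f {1..}"
  proof -
    have b: "bij_betw uminus {1..} {..-1::int}"
      by (rule bij_betwI[where g = uminus]) auto
    show ?thesis using infsum_reindex_bij_betw[OF b, of f] by (simp add: f_def)
  qed
  have "jtheta v 0 = infsum f ({0} \<union> ({1..} \<union> {..-1}))"
    unfolding jtheta_def f_def by (rule infsum_cong_neutral) auto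
  also have "\<dots> = infsum f {0} + infsum f ({1..} \<union> {..-1})"
    by (rule infsum_Un_disjoint) (auto intro: summable_on_subset_banach[OF s])
  also have "infsum f ({1..} \<union> {..-1}) = infsum f {1..} + infsum f {..-1}"
    by (rule infsum_Un_disjoint) (auto intro: summable_on_subset_banach[OF s])
  finally have "jtheta v 0 = 1 + 2 * infsum f {1..}" using neg by (simp add: f_def)
  then show ?thesis using pos by (simp add: q_def)
qed

section \<open>The theta function of a lattice\<close>

text \<open>The quadratic form of determinant 1 of the lattice spanned by z and 1. Both lattice sums
  depend on z only through its values, so symmetries of the sums become statements about index
  maps.\<close>

definition lattice_form :: "complex \<Rightarrow> int \<times> int \<Rightarrow> real" where
  "lattice_form z = (\<lambda>(m, n). (cmod (of_int m * z + of_int n))\<^sup>2 / Im z)"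

lemma lattice_form_eq:
  "lattice_form z (m, n) = ((of_int n + of_int m * Re z)\<^sup>2 + (of_int m)\<^sup>2 * (Im z)\<^sup>2) / Im z"
proof -
  have "(cmod (of_int m * z + of_int n))\<^sup>2 = (of_int n + of_int m * Re z)\<^sup>2 + (of_int m)\<^sup>2 * (Im z)\<^sup>2"
    unfolding cmod_power2 by (simp add: power_mult_distrib add.commute)
  then show ?thesis by (simp add: lattice_form_def)
qed

lemma lattice_form_nonneg: "Im z > 0 \<Longrightarrow> lattice_form z v \<ge> 0"
  by (cases v) (simp add: lattice_form_eq)

lemma lattice_theta_form:
  "lattice_theta t z = (\<Sum>\<^sub>\<infinity>v. exp (- (pi * t) * lattice_form z v))"
  unfolding lattice_theta_def lattice_form_def by (simp add: case_prod_unfold)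

text \<open>Positive definiteness with an explicit constant, by which products of one-dimensional
  series dominate the lattice sums. \<open>K\<close> comes from writing n as (n + m x) - m x and
  bounding the square of the difference by twice the sum of squares.\<close>

lemma lattice_form_ge:
  assumes "Im z > 0"
  obtains c where "c > 0" "\<And>m n. lattice_form z (m, n) \<ge> c * ((of_int m)\<^sup>2 + (of_int n)\<^sup>2)"
proof -
  define x y where "x = Re z" and "y = Im z"
  have y: "y > 0" using assms by (simp add: y_def)
  define K where "K = 2 + (2 * x\<^sup>2 + 1) / y\<^sup>2"
  have K: "K > 0" using y by (simp add: K_def add_pos_nonneg)
  have "(of_int m)\<^sup>2 + (of_int n)\<^sup>2 \<le> K * ((of_int n + of_int m * x)\<^sup>2 + (of_int m)\<^sup>2 * y\<^sup>2)" for m n :: int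
  proof -
    define A M where "A = of_int n + of_int m * x" and "M = (of_int m :: real)"
    have n: "of_int n = A - M * x" by (simp add: A_def M_def)
    have "(A + M * x)\<^sup>2 \<ge> 0" by simp
    then have "M\<^sup>2 + (A - M * x)\<^sup>2 \<le> 2 * A\<^sup>2 + (2 * x\<^sup>2 + 1) * M\<^sup>2"
      by (simp add: power2_eq_square algebra_simps)
    also have "\<dots> = 2 * A\<^sup>2 + (2 * x\<^sup>2 + 1) / y\<^sup>2 * (M\<^sup>2 * y\<^sup>2)"
      using y by simp
    also have "\<dots> \<le> K * A\<^sup>2 + K * (M\<^sup>2 * y\<^sup>2)"
      unfolding K_def using y by (intro add_mono mult_right_mono) auto
    finally show ?thesis unfolding n by (simp add: M_def[symmetric] algebra_simps)
  qed
  then have "((of_int m)\<^sup>2 + (of_int n)\<^sup>2) / K \<le> (of_int n + of_int m * x)\<^sup>2 + (of_int m)\<^sup>2 * y\<^sup>2" for m n :: int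
    using K by (simp add: pos_divide_le_eq mult.commute)
  then have "((of_int m)\<^sup>2 + (of_int n)\<^sup>2) / K / y \<le> lattice_form z (m, n)" for m n
    unfolding lattice_form_eq x_def[symmetric] y_def[symmetric] using y by (intro divide_right_mono) auto
  then show ?thesis using K y by (intro that[of "1 / (K * y)"]) auto
qed

lemma summable_on_product_nonneg:
  fixes f :: "'a \<Rightarrow> real" and g :: "'b \<Rightarrow> real"
  assumes "f summable_on A" "g summable_on B" "\<And>x. x \<in> A \<Longrightarrow> f x \<ge> 0" "\<And>x. x \<in> B \<Longrightarrow> g x \<ge> 0"
  shows "(\<lambda>(x, y). f x * g y) summable_on A \<times> B"
proof (rule summable_on_SigmaI)
  show "((\<lambda>y. case (x, y) of (x, y) \<Rightarrow> f x * g y) has_sum f x * infsum g B) B" if "x \<in> A" for x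
    using has_sum_cmult_right[OF has_sum_infsum[OF assms(2)], of "f x"] by simp
  show "(\<lambda>x. f x * infsum g B) summable_on A"
    using assms(1) by (rule summable_on_cmult_left)
qed (use assms in auto)

lemma summable_exp_neg_sum_squares:
  fixes a b :: real
  assumes "a > 0" "b > 0"
  shows "(\<lambda>(m::int, n::int). exp (- a * (of_int m)\<^sup>2) * exp (- b * (of_int n)\<^sup>2)) summable_on UNIV"
  using summable_on_product_nonneg[OF summable_on_exp_neg_square[OF assms(1)] summable_on_exp_neg_square[OF assms(2)]]
  by simp

lemma summable_lattice_theta:
  assumes "Im z > 0" "a > 0"
  shows "(\<lambda>v. exp (- a * lattice_form z v)) summable_on UNIV"
proof -
  obtain c where c: "c > 0" "\<And>m n. lattice_form z (m, n) \<ge> c * ((of_int m)\<^sup>2 + (of_int n)\<^sup>2)"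
    using lattice_form_ge[OF assms(1)] by metis
  have "a * (c * ((of_int m)\<^sup>2 + (of_int n)\<^sup>2)) \<le> a * lattice_form z (m, n)" for m n :: int
    using c(2) assms(2) by (intro mult_left_mono) auto
  then have le: "exp (- a * lattice_form z (m, n)) \<le> exp (- (a * c) * (of_int m)\<^sup>2) * exp (- (a * c) * (of_int n)\<^sup>2)" for m n
    by (simp add: exp_add[symmetric] algebra_simps)
  show ?thesis
    by (rule summable_on_comparison_test[OF summable_exp_neg_sum_squares[of "a * c" "a * c"]])
       (use c(1) assms(2) le in \<open>auto simp del: mult_minus_left\<close>)
qed

lemma lattice_theta_rows:
  assumes "Im z > 0" "t > 0"
  shows "lattice_theta t z = (\<Sum>\<^sub>\<infinity>m::int. exp (- (pi * (t * Im z)) * (of_int m)\<^sup>2) * jtheta (t / Im z) (of_int m * Re z))"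
    and "(\<lambda>m::int. exp (- (pi * (t * Im z)) * (of_int m)\<^sup>2) * jtheta (t / Im z) (of_int m * Re z)) summable_on UNIV"
proof -
  have s: "(\<lambda>v. exp (- (pi * t) * lattice_form z v)) summable_on UNIV \<times> UNIV"
    using summable_lattice_theta[OF assms(1), of "pi * t"] assms(2) by simp
  have e: "exp (- (pi * t) * lattice_form z (m, n))
      = exp (- (pi * (t * Im z)) * (of_int m)\<^sup>2) * exp (- (pi * (t / Im z)) * (of_int n + of_int m * Re z)\<^sup>2)" for m n
    unfolding exp_add[symmetric] lattice_form_eq using assms(1) by (simp add: field_simps power2_eq_square)
  have i: "(\<Sum>\<^sub>\<infinity>n. exp (- (pi * t) * lattice_form z (m, n)))
      = exp (- (pi * (t * Im z)) * (of_int m)\<^sup>2) * jtheta (t / Im z) (of_int m * Re z)" for m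
    unfolding e jtheta_def by (rule infsum_cmult_right')
  show "lattice_theta t z = (\<Sum>\<^sub>\<infinity>m::int. exp (- (pi * (t * Im z)) * (of_int m)\<^sup>2) * jtheta (t / Im z) (of_int m * Re z))"
    using infsum_Sigma_banach[OF s] unfolding i lattice_theta_form by simp
  show "(\<lambda>m::int. exp (- (pi * (t * Im z)) * (of_int m)\<^sup>2) * jtheta (t / Im z) (of_int m * Re z)) summable_on UNIV"
    using summable_on_Sigma_banach[of "\<lambda>m n. exp (- (pi * t) * lattice_form z (m, n))" UNIV "\<lambda>_. UNIV"] s
    unfolding i by (simp add: case_prod_unfold)
qed

text \<open>Each row is largest without its translation, so the rectangular lattice of the same
  height gives an upper bound, which factors.\<close>

lemma lattice_theta_le:
  assumes "Im z > 0" "t > 0"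
  shows "lattice_theta t z \<le> jtheta (t * Im z) 0 * jtheta (t / Im z) 0"
proof -
  have "lattice_theta t z \<le> (\<Sum>\<^sub>\<infinity>m::int. exp (- (pi * (t * Im z)) * (of_int m)\<^sup>2) * jtheta (t / Im z) 0)"
    unfolding lattice_theta_rows(1)[OF assms]
  proof (rule infsum_mono[OF lattice_theta_rows(2)[OF assms]])
    show "(\<lambda>m::int. exp (- (pi * (t * Im z)) * (of_int m)\<^sup>2) * jtheta (t / Im z) 0) summable_on UNIV"
      using assms by (intro summable_on_cmult_left summable_on_exp_neg_square) auto
    show "exp (- (pi * (t * Im z)) * (of_int m)\<^sup>2) * jtheta (t / Im z) (of_int m * Re z)
       \<le> exp (- (pi * (t * Im z)) * (of_int m)\<^sup>2) * jtheta (t / Im z) 0" for m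
      using jtheta_le_jtheta_0[of "t / Im z"] assms by (intro mult_left_mono) auto
  qed
  also have "\<dots> = jtheta (t * Im z) 0 * jtheta (t / Im z) 0"
    by (subst infsum_cmult_left') (simp add: jtheta_def)
  finally show ?thesis .
qed

text \<open>Poisson summation in n alone suffices: it yields the terms \<open>E t m j\<close>, and
  replacing t by 1/t exchanges the roles of m and j.\<close>

theorem lattice_theta_functional_equation:
  assumes "Im z > 0" "t > 0"
  shows "lattice_theta (1 / t) z = t * lattice_theta t z"
proof -
  define y x where "y = Im z" and "x = Re z"
  have y: "y > 0" using assms by (simp add: y_def)
  define E where "E = (\<lambda>t (m::int) (j::int). exp (- (pi * (t * y)) * (of_int m)\<^sup>2) * (exp (- (pi * (y / t)) * (of_int j)\<^sup>2) * cos (2 * pi * of_int j * (of_int m * x))))"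
  have row: "sqrt (t / y) * lattice_theta t z = (\<Sum>\<^sub>\<infinity>m. \<Sum>\<^sub>\<infinity>j. E t m j)" if "t > 0" for t
  proof -
    have "lattice_theta t z = (\<Sum>\<^sub>\<infinity>m::int. (exp (- (pi * (t * y)) * (of_int m)\<^sup>2) * jtheta_dual (t / y) (of_int m * x)) * (1 / sqrt (t / y)))"
      using lattice_theta_rows(1)[OF assms(1) that] jtheta_functional_equation[of "t / y"] that y
      by (simp add: y_def x_def)
    also have "\<dots> = (\<Sum>\<^sub>\<infinity>m::int. exp (- (pi * (t * y)) * (of_int m)\<^sup>2) * jtheta_dual (t / y) (of_int m * x)) * (1 / sqrt (t / y))"
      by (rule infsum_cmult_left')
    finally have "sqrt (t / y) * lattice_theta t z
        = (\<Sum>\<^sub>\<infinity>m::int. exp (- (pi * (t * y)) * (of_int m)\<^sup>2) * jtheta_dual (t / y) (of_int m * x))"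
      using that y by simp
    also have "\<dots> = (\<Sum>\<^sub>\<infinity>m. \<Sum>\<^sub>\<infinity>j. E t m j)"
      unfolding E_def jtheta_dual_def by (simp add: infsum_cmult_right')
    finally show ?thesis .
  qed
  have s: "(\<lambda>(m, j). E t m j) summable_on UNIV \<times> UNIV"
  proof (rule abs_summable_summable, rule summable_on_comparison_test)
    show "(\<lambda>(m::int, n::int). exp (- (pi * (t * y)) * (of_int m)\<^sup>2) * exp (- (pi * (y / t)) * (of_int n)\<^sup>2)) summable_on UNIV \<times> UNIV"
      using summable_exp_neg_sum_squares[of "pi * (t * y)" "pi * (y / t)"] assms(2) y by simp
  qed (auto simp: E_def abs_mult mult_left_le)
  have sw: "E (1 / t) m j = E t j m" for m j
    by (simp add: E_def mult_ac)
  have "sqrt (1 / t / y) * lattice_theta (1 / t) z = (\<Sum>\<^sub>\<infinity>m. \<Sum>\<^sub>\<infinity>j. E t j m)"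
    using row[of "1 / t"] assms(2) sw by simp
  also have "\<dots> = sqrt (t / y) * lattice_theta t z"
    using row[OF assms(2)] infsum_swap_banach[OF s] by simp
  also have "sqrt (t / y) = t * sqrt (1 / t / y)"
  proof -
    have "t / y = t\<^sup>2 * (1 / t / y)" using assms(2) by (simp add: power2_eq_square)
    then have "sqrt (t / y) = sqrt (t\<^sup>2 * (1 / t / y))" by (rule arg_cong)
    then show ?thesis using assms(2) by (simp only: real_sqrt_mult real_sqrt_abs abs_of_pos)
  qed
  finally show ?thesis using assms(2) y by simp
qed

lemma lattice_theta_antimono:
  assumes "Im z > 0" "0 < t" "t \<le> t'"
  shows "lattice_theta t' z \<le> lattice_theta t z"
  unfolding lattice_theta_form
proof (rule infsum_mono)
  show "exp (- (pi * t') * lattice_form z v) \<le> exp (- (pi * t) * lattice_form z v)" for v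
    using lattice_form_nonneg[OF assms(1), of v] assms by (auto intro!: mult_right_mono)
qed (use assms summable_lattice_theta[of z "pi * t"] summable_lattice_theta[of z "pi * t'"] in auto)

lemma lattice_theta_ge_partial:
  assumes "Im z > 0" "t > 0" "finite F"
  shows "(\<Sum>v\<in>F. exp (- (pi * t) * lattice_form z v)) \<le> lattice_theta t z"
  unfolding lattice_theta_form
  by (rule finite_sum_le_infsum) (use assms summable_lattice_theta[of z "pi * t"] in auto)

section \<open>Mellin representation of the zeta function\<close>

lemma nn_integral_powr_exp:
  fixes s a :: real
  assumes "s > 0" "a > 0"
  shows "(\<integral>\<^sup>+t. ennreal (indicator {0<..} t * (t powr (s - 1) * exp (- a * t))) \<partial>lborel) = ennreal (Gamma s / a powr s)"
proof -
  let ?f = "\<lambda>t. ennreal (indicator {0..} t * t powr (s - 1) / exp t)"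
  have "ennreal (Gamma s) = (\<integral>\<^sup>+t. ?f t \<partial>lborel)"
    using Gamma_conv_nn_integral_real[OF assms(1)] .
  also have "\<dots> = ennreal a * (\<integral>\<^sup>+t. ?f (0 + a * t) \<partial>lborel)"
    using assms(2) by (subst nn_integral_real_affine[of ?f a 0]) auto
  also have "(\<integral>\<^sup>+t. ?f (0 + a * t) \<partial>lborel)
      = (\<integral>\<^sup>+t. ennreal (a powr (s - 1)) * ennreal (indicator {0<..} t * (t powr (s - 1) * exp (- a * t))) \<partial>lborel)"
    using assms
    by (intro nn_integral_cong)
       (auto simp: indicator_def powr_mult zero_le_mult_iff exp_minus field_simps simp flip: ennreal_mult)
  also have "\<dots> = ennreal (a powr (s - 1)) * (\<integral>\<^sup>+t. ennreal (indicator {0<..} t * (t powr (s - 1) * exp (- a * t))) \<partial>lborel)"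
    by (subst nn_integral_cmult) auto
  finally have "ennreal (Gamma s) = ennreal (a powr s) * (\<integral>\<^sup>+t. ennreal (indicator {0<..} t * (t powr (s - 1) * exp (- a * t))) \<partial>lborel)"
    using assms(2) by (simp add: mult.assoc[symmetric] ennreal_mult[symmetric] powr_mult_base)
  then have "ennreal (1 / a powr s) * ennreal (Gamma s)
     = ennreal (1 / a powr s) * ennreal (a powr s) * (\<integral>\<^sup>+t. ennreal (indicator {0<..} t * (t powr (s - 1) * exp (- a * t))) \<partial>lborel)"
    by (simp add: mult.assoc)
  then show ?thesis
    using assms Gamma_real_pos[of s] by (simp add: ennreal_mult[symmetric])
qed

text \<open>Shifting t by 1 and using that t powr (s - 1) is nondecreasing compares the tail with
  the whole Gamma integral, at the price of the factor exp (-a).\<close>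

lemma nn_integral_powr_exp_tail:
  fixes s a :: real
  assumes "s \<ge> 1" "a > 0"
  shows "ennreal (exp (- a) * (Gamma s / a powr s))
     \<le> (\<integral>\<^sup>+t. ennreal (indicator {1..} t * (t powr (s - 1) * exp (- a * t))) \<partial>lborel)"
proof -
  let ?f = "\<lambda>t. ennreal (indicator {1..} t * (t powr (s - 1) * exp (- a * t)))"
  have "ennreal (exp (- a) * (Gamma s / a powr s))
      = (\<integral>\<^sup>+t. ennreal (exp (- a)) * ennreal (indicator {0<..} t * (t powr (s - 1) * exp (- a * t))) \<partial>lborel)"
  proof (subst nn_integral_cmult)
    show "ennreal (exp (- a) * (Gamma s / a powr s))
      = ennreal (exp (- a)) * (\<integral>\<^sup>+t. ennreal (indicator {0<..} t * (t powr (s - 1) * exp (- a * t))) \<partial>lborel)"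
      using assms by (subst nn_integral_powr_exp) (auto simp only: ennreal_mult' exp_ge_zero)
  qed measurable
  also have "\<dots> \<le> (\<integral>\<^sup>+t. ?f (1 + 1 * t) \<partial>lborel)"
  proof (rule nn_integral_mono)
    fix t :: real
    have "exp (- a) * (t powr (s - 1) * exp (- a * t)) \<le> (1 + t) powr (s - 1) * exp (- a * (1 + t))" if "t > 0"
    proof -
      have "t powr (s - 1) \<le> (1 + t) powr (s - 1)" using that assms by (intro powr_mono2) auto
      then have "t powr (s - 1) * (exp (- a) * exp (- a * t)) \<le> (1 + t) powr (s - 1) * (exp (- a) * exp (- a * t))"
        by (intro mult_right_mono) auto
      moreover have "exp (- a * (1 + t)) = exp (- a) * exp (- a * t)"
        unfolding exp_add[symmetric] by (simp add: algebra_simps)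
      ultimately show ?thesis by (simp only: mult_ac)
    qed
    then show "ennreal (exp (- a)) * ennreal (indicator {0<..} t * (t powr (s - 1) * exp (- a * t))) \<le> ?f (1 + 1 * t)"
      by (auto simp: indicator_def ennreal_mult[symmetric] intro!: ennreal_leI)
  qed
  also have "\<dots> = (\<integral>\<^sup>+t. ?f t \<partial>lborel)"
    using nn_integral_real_affine[of ?f 1 1] by simp
  finally show ?thesis .
qed

text \<open>Normalised so that \<open>exp (- (pi * t) * q)\<close> has integral
  \<open>q powr (- s)\<close>; the indicator allows integration over the whole line.\<close>

definition mellin_weight :: "real \<Rightarrow> real \<Rightarrow> real" where
  "mellin_weight s t = indicator {0<..} t * (pi powr s / Gamma s * t powr (s - 1))"

lemma borel_measurable_mellin_weight [measurable]: "mellin_weight s \<in> borel_measurable borel"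
  unfolding mellin_weight_def by measurable

lemma mellin_weight_nonneg: "s > 0 \<Longrightarrow> mellin_weight s t \<ge> 0"
  unfolding mellin_weight_def by (auto simp: Gamma_real_pos less_imp_le indicator_def)

lemma nn_integral_mellin_exp:
  assumes "s > 0" "q > 0"
  shows "(\<integral>\<^sup>+t. ennreal (mellin_weight s t * exp (- (pi * t) * q)) \<partial>lborel) = ennreal (q powr (- s))"
proof -
  have "(\<integral>\<^sup>+t. ennreal (mellin_weight s t * exp (- (pi * t) * q)) \<partial>lborel)
    = (\<integral>\<^sup>+t. ennreal (pi powr s / Gamma s) * ennreal (indicator {0<..} t * (t powr (s - 1) * exp (- (pi * q) * t))) \<partial>lborel)"
    using assms unfolding mellin_weight_def
    by (intro nn_integral_cong) (auto simp: indicator_def ennreal_mult[symmetric] Gamma_real_pos less_imp_le mult_ac)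
  also have "\<dots> = ennreal (pi powr s / Gamma s) * ennreal (Gamma s / (pi * q) powr s)"
    using assms by (subst nn_integral_cmult, measurable) (simp only: nn_integral_powr_exp mult_pos_pos pi_gt_zero)
  also have "\<dots> = ennreal (q powr (- s))"
    using assms Gamma_real_pos[of s] by (simp add: ennreal_mult[symmetric] powr_mult powr_minus_divide less_imp_le order_less_imp_not_eq2)
  finally show ?thesis .
qed

lemma nn_integral_mellin_exp_tail:
  assumes "s \<ge> 1" "a > 0"
  shows "ennreal (exp (- a) * (pi / a) powr s)
     \<le> (\<integral>\<^sup>+t. ennreal (mellin_weight s t * (indicator {1..} t * exp (- a * t))) \<partial>lborel)"
proof -
  have "(\<integral>\<^sup>+t. ennreal (mellin_weight s t * (indicator {1..} t * exp (- a * t))) \<partial>lborel)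
    = (\<integral>\<^sup>+t. ennreal (pi powr s / Gamma s) * ennreal (indicator {1..} t * (t powr (s - 1) * exp (- a * t))) \<partial>lborel)"
    using assms unfolding mellin_weight_def
    by (intro nn_integral_cong) (auto simp: indicator_def ennreal_mult[symmetric] Gamma_real_pos less_imp_le mult_ac)
  also have "\<dots> = ennreal (pi powr s / Gamma s) * (\<integral>\<^sup>+t. ennreal (indicator {1..} t * (t powr (s - 1) * exp (- a * t))) \<partial>lborel)"
    by (subst nn_integral_cmult) auto
  also have "\<dots> \<ge> ennreal (pi powr s / Gamma s) * ennreal (exp (- a) * (Gamma s / a powr s))"
    by (intro mult_left_mono nn_integral_powr_exp_tail assms) auto
  also have "ennreal (pi powr s / Gamma s) * ennreal (exp (- a) * (Gamma s / a powr s)) = ennreal (exp (- a) * (pi / a) powr s)"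
    using assms Gamma_real_pos[of s] by (simp add: ennreal_mult[symmetric] powr_divide less_imp_le order_less_imp_not_eq2)
  finally show ?thesis .
qed

text \<open>For x = t / (2 pi) the inequality x^s \<le> x + x^12 holds throughout 1 \<le> s \<le>
  12. Integrated against exp (-t) it bounds Gamma by 1! and 12!, uniformly in s. The scale 2 pi
  matches the factor pi^s 2^s in the mass of [1,2].\<close>

lemma Gamma_plus1_le:
  fixes s :: real
  assumes "1 \<le> s" "s \<le> 12"
  shows "Gamma (s + 1) \<le> (2 * pi) powr s * (1 / (2 * pi) + fact 12 / (2 * pi) ^ 12)"
proof -
  let ?b = "2 * pi"
  let ?g = "\<lambda>c t. indicator {0..} t * t powr (c + 1 - 1) / exp t :: real"
  have b: "?b > 0" by simp
  have le: "(t / ?b) powr s \<le> t powr 1 / ?b + t powr 12 / ?b ^ 12" if "t \<ge> 0" for t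
  proof -
    have x: "t / ?b \<ge> 0" using that by simp
    have "(t / ?b) powr s \<le> (t / ?b) powr 1 + (t / ?b) powr 12"
    proof (cases "t / ?b \<le> 1")
      case True
      have "(t / ?b) powr s \<le> (t / ?b) powr 1" by (rule powr_mono'[OF assms(1) x True])
      moreover have "0 \<le> (t / ?b) powr 12" by simp
      ultimately show ?thesis by linarith
    next
      case False
      then have "(t / ?b) powr s \<le> (t / ?b) powr 12" using assms by (intro powr_mono) auto
      then show ?thesis using x by (simp add: add_increasing)
    qed
    also have "(t / ?b) powr 12 = t powr 12 / ?b ^ 12"
      using that by (simp add: powr_divide powr_numeral)
    finally show ?thesis using that by simp
  qed
  have "ennreal (Gamma (s + 1)) = (\<integral>\<^sup>+t. ennreal (?g s t) \<partial>lborel)"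
    using Gamma_conv_nn_integral_real[of "s + 1"] assms by simp
  also have "\<dots> \<le> (\<integral>\<^sup>+t. (ennreal (?b powr s / ?b) * ennreal (?g 1 t) + ennreal (?b powr s / ?b ^ 12) * ennreal (?g 12 t)) \<partial>lborel)"
  proof (rule nn_integral_mono)
    fix t :: real
    have "t powr s / exp t \<le> (?b powr s / ?b) * (t powr 1 / exp t) + (?b powr s / ?b ^ 12) * (t powr 12 / exp t)" if t: "t \<ge> 0"
    proof -
      have "t powr s = ?b powr s * (t / ?b) powr s" using t by (simp add: powr_divide)
      also have "\<dots> \<le> ?b powr s * (t powr 1 / ?b + t powr 12 / ?b ^ 12)"
        by (intro mult_left_mono le t) auto
      finally have "t powr s / exp t \<le> ?b powr s * (t powr 1 / ?b + t powr 12 / ?b ^ 12) / exp t"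
        by (intro divide_right_mono) auto
      then show ?thesis by (simp add: field_simps)
    qed
    then show "ennreal (?g s t) \<le> ennreal (?b powr s / ?b) * ennreal (?g 1 t) + ennreal (?b powr s / ?b ^ 12) * ennreal (?g 12 t)"
      by (auto simp: indicator_def ennreal_mult[symmetric] ennreal_plus[symmetric] simp del: ennreal_plus intro!: ennreal_leI)
  qed
  also have "\<dots> = ennreal (?b powr s / ?b) * ennreal (Gamma (1 + 1)) + ennreal (?b powr s / ?b ^ 12) * ennreal (Gamma (12 + 1))"
    by (subst nn_integral_add, measurable, subst (1 2) nn_integral_cmult, measurable,
        subst (1 2) Gamma_conv_nn_integral_real) simp_all
  also have "\<dots> = ennreal (?b powr s / ?b * 1 + ?b powr s / ?b ^ 12 * fact 12)"
    using Gamma_fact[of 1, where 'a = real] Gamma_fact[of 12, where 'a = real]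
    by (simp add: ennreal_mult[symmetric] ennreal_plus[symmetric] del: ennreal_plus)
  finally show ?thesis
    by (subst (asm) ennreal_le_iff) (auto simp: algebra_simps)
qed

text \<open>The mass equals pi^s (2^s - 1) / Gamma (s + 1). With 2^s - 1 \<ge> 2^s / 2 and Gamma (s
  + 1) \<le> 29/100 * (2 pi)^s it is at least 50/29.\<close>

lemma nn_integral_mellin_weight_1_2:
  assumes "1 \<le> s" "s \<le> 12"
  shows "ennreal (17/10) \<le> (\<integral>\<^sup>+t. ennreal (mellin_weight s t * indicator {1..2} t) \<partial>lborel)"
proof -
  have G: "Gamma s > 0" using assms by (intro Gamma_real_pos) auto
  have "((\<lambda>t. t powr (s - 1)) has_integral (2 powr s / s - 1 powr s / s)) {1..2}"
    using assms
    by (intro fundamental_theorem_of_calculus)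
       (auto intro!: derivative_eq_intros simp: has_real_derivative_iff_has_vector_derivative[symmetric])
  then have "(\<integral>\<^sup>+t. ennreal (indicator {1..2} t * t powr (s - 1)) \<partial>lborel) = ennreal (2 powr s / s - 1 powr s / s)"
    by (intro nn_integral_has_integral_lebesgue) auto
  moreover have "ennreal (indicator {1..2} t * t powr (s - 1)) = ennreal (t powr (s - 1)) * indicator {1..2} t" for t :: real
    by (auto simp: indicator_def)
  ultimately have "(\<integral>\<^sup>+t. ennreal (t powr (s - 1)) * indicator {1..2} t \<partial>lborel) = ennreal (2 powr s / s - 1 powr s / s)"
    by simp
  then have I: "(\<integral>\<^sup>+t. ennreal (t powr (s - 1)) * indicator {1..2} t \<partial>lborel) = ennreal ((2 powr s - 1) / s)"
    by (simp add: diff_divide_distrib)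
  have "(\<integral>\<^sup>+t. ennreal (mellin_weight s t * indicator {1..2} t) \<partial>lborel)
      = (\<integral>\<^sup>+t. ennreal (pi powr s / Gamma s) * (ennreal (t powr (s - 1)) * indicator {1..2} t) \<partial>lborel)"
    using G unfolding mellin_weight_def
    by (intro nn_integral_cong) (auto simp: indicator_def ennreal_mult[symmetric])
  also have "\<dots> = ennreal (pi powr s / Gamma s * ((2 powr s - 1) / s))"
    using assms G by (subst nn_integral_cmult) (auto simp: I ennreal_mult[symmetric] ge_one_powr_ge_zero)
  finally have eq: "(\<integral>\<^sup>+t. ennreal (mellin_weight s t * indicator {1..2} t) \<partial>lborel) = ennreal (pi powr s / Gamma s * ((2 powr s - 1) / s))" .
  have "s \<notin> \<int>\<^sub>\<le>\<^sub>0" using assms by (auto elim!: nonpos_Ints_cases)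
  then have Gs: "Gamma (s + 1) = s * Gamma s" by (rule Gamma_plus1)
  have b: "1 / (2 * pi) + fact 12 / (2 * pi) ^ 12 \<le> 29 / 100"
  proof -
    have p: "6.283 \<le> 2 * pi" using pi_approx by simp
    have "1 / (2 * pi) \<le> 1 / 6.283" using p by (intro divide_left_mono) auto
    moreover have "fact 12 / (2 * pi) ^ 12 \<le> fact 12 / 6.283 ^ 12"
      using p by (intro divide_left_mono power_mono) auto
    moreover have "1 / 6.283 + fact 12 / 6.283 ^ 12 \<le> (29 / 100 :: real)"
      by (simp add: fact_numeral power_divide)
    ultimately show ?thesis by linarith
  qed
  have p: "2 powr s \<ge> 2" using assms powr_mono[of 1 s 2] by simp
  have "17/10 * (s * Gamma s) = 17/10 * Gamma (s + 1)" by (simp add: Gs)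
  also have "\<dots> \<le> 17/10 * ((2 * pi) powr s * (1 / (2 * pi) + fact 12 / (2 * pi) ^ 12))"
    using Gamma_plus1_le[OF assms] by simp
  also have "\<dots> \<le> 17/10 * ((2 * pi) powr s * (29/100))"
    using b by (intro mult_left_mono) auto
  also have "\<dots> \<le> 1/2 * (2 * pi) powr s" by simp
  also have "\<dots> = pi powr s * (2 powr s / 2)" by (simp add: powr_mult)
  also have "\<dots> \<le> pi powr s * (2 powr s - 1)" using p by (intro mult_left_mono) auto
  finally have "17/10 \<le> pi powr s / Gamma s * ((2 powr s - 1) / s)"
    using G assms by (simp add: field_simps)
  then show ?thesis unfolding eq by (rule ennreal_leI)
qed

lemma epstein_zeta_form:
  assumes "Im z > 0"
  shows "epstein_zeta s z = (\<Sum>\<^sub>\<infinity>v\<in>UNIV - {(0, 0)}. lattice_form z v powr (- s))"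
  unfolding epstein_zeta_def
proof (rule infsum_cong)
  fix v :: "int \<times> int"
  obtain m n where v: "v = (m, n)" by (cases v)
  have "lattice_form z v powr (- s) = Im z powr s / cmod (of_int m * z + of_int n) powr (2 * s)"
    using assms
    by (simp add: lattice_form_def v powr_divide powr_minus_divide powr_powr[symmetric] powr_numeral)
  then show "(case v of (m, n) \<Rightarrow> Im z powr s / cmod (of_int m * z + of_int n) powr (2 * s)) = lattice_form z v powr (- s)"
    by (simp add: v)
qed

lemma lattice_form_pos:
  assumes "Im z > 0" "v \<noteq> (0, 0)"
  shows "lattice_form z v > 0"
proof -
  obtain m n where v: "v = (m, n)" by (cases v)
  obtain c where c: "c > 0" "\<And>m n. lattice_form z (m, n) \<ge> c * ((of_int m)\<^sup>2 + (of_int n)\<^sup>2)"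
    using lattice_form_ge[OF assms(1)] by metis
  have "(of_int m)\<^sup>2 + (of_int n)\<^sup>2 > (0::real)"
    using assms(2) by (auto simp: v sum_power2_gt_zero_iff)
  then have "c * ((of_int m)\<^sup>2 + (of_int n)\<^sup>2) > 0" using c(1) by simp
  then show ?thesis using c(2)[of m n] unfolding v by linarith
qed

text \<open>Away from the origin max(|m|,1) * max(|n|,1) \<le> m^2 + n^2, so a product of two
  one-dimensional series with exponent s > 1 is a majorant.\<close>

lemma summable_epstein_zeta:
  assumes "Im z > 0" "s > 1"
  shows "(\<lambda>v. lattice_form z v powr (- s)) summable_on UNIV - {(0, 0)}"
proof -
  define h where "h = (\<lambda>n::int. (max \<bar>of_int n\<bar> 1) powr (- s) :: real)"
  obtain c where c: "c > 0" "\<And>m n. lattice_form z (m, n) \<ge> c * ((of_int m)\<^sup>2 + (of_int n)\<^sup>2)"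
    using lattice_form_ge[OF assms(1)] by metis
  have h: "h summable_on UNIV"
  proof (rule summable_on_int_even)
    have "summable (\<lambda>n::nat. real n powr (- s))"
      using assms(2) by (subst summable_real_powr_iff) auto
    then show "summable (\<lambda>n::nat. h (int n))"
    proof (subst summable_cong)
      show "\<forall>\<^sub>F n in sequentially. h (int n) = real n powr (- s)"
        using eventually_ge_at_top[of 1] by eventually_elim (auto simp: h_def max_def)
    qed
  qed (auto simp: h_def)
  have hh: "(\<lambda>(m, n). h m * h n) summable_on UNIV \<times> UNIV"
    by (rule summable_on_product_nonneg[OF h h]) (auto simp: h_def)
  have "(\<lambda>v. c powr (- s) * (case v of (m, n) \<Rightarrow> h m * h n)) summable_on UNIV - {(0, 0)}"
    by (intro summable_on_cmult_right summable_on_subset_banach[OF hh]) auto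
  then show ?thesis
  proof (rule summable_on_comparison_test)
    fix v :: "int \<times> int"
    assume v0: "v \<in> UNIV - {(0, 0)}"
    obtain m n where v: "v = (m, n)" by (cases v)
    define M N where "M = (\<bar>of_int m\<bar> :: real)" and "N = (\<bar>of_int n\<bar> :: real)"
    have MN: "M = 0 \<or> M \<ge> 1" "N = 0 \<or> N \<ge> 1" "M \<noteq> 0 \<or> N \<noteq> 0" using v0 by (auto simp: M_def N_def v)
    have "max M 1 * max N 1 \<le> M\<^sup>2 + N\<^sup>2"
    proof (cases "M = 0 \<or> N = 0")
      case True
      then show ?thesis using MN by (auto simp: power2_eq_square)
    next
      case False
      have "(M - N)\<^sup>2 \<ge> 0" by simp
      then have "2 * (M * N) \<le> M\<^sup>2 + N\<^sup>2" by (simp add: power2_eq_square algebra_simps)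
      moreover have "M * N \<ge> 0" using False MN by auto
      ultimately have "M * N \<le> M\<^sup>2 + N\<^sup>2" by linarith
      then show ?thesis using False MN by auto
    qed
    then have "c * (max M 1 * max N 1) \<le> c * ((of_int m)\<^sup>2 + (of_int n)\<^sup>2)"
      using c(1) by (intro mult_left_mono) (auto simp: M_def N_def)
    also have "\<dots> \<le> lattice_form z v" using c(2) by (simp add: v)
    finally have "lattice_form z v powr (- s) \<le> (c * (max M 1 * max N 1)) powr (- s)"
      using c(1) assms(2) by (intro powr_mono2') auto
    also have "\<dots> = c powr (- s) * (h m * h n)"
      using c(1) by (simp add: powr_mult h_def M_def N_def)
    finally show "lattice_form z v powr (- s) \<le> c powr (- s) * (case v of (m, n) \<Rightarrow> h m * h n)"
      by (simp add: v)
  qed auto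
qed

lemma nn_integral_count_space_infsum:
  fixes f :: "'a \<Rightarrow> real"
  assumes "f summable_on A" "\<And>x. x \<in> A \<Longrightarrow> f x \<ge> 0"
  shows "(\<integral>\<^sup>+x. ennreal (f x) \<partial>count_space A) = ennreal (infsum f A)"
proof -
  have "Infinite_Sum.abs_summable_on f A"
    using assms by (subst summable_on_cong[where g = f]) auto
  then have "Infinite_Set_Sum.abs_summable_on f A"
    by (rule iffD1[OF abs_summable_equivalent])
  then show ?thesis
    using nn_integral_conv_infsetsum[of f A] infsetsum_infsum[of f A] assms(2) by simp
qed

lemma lattice_theta_minus_1:
  assumes "Im z > 0" "t > 0"
  shows "lattice_theta t z - 1 = (\<Sum>\<^sub>\<infinity>v\<in>UNIV - {(0, 0)}. exp (- (pi * t) * lattice_form z v))"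
proof -
  have s: "(\<lambda>v. exp (- (pi * t) * lattice_form z v)) summable_on UNIV"
    using summable_lattice_theta[OF assms(1), of "pi * t"] assms(2) by simp
  have s0: "(\<lambda>v. exp (- (pi * t) * lattice_form z v)) summable_on UNIV - {(0, 0)}"
    by (rule summable_on_subset_banach[OF s]) auto
  have "lattice_theta t z = (\<Sum>\<^sub>\<infinity>v\<in>{(0, 0)} \<union> (UNIV - {(0, 0)}). exp (- (pi * t) * lattice_form z v))"
    unfolding lattice_theta_form by (rule infsum_cong_neutral) auto
  also have "\<dots> = exp (- (pi * t) * lattice_form z (0, 0)) + (\<Sum>\<^sub>\<infinity>v\<in>UNIV - {(0, 0)}. exp (- (pi * t) * lattice_form z v))"
    by (subst infsum_Un_disjoint[OF _ s0]) auto
  finally show ?thesis by (simp add: lattice_form_eq)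
qed

lemma lattice_theta_ge_1: "Im z > 0 \<Longrightarrow> t > 0 \<Longrightarrow> lattice_theta t z \<ge> 1"
  using lattice_theta_minus_1[of z t] infsum_nonneg[of "UNIV - {(0, 0)}" "\<lambda>v. exp (- (pi * t) * lattice_form z v)"]
  by simp

text \<open>Tonelli's theorem for lattice vectors and t; each vector contributes its own Mellin
  integral. Measurability in t comes from writing the integrand as an integral over counting
  measure, and later permits adding integrals.\<close>

theorem epstein_zeta_mellin:
  assumes "Im z > 0" "s > 1"
  shows "ennreal (epstein_zeta s z) = (\<integral>\<^sup>+t. ennreal (mellin_weight s t * (lattice_theta t z - 1)) \<partial>lborel)"
    and "(\<lambda>t. ennreal (mellin_weight s t * (lattice_theta t z - 1))) \<in> borel_measurable borel"
proof -
  let ?A = "UNIV - {(0 :: int, 0 :: int)}"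
  let ?f = "\<lambda>v t. ennreal (mellin_weight s t * exp (- (pi * t) * lattice_form z v))"
  have A: "countable ?A" by simp
  have inner: "(\<integral>\<^sup>+v. ?f v t \<partial>count_space ?A) = ennreal (mellin_weight s t * (lattice_theta t z - 1))" for t
  proof (cases "t > 0")
    case True
    have "pi * t > 0" using True by simp
    then have su: "(\<lambda>v. exp (- (pi * t) * lattice_form z v)) summable_on ?A"
      by (rule summable_on_subset_banach[OF summable_lattice_theta[OF assms(1)]]) auto
    have "(\<integral>\<^sup>+v. ?f v t \<partial>count_space ?A) = ennreal (\<Sum>\<^sub>\<infinity>v\<in>?A. mellin_weight s t * exp (- (pi * t) * lattice_form z v))"
      using su assms(2) by (intro nn_integral_count_space_infsum summable_on_cmult_right) (auto simp: mellin_weight_nonneg)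
    also have "(\<Sum>\<^sub>\<infinity>v\<in>?A. mellin_weight s t * exp (- (pi * t) * lattice_form z v)) = mellin_weight s t * (lattice_theta t z - 1)"
      by (simp only: infsum_cmult_right' lattice_theta_minus_1[OF assms(1) True])
    finally show ?thesis .
  next
    case False
    then show ?thesis by (simp add: mellin_weight_def)
  qed
  have "ennreal (epstein_zeta s z) = (\<integral>\<^sup>+v. ennreal (lattice_form z v powr (- s)) \<partial>count_space ?A)"
    unfolding epstein_zeta_form[OF assms(1)]
    by (rule nn_integral_count_space_infsum[symmetric]) (auto intro: summable_epstein_zeta assms)
  also have "\<dots> = (\<integral>\<^sup>+v. \<integral>\<^sup>+t. ?f v t \<partial>lborel \<partial>count_space ?A)"
  proof (rule nn_integral_cong)
    fix v assume "v \<in> space (count_space ?A)"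
    then have "lattice_form z v > 0" by (intro lattice_form_pos assms(1)) simp
    then show "ennreal (lattice_form z v powr - s) = (\<integral>\<^sup>+t. ?f v t \<partial>lborel)"
      using nn_integral_mellin_exp[of s "lattice_form z v"] assms(2) by simp
  qed
  also have "\<dots> = (\<integral>\<^sup>+t. \<integral>\<^sup>+v. ?f v t \<partial>count_space ?A \<partial>lborel)"
    by (rule nn_integral_count_space_nn_integral[symmetric, OF A]) measurable
  finally show "ennreal (epstein_zeta s z) = (\<integral>\<^sup>+t. ennreal (mellin_weight s t * (lattice_theta t z - 1)) \<partial>lborel)"
    unfolding inner .
  interpret sigma_finite_measure "count_space ?A"
    by (rule sigma_finite_measure_count_space_countable) simp
  have "(\<lambda>(v, t). ?f v t) \<in> borel_measurable (count_space ?A \<Otimes>\<^sub>M borel)"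
    by (rule measurable_pair_measure_countable1[OF A]) simp
  then have "(\<lambda>(t, v). ?f v t) \<in> borel_measurable (borel \<Otimes>\<^sub>M count_space ?A)"
    using measurable_pair_swap by fastforce
  then have "(\<lambda>t. \<integral>\<^sup>+v. ?f v t \<partial>count_space ?A) \<in> borel_measurable borel"
    by (intro borel_measurable_nn_integral) auto
  then show "(\<lambda>t. ennreal (mellin_weight s t * (lattice_theta t z - 1))) \<in> borel_measurable borel"
    unfolding inner .
qed

lemma epstein_zeta_nonneg: "epstein_zeta s z \<ge> 0"
  unfolding epstein_zeta_def by (rule infsum_nonneg) auto

text \<open>The functional equation at both points carries the sign of the difference from 1/t to t;
  for t < 1 only this sign is used and the gain is dropped.\<close>

lemma epstein_zeta_diff_ge:
  assumes z: "Im z > 0" and w: "Im w > 0" and s: "s > 1"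
    and diff: "\<And>t. t \<ge> 1 \<Longrightarrow> lattice_theta t z - lattice_theta t w \<ge> g t"
    and g: "\<And>t. t \<ge> 1 \<Longrightarrow> g t \<ge> 0"
    and [measurable]: "g \<in> borel_measurable borel"
    and I: "I \<ge> 0" "ennreal I \<le> (\<integral>\<^sup>+t. ennreal (mellin_weight s t * (indicator {1..} t * g t)) \<partial>lborel)"
  shows "epstein_zeta s z \<ge> epstein_zeta s w + I"
proof -
  have ge: "lattice_theta t z - lattice_theta t w \<ge> indicator {1..} t * g t" if "t > 0" for t
  proof (cases "t \<ge> 1")
    case True
    then show ?thesis using diff[of t] by simp
  next
    case False
    then have t: "1 / t \<ge> 1" using that by simp
    have "0 \<le> lattice_theta (1 / t) z - lattice_theta (1 / t) w"
      using diff[OF t] g[OF t] by linarith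
    also have "\<dots> = t * (lattice_theta t z - lattice_theta t w)"
      using lattice_theta_functional_equation[OF z that] lattice_theta_functional_equation[OF w that]
      by (simp add: algebra_simps)
    finally have "0 \<le> lattice_theta t z - lattice_theta t w" using that by (simp add: zero_le_mult_iff)
    then show ?thesis using False by simp
  qed
  note [measurable] = epstein_zeta_mellin(2)[OF w s]
  have "ennreal (epstein_zeta s w + I) = ennreal (epstein_zeta s w) + ennreal I"
    using epstein_zeta_nonneg I(1) by (rule ennreal_plus)
  also have "\<dots> \<le> (\<integral>\<^sup>+t. ennreal (mellin_weight s t * (lattice_theta t w - 1)) \<partial>lborel)
      + (\<integral>\<^sup>+t. ennreal (mellin_weight s t * (indicator {1..} t * g t)) \<partial>lborel)"
    unfolding epstein_zeta_mellin(1)[OF w s] by (intro add_left_mono I(2))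
  also have "\<dots> = (\<integral>\<^sup>+t. (ennreal (mellin_weight s t * (lattice_theta t w - 1)) + ennreal (mellin_weight s t * (indicator {1..} t * g t))) \<partial>lborel)"
    by (rule nn_integral_add[symmetric]) measurable
  also have "\<dots> \<le> (\<integral>\<^sup>+t. ennreal (mellin_weight s t * (lattice_theta t z - 1)) \<partial>lborel)"
  proof (rule nn_integral_mono)
    fix t :: real
    show "ennreal (mellin_weight s t * (lattice_theta t w - 1)) + ennreal (mellin_weight s t * (indicator {1..} t * g t))
       \<le> ennreal (mellin_weight s t * (lattice_theta t z - 1))"
    proof (cases "t > 0")
      case True
      have m: "mellin_weight s t \<ge> 0" using s by (simp add: mellin_weight_nonneg)
      have n1: "0 \<le> mellin_weight s t * (lattice_theta t w - 1)"
        using m lattice_theta_ge_1[OF w True] by simp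
      have n2: "0 \<le> mellin_weight s t * (indicator {1..} t * g t)"
        using m g by (auto simp: indicator_def)
      have "mellin_weight s t * (lattice_theta t w - 1) + mellin_weight s t * (indicator {1..} t * g t)
         = mellin_weight s t * (lattice_theta t w - 1 + indicator {1..} t * g t)"
        by (simp add: algebra_simps)
      also have "\<dots> \<le> mellin_weight s t * (lattice_theta t z - 1)"
        using m ge[OF True] by (intro mult_left_mono) auto
      finally show ?thesis unfolding ennreal_plus[OF n1 n2, symmetric] by (rule ennreal_leI)
    qed (simp add: mellin_weight_def)
  qed
  also have "\<dots> = ennreal (epstein_zeta s z)"
    by (rule epstein_zeta_mellin(1)[OF z s, symmetric])
  finally show ?thesis
    using epstein_zeta_nonneg by (simp add: ennreal_le_iff)
qed

section \<open>The three shortest vectors\<close>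

text \<open>The Lagrange remainder carries an even power of x, so the bound holds for arguments of
  either sign.\<close>

lemma exp_ge_Taylor_even:
  fixes x :: real
  assumes "even n"
  shows "(\<Sum>m<n. x ^ m / fact m) \<le> exp x"
proof -
  obtain t where t: "exp x = (\<Sum>m<n. x ^ m / fact m) + exp t / fact n * x ^ n"
    using Maclaurin_exp_le[of x n] by blast
  have "exp t / fact n * x ^ n \<ge> 0"
    using assms by (intro mult_nonneg_nonneg) (auto simp: zero_le_even_power)
  then show ?thesis using t by simp
qed

lemma exp_ge_cubic: "1 + x + x\<^sup>2 / 2 + x ^ 3 / 6 \<le> exp (x::real)"
proof -
  have "(\<Sum>m<4. x ^ m / fact m) \<le> exp x" by (rule exp_ge_Taylor_even) simp
  then show ?thesis by (simp add: eval_nat_numeral)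
qed

text \<open>For numerical bounds on \<open>exp x\<close>: \<open>c\<close> is the Taylor polynomial at \<open>x/8\<close>, rounded down to a short fraction.\<close>

lemma exp_ge_eighth_power:
  fixes x h c L :: real
  assumes "x = 8 * h" "0 \<le> c" "c \<le> 1 + h + h ^ 2 / 2 + h ^ 3 / 6 + h ^ 4 / 24 + h ^ 5 / 120" "L \<le> c ^ 8"
  shows "L \<le> exp x"
proof -
  have "c \<le> exp h"
  proof -
    have "(\<Sum>m<6. h ^ m / fact m) \<le> exp h" by (rule exp_ge_Taylor_even) simp
    then show ?thesis using assms(3) by (simp add: eval_nat_numeral)
  qed
  then have "c ^ 8 \<le> exp h ^ 8" using assms(2) by (intro power_mono)
  also have "\<dots> = exp x" by (simp add: assms(1) exp_of_nat_mult[symmetric])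
  finally show ?thesis using assms(4) by simp
qed

text \<open>Reduces upper bounds for exp (-x) to lower bounds for exp, the only kind that the Taylor
  polynomials above provide.\<close>

lemma exp_neg_le:
  fixes x y B :: real
  assumes "1 / B \<le> exp y" "B > 0" "y \<le> x"
  shows "exp (- x) \<le> B"
proof -
  have "1 / B \<le> exp x" using assms(1,3) by (meson exp_le_cancel_iff order_trans)
  then have "1 \<le> B * exp x" using assms(2) by (simp add: field_simps)
  then show ?thesis by (simp add: exp_minus field_simps)
qed

lemma exp_neg_ge:
  fixes x y B :: real
  assumes "B \<le> exp (- y)" "x \<le> y"
  shows "B \<le> exp (- x)"
  using assms by (meson exp_le_cancel_iff neg_le_iff_le order_trans)

text \<open>\<open>hexq\<close> is the value of the quadratic form of the hexagonal lattice on its shortest vectors, and \<open>hexa\<close> the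
  corresponding term of the theta series at parameter 1.\<close>

definition hexq :: real where "hexq = 2 / sqrt 3"

lemma hexq_bounds: "115470/100000 \<le> hexq" "hexq \<le> 115471/100000"
  and hexq_squared: "hexq\<^sup>2 = 4 / 3" and hexq_pos: "hexq > 0"
proof -
  show "hexq\<^sup>2 = 4 / 3" by (simp add: hexq_def power_divide)
  show pos: "hexq > 0" by (simp add: hexq_def)
  show "115470/100000 \<le> hexq"
    by (rule power2_le_imp_le) (use pos \<open>hexq\<^sup>2 = 4 / 3\<close> in \<open>auto simp: power2_eq_square\<close>)
  show "hexq \<le> 115471/100000"
    by (rule power2_le_imp_le) (use pos \<open>hexq\<^sup>2 = 4 / 3\<close> in \<open>auto simp: power2_eq_square\<close>)
qed

definition hexa :: real where "hexa = exp (- (pi * hexq))"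

text \<open>The exponents 36274/10000 here and 36277/10000 in the next bound enclose pi *
  hexq.\<close>

lemma exp_bound_hexa_upper: "1 / (266/10000) \<le> exp (36274/10000 :: real)"
  by (rule exp_ge_eighth_power[where h = "18137/40000" and c = "15736799/10000000"]) (simp_all add: power_divide)

lemma exp_bound_hexa_lower: "2656/100000 \<le> exp (- (36277/10000) :: real)"
  by (rule exp_ge_eighth_power[where h = "-36277/80000" and c = "397133/625000"]) (simp_all add: power_divide)

lemma exp_bound_pi: "1 / (433/10000) \<le> exp (6283/2000 :: real)"
  by (rule exp_ge_eighth_power[where h = "6283/16000" and c = "14809501/10000000"]) (simp_all add: power_divide)

text \<open>The exponent lies just below 31415/10000 * 10/13, a lower bound for pi * Q when Q \<ge>
  10/13.\<close>

lemma exp_bound_1013: "1 / (893/10000) \<le> exp (4833/2000 :: real)"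
  by (rule exp_ge_eighth_power[where h = "4833/16000" and c = "6763223/5000000"]) (simp_all add: power_divide)

lemma exp_bound_07: "1 / (7/10) \<le> exp (37/100 :: real)"
  by (rule exp_ge_eighth_power[where h = "37/800" and c = "5236681/5000000"]) (simp_all add: power_divide)

lemma exp_bound_0030: "1 / (30/1000) \<le> exp (439/125 :: real)"
  by (rule exp_ge_eighth_power[where h = "439/1000" and c = "7755723/5000000"]) (simp_all add: power_divide)

lemma pi_bounds: "31415/10000 \<le> pi" "pi \<le> 31416/10000"
  using pi_approx by simp_all

lemma hexa_bounds: "2656/100000 \<le> hexa" "hexa \<le> 266/10000"
proof -
  have "31415/10000 * (115470/100000) \<le> pi * hexq" "pi * hexq \<le> 31416/10000 * (115471/100000)"
    using pi_bounds hexq_bounds by (intro mult_mono; simp)+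
  then have "36274/10000 \<le> pi * hexq" "pi * hexq \<le> 36277/10000" by simp_all
  then have "exp (- (36277/10000)) \<le> hexa" "hexa \<le> exp (- (36274/10000))"
    unfolding hexa_def by simp_all
  then show "2656/100000 \<le> hexa" "hexa \<le> 266/10000"
    using exp_bound_hexa_lower exp_neg_le[OF exp_bound_hexa_upper, of "36274/10000"] by linarith+
qed

section \<open>First-order increase over the three shortest vectors\<close>

lemma cosh_ge_quadratic: "1 + x\<^sup>2 / 2 \<le> cosh (x::real)"
  using exp_ge_cubic[of x] exp_ge_cubic[of "- x"] by (simp add: cosh_def field_simps)

lemma one_minus_exp_le: "1 - exp (- x) \<le> (x::real)"
  using exp_ge_add_one_self[of "- x"] by simp

lemma diff_three_halves_square_mono:
  fixes x y :: real
  assumes "x \<le> y" "y \<le> 1 / 3"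
  shows "x - 3/2 * x\<^sup>2 \<le> y - 3/2 * y\<^sup>2"
proof -
  have "0 \<le> (y - x) * (1 - 3/2 * (x + y))" using assms by (intro mult_nonneg_nonneg) auto
  also have "\<dots> = (y - 3/2 * y\<^sup>2) - (x - 3/2 * x\<^sup>2)" by (simp add: power2_eq_square field_simps)
  finally show ?thesis by simp
qed

text \<open>In terms of \<open>e = (|z|\<^sup>2 - 1)/(2 Im z)\<close> and \<open>p = Re z/Im z\<close>, the quadratic form takes the values
  \<open>R - e\<close>, \<open>R + e\<close> and \<open>2 (R - p)\<close> on the three shortest vectors. Replacing \<open>e\<close> by \<open>0\<close> decreases
  \<open>\<Sum>(a\<^sub>i - 3/2 a\<^sub>i\<^sup>2)\<close>; afterwards this sum decreases as \<open>p\<close> grows from \<open>1/4\<close> to its hexagonal value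
  \<open>hexq/2\<close>, and is large enough for \<open>p \<le> 1/4\<close>.\<close>

lemma first_shell_isosceles:
  fixes e p :: real
  assumes p: "0 \<le> p" "p \<le> hexq / 2" and e: "0 \<le> e" "e \<le> 37/100"
  defines "R \<equiv> sqrt (1 + e\<^sup>2 + p\<^sup>2)" and "R0 \<equiv> sqrt (1 + p\<^sup>2)"
  assumes Re: "10/13 \<le> R - e"
  defines "a1 \<equiv> exp (- (pi * (R - e)))" and "a2 \<equiv> exp (- (pi * (R + e)))" and "a3 \<equiv> exp (- (pi * (2 * (R - p))))"
    and "g0 \<equiv> exp (- (pi * R0))" and "b0 \<equiv> exp (- (pi * (2 * (R0 - p))))"
  shows "2 * (g0 - 3/2 * g0\<^sup>2) + (b0 - 3/2 * b0\<^sup>2)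
      \<le> (a1 - 3/2 * a1\<^sup>2) + (a2 - 3/2 * a2\<^sup>2) + (a3 - 3/2 * a3\<^sup>2)"
proof -
  \<comment> \<open>\<open>E\<close> is the unit in which gain and loss are measured: R grows by at
    most E / (2 R0), while the mean of the two outer terms gains the factor cosh (pi e) \<ge> 1 +
    pi^2 E / 2.\<close>
  define E where "E = e\<^sup>2"
  have E: "0 \<le> E" "E \<le> 137/1000"
  proof -
    have "e\<^sup>2 \<le> (37/100)\<^sup>2" using e by (intro power_mono) auto
    then show "E \<le> 137/1000" by (simp add: E_def power2_eq_square)
  qed (simp add: E_def)
  have R0: "R0 \<ge> 1" "R0\<^sup>2 = 1 + p\<^sup>2" by (auto simp: R0_def)
  have R: "R\<^sup>2 = R0\<^sup>2 + E" "R \<ge> R0" by (auto simp: R_def R0_def E_def intro!: real_sqrt_le_mono)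
  define D where "D = R - R0"
  have D0: "D \<ge> 0" using R by (simp add: D_def)
  have "D * (R + R0) = E" using R by (simp add: D_def power2_eq_square algebra_simps)
  moreover have "D * (2 * R0) \<le> D * (R + R0)" using D0 R by (intro mult_left_mono) auto
  ultimately have DE: "D * (2 * R0) \<le> E" by simp
  define g where "g = exp (- (pi * R))"
  define X where "X = (a1 + a2) / 2"
  have g_eq: "g = g0 * exp (- (pi * D))"
    by (simp add: g_def g0_def D_def exp_add[symmetric] algebra_simps)
  have a3_eq: "a3 = b0 * exp (- (2 * pi * D))"
    by (simp add: a3_def b0_def D_def exp_add[symmetric] algebra_simps)
  have g0: "0 < g0" by (simp add: g0_def)
  have g0_le: "g0 \<le> 433/10000"
    unfolding g0_def by (rule exp_neg_le[OF exp_bound_pi]) (use pi_bounds R0 mult_mono[of "31415/10000" pi 1 R0] in auto)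
  have prod: "a1 * a2 = g\<^sup>2"
    by (simp add: a1_def a2_def g_def power2_eq_square exp_add[symmetric] algebra_simps)
  have sumsq: "a1\<^sup>2 + a2\<^sup>2 = 4 * X\<^sup>2 - 2 * g\<^sup>2"
    using prod by (simp add: X_def power2_eq_square algebra_simps)
  have X_eq: "X = g * cosh (pi * e)"
    by (simp add: X_def a1_def a2_def g_def cosh_def exp_add[symmetric] algebra_simps)
  have gap: "g0 * (1 - pi * D) * (1 + (pi * e)\<^sup>2 / 2) \<le> X"
    unfolding X_eq g_eq
  proof (rule mult_mono)
    show "g0 * (1 - pi * D) \<le> g0 * exp (- (pi * D))"
      using one_minus_exp_le[of "pi * D"] g0 by (intro mult_left_mono) auto
  qed (use cosh_ge_quadratic[of "pi * e"] g0 in auto)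
  have gg: "g0\<^sup>2 - g\<^sup>2 \<le> g0\<^sup>2 * (2 * pi * D)"
  proof -
    have "g\<^sup>2 = g0\<^sup>2 * exp (- (2 * pi * D))"
      by (simp add: g_eq power_mult_distrib power2_eq_square[of "exp _"] exp_add[symmetric] algebra_simps)
    then have "g0\<^sup>2 - g\<^sup>2 = g0\<^sup>2 * (1 - exp (- (2 * pi * D)))" by (simp add: algebra_simps)
    then show ?thesis using one_minus_exp_le[of "2 * pi * D"] by (simp add: mult_left_mono)
  qed
  have bb: "b0 - a3 \<le> b0 * (2 * pi * D)"
  proof -
    have "b0 - a3 = b0 * (1 - exp (- (2 * pi * D)))" by (simp add: a3_eq algebra_simps)
    then show ?thesis using one_minus_exp_le[of "2 * pi * D"] by (simp add: b0_def mult_left_mono)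
  qed
  have ab: "0 < a3" "a3 \<le> b0"
    unfolding a3_eq using D0 by (auto simp: b0_def)
  have b3: "b0 - 3/2 * b0\<^sup>2 - (a3 - 3/2 * a3\<^sup>2) \<le> b0 - a3"
    using ab power_mono[of a3 b0 2] by simp
  have a1_le: "a1 \<le> 893/10000"
    unfolding a1_def by (rule exp_neg_le[OF exp_bound_1013]) (use Re pi_bounds mult_mono[of "31415/10000" pi "10/13" "R - e"] in auto)
  have a2_le: "a2 \<le> g0"
    unfolding a2_def g0_def using R e by simp
  have "X \<le> (893/10000 + g0) / 2"
    unfolding X_def using a1_le a2_le by (intro divide_right_mono add_mono) auto
  then have X_le: "X + g0 \<le> 893/20000 + 3/2 * g0" by (simp add: add_divide_distrib)
  have b0_eq: "b0 = g0 * exp (- (pi * (R0 - 2 * p)))"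
    by (simp add: b0_def g0_def exp_add[symmetric] algebra_simps)
  \<comment> \<open>Here \<open>q\<close>, \<open>G\<close> and \<open>\<beta>\<close> bound pi D /
    E, \<open>g0\<close> and \<open>b0 / g0\<close>, and \<open>r\<close> is a guaranteed relative
    growth of the mean \<open>X\<close> per unit of \<open>E\<close>. The condition
    \<open>num\<close> says that this growth outweighs the decrease of g^2 and of the third
    term.\<close>
  have reduce: ?thesis
    if q: "pi * D \<le> q * E" "0 \<le> q" "q * E \<le> 1" and G: "g0 \<le> G" and bg: "b0 \<le> \<beta> * g0" "0 \<le> \<beta>"
      and r: "g0 * (1 + r * E) \<le> X" "0 \<le> r"
      and num: "3 * G * (2 * q) + \<beta> * (2 * q) \<le> 2 * r * (1 - 3 * (893/20000 + 3/2 * G))"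
               "3 * (893/20000 + 3/2 * G) \<le> 1" for q G \<beta> r
  proof -
    have Xg: "X - g0 \<ge> r * E * g0" using r(1) by (simp add: algebra_simps)
    have f: "1 - 3 * (X + g0) \<ge> 1 - 3 * (893/20000 + 3/2 * G)"
      by (intro diff_left_mono mult_left_mono order_trans[OF X_le] add_left_mono G) auto
    have "g0 * E * (3 * G * (2 * q) + \<beta> * (2 * q)) \<le> g0 * E * (2 * r * (1 - 3 * (893/20000 + 3/2 * G)))"
      using num(1) g0 E by (intro mult_left_mono) auto
    also have "\<dots> = 2 * (r * E * g0) * (1 - 3 * (893/20000 + 3/2 * G))" by (simp add: algebra_simps)
    also have "\<dots> \<le> 2 * (X - g0) * (1 - 3 * (X + g0))"
      using Xg f num(2) g0 E r(2) order_trans[OF _ Xg, of 0] by (intro mult_mono) (auto intro!: mult_nonneg_nonneg)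
    finally have 1: "g0 * E * (3 * G * (2 * q)) + g0 * E * (\<beta> * (2 * q)) \<le> 2 * (X - g0) * (1 - 3 * (X + g0))"
      by (simp add: algebra_simps)
    have "3 * (g0\<^sup>2 - g\<^sup>2) \<le> 3 * (g0\<^sup>2 * (2 * pi * D))" using gg by simp
    also have "\<dots> = 3 * g0 * g0 * (2 * (pi * D))" by (simp add: power2_eq_square)
    also have "\<dots> \<le> 3 * g0 * G * (2 * (q * E))"
    proof (rule mult_mono)
      show "3 * g0 * g0 \<le> 3 * g0 * G" using g0 G by (intro mult_left_mono) auto
    qed (use q G g0 D0 in auto)
    finally have 2: "3 * (g0\<^sup>2 - g\<^sup>2) \<le> g0 * E * (3 * G * (2 * q))" by (simp add: algebra_simps)
    have "b0 - a3 \<le> b0 * (2 * pi * D)" by (rule bb)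
    also have "\<dots> \<le> \<beta> * g0 * (2 * (q * E))"
    proof (rule mult_mono)
      show "2 * pi * D \<le> 2 * (q * E)" using q by simp
    qed (use bg g0 D0 in auto)
    finally have 3: "b0 - a3 \<le> g0 * E * (\<beta> * (2 * q))" by (simp add: algebra_simps)
    have "(a1 - 3/2 * a1\<^sup>2) + (a2 - 3/2 * a2\<^sup>2) - 2 * (g0 - 3/2 * g0\<^sup>2)
       = 2 * (X - g0) * (1 - 3 * (X + g0)) - 3 * (g0\<^sup>2 - g\<^sup>2)"
    proof -
      have "(a1 - 3/2 * a1\<^sup>2) + (a2 - 3/2 * a2\<^sup>2) = 2 * X - 3/2 * (a1\<^sup>2 + a2\<^sup>2)"
        by (simp add: X_def algebra_simps)
      then show ?thesis unfolding sumsq by (simp add: power2_eq_square algebra_simps)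
    qed
    then show ?thesis using 1 2 3 b3 by linarith
  qed
  \<comment> \<open>4934/1000 and 4936/1000 enclose pi^2 / 2, and 137/1000 bounds \<open>E\<close>.
    The two subtracted terms stem from expanding (1 - q E)(1 + pi^2 E / 2).\<close>
  have gap': "g0 * (1 + r * E) \<le> X"
    if "pi * D \<le> q * E" "0 \<le> q" "q * E \<le> 1" "r \<le> 4934/1000 - q - q * (4936/1000) * (137/1000)" for q r
  proof -
    have pp: "9869/1000 \<le> pi\<^sup>2" "pi\<^sup>2 \<le> 9871/1000"
      using power_mono[OF pi_bounds(1), of 2] power_mono[OF pi_bounds(2), of 2] by (auto simp: power2_eq_square)
    have "r + q * (4936/1000) * E \<le> r + q * (4936/1000) * (137/1000)"
      using E that by (intro add_left_mono mult_left_mono) auto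
    then have "r \<le> 4934/1000 - q - q * (4936/1000) * E" using that(4) by linarith
    then have "E * r \<le> E * (4934/1000 - q - q * (4936/1000) * E)" using E by (intro mult_left_mono)
    also have "\<dots> \<le> E * (pi\<^sup>2 / 2 - q - q * (pi\<^sup>2 / 2) * E)"
    proof -
      have "q * E * (pi\<^sup>2 / 2) \<le> q * E * (4936/1000)" using pp that E by (intro mult_left_mono) auto
      then have "4934/1000 - q - q * (4936/1000) * E \<le> pi\<^sup>2 / 2 - q - q * (pi\<^sup>2 / 2) * E"
        using pp by (simp add: mult_ac)
      then show ?thesis using E by (intro mult_left_mono)
    qed
    also have "\<dots> = (1 - q * E) * (1 + pi\<^sup>2 * E / 2) - 1" by (simp add: power2_eq_square algebra_simps)
    also have "\<dots> \<le> (1 - pi * D) * (1 + pi\<^sup>2 * E / 2) - 1"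
      using that E by (intro diff_right_mono mult_right_mono) auto
    finally have "1 + r * E \<le> (1 - pi * D) * (1 + (pi * e)\<^sup>2 / 2)"
      by (simp add: E_def power_mult_distrib mult.commute)
    then have "g0 * (1 + r * E) \<le> g0 * ((1 - pi * D) * (1 + (pi * e)\<^sup>2 / 2))"
      using g0 by (intro mult_left_mono) auto
    then show ?thesis using gap by (simp add: mult.assoc)
  qed
  show ?thesis
  \<comment> \<open>For small p only R0 \<ge> 1 is available, but the third term is at most 7/10 of
    \<open>g0\<close>; for larger p it may reach \<open>g0\<close>, which the larger R0 makes up
    for.\<close>
  proof (cases "p \<le> 1/2")
    case True
    have "D * 2 \<le> D * (2 * R0)" using D0 R0 by (intro mult_left_mono) auto
    then have "pi * (D * 2) \<le> 31416/10000 * E" using DE pi_bounds E D0 by (intro mult_mono) auto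
    then have q: "pi * D \<le> 1571/1000 * E" using E by simp
    have l: "R0 - 2 * p \<ge> 118/1000"
    proof -
      have "(118/1000 + 2 * p)\<^sup>2 \<le> R0\<^sup>2"
      proof -
        have "p * p \<le> 1/2 * (1/2)" using p True by (intro mult_mono) auto
        then show ?thesis unfolding R0(2) using True by (simp add: power2_eq_square algebra_simps)
      qed
      then have "118/1000 + 2 * p \<le> R0" using R0(1) by - (rule power2_le_imp_le, auto)
      then show ?thesis by simp
    qed
    have "b0 \<le> g0 * (7/10)"
      unfolding b0_eq
      by (intro mult_left_mono exp_neg_le[OF exp_bound_07])
         (use g0 l pi_bounds mult_mono[of "31415/10000" pi "118/1000" "R0 - 2 * p"] in auto)
    then show ?thesis
      using reduce[of "1571/1000" "433/10000" "7/10" "23/10"] gap'[of "1571/1000" "23/10"] q g0_le E by simp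
  next
    case False
    have R0': "R0 \<ge> 1118/1000"
    proof -
      have "1/2 * (1/2) \<le> p * p" using False by (intro mult_mono) auto
      then have "(1118/1000)\<^sup>2 \<le> R0\<^sup>2" unfolding R0(2) by (simp add: power2_eq_square)
      then show ?thesis using R0(1) by - (rule power2_le_imp_le, auto)
    qed
    have "D * (2236/1000) \<le> D * (2 * R0)" using D0 R0' by (intro mult_left_mono) auto
    then have "pi * (D * (2236/1000)) \<le> 31416/10000 * E" using DE pi_bounds E D0 by (intro mult_mono) auto
    then have "(2236/1000) * (pi * D) \<le> 31416/10000 * E" by (simp only: mult_ac)
    then have q: "pi * D \<le> 14051/10000 * E" using E by linarith
    have "2 * p \<le> R0"
    proof -
      have "p\<^sup>2 \<le> (hexq / 2)\<^sup>2" using p by (intro power_mono) auto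
      then have "(2 * p)\<^sup>2 \<le> R0\<^sup>2" unfolding R0(2) using hexq_squared by (simp add: power_mult_distrib power_divide)
      then show ?thesis using R0(1) by - (rule power2_le_imp_le, auto)
    qed
    then have b: "b0 \<le> 1 * g0" unfolding b0_eq using g0 by (simp add: mult_left_le)
    have "g0 \<le> 30/1000"
      unfolding g0_def by (rule exp_neg_le[OF exp_bound_0030]) (use pi_bounds R0' mult_mono[of "31415/10000" pi "1118/1000" R0] in auto)
    then show ?thesis
      using reduce[of "14051/10000" "30/1000" 1 "25/10"] gap'[of "14051/10000" "25/10"] q b E by simp
  qed
qed

lemma exp_bound_step1: "405/10000 \<le> exp (- (32042/10000) :: real)"
  by (rule exp_ge_eighth_power[where h = "-16021/40000" and c = "6699627/10000000"]) (simp_all add: power_divide)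

lemma exp_bound_step2: "185/100000 \<le> exp (- (62832/10000) :: real)"
  by (rule exp_ge_eighth_power[where h = "-3927/5000" and c = "911289/2000000"]) (simp_all add: power_divide)

lemma exp_bound_step3: "392/10000 \<le> exp (- (32384/10000) :: real)"
  by (rule exp_ge_eighth_power[where h = "-253/625" and c = "1667761/2500000"]) (simp_all add: power_divide)

lemma exp_bound_step4: "57/10000 \<le> exp (- (51523/10000) :: real)"
  by (rule exp_ge_eighth_power[where h = "-51523/80000" and c = "525077/1000000"]) (simp_all add: power_divide)

lemma exp_bound_pi_upper: "1 / (5/100) \<le> exp (31415/10000 :: real)"
  by (rule exp_ge_eighth_power[where h = "6283/16000" and c = "14809501/10000000"]) (simp_all add: power_divide)

lemma exp_bound_b25: "1 / (393/10000) \<le> exp (3238/1000 :: real)"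
  by (rule exp_ge_eighth_power[where h = "1619/4000" and c = "3747303/2500000"]) (simp_all add: power_divide)

text \<open>Up to a positive factor this is the sign of the p-derivative of 2 (a - 3/2 a^2) + (b -
  3/2 b^2). With \<open>l = R - 2 * p\<close>, nonnegative up to the hexagonal value, b = a exp (-pi
  l), and the quadratic Taylor polynomial of exp (pi l) decides.\<close>

lemma first_shell_decreasing:
  fixes p :: real
  assumes p: "1/4 \<le> p" "p \<le> hexq / 2"
  defines "R \<equiv> sqrt (1 + p\<^sup>2)"
  defines "a \<equiv> exp (- (pi * R))" and "b \<equiv> exp (- (pi * (2 * (R - p))))"
  shows "(1 - 3 * b) * ((R - p) * b) \<le> (1 - 3 * a) * (p * a)"
proof -
  have R: "R\<^sup>2 = 1 + p\<^sup>2" "R \<ge> 0" by (auto simp: R_def)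
  define l where "l = R - 2 * p"
  have "p\<^sup>2 \<le> (hexq / 2)\<^sup>2" using p by (intro power_mono) auto
  then have "(2 * p)\<^sup>2 \<le> R\<^sup>2" unfolding R(1) using hexq_squared by (simp add: power_mult_distrib power_divide)
  then have l0: "l \<ge> 0" using power2_le_imp_le[OF _ R(2)] by (simp add: l_def)
  have b_eq: "b = a * exp (- (pi * l))"
    by (simp add: a_def b_def l_def exp_add[symmetric] algebra_simps)
  have "1/4 * (1/4) \<le> p * p" using p by (intro mult_mono) auto
  then have "(103077/100000)\<^sup>2 \<le> R\<^sup>2" unfolding R(1) by (simp add: power2_eq_square)
  then have R25: "R \<ge> 103077/100000" using R by - (rule power2_le_imp_le, auto)
  have "31415/10000 * (103077/100000) \<le> pi * R" using pi_bounds R25 by (intro mult_mono) auto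
  then have a: "0 < a" "a \<le> 393/10000"
    unfolding a_def by (simp, intro exp_neg_le[OF exp_bound_b25]) simp_all
  have ab: "a - b \<le> a * (pi * l)"
    using mult_left_mono[OF one_minus_exp_le[of "pi * l"], of a] a by (simp add: b_eq algebra_simps)
  \<comment> \<open>42/100 is chosen to satisfy 3 * 0.0393 * 3.1416 \<le> 42/100 * (1 - 3 * 0.0393),
    where 0.0393 bounds \<open>a\<close>; it limits how far 1 - 3b can exceed 1 - 3a.\<close>
  have "3 * (a - b) \<le> 3 * (393/10000 * (31416/10000 * l))"
  proof -
    have "a * (pi * l) \<le> 393/10000 * (31416/10000 * l)"
      using a pi_bounds l0 by (intro mult_mono) auto
    then show ?thesis using ab by simp
  qed
  also have "\<dots> \<le> 42/100 * l * (1 - 3 * a)"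
  proof -
    have "42/100 * l * (1 - 3 * (393/10000)) \<le> 42/100 * l * (1 - 3 * a)"
      using a l0 by (intro mult_left_mono) auto
    then show ?thesis using l0 by simp
  qed
  finally have "1 - 3 * b - 1 * (1 - 3 * a) \<le> 42/100 * l * (1 - 3 * a)" by (simp only: right_diff_distrib)
  then have "1 - 3 * b \<le> 1 * (1 - 3 * a) + 42/100 * l * (1 - 3 * a)" by (simp only: diff_le_eq add.commute)
  then have f: "1 - 3 * b \<le> (1 + 42/100 * l) * (1 - 3 * a)" by (simp only: distrib_right)
  \<comment> \<open>What remains of the final comparison after cancelling p and one factor l. From p
    = 37/100 on the first summand suffices; below, lower bounds for l supply the rest.\<close>
  have key: "1 \<le> p * (31415/10000 - 42/100) + l * (4934/1000 * p - 42/100)"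
  proof (cases "p \<le> 3/10")
    case True
    have "l \<ge> 43/100" using R25 True by (simp add: l_def)
    then have "43/100 * (8135/10000) \<le> l * (4934/1000 * p - 42/100)" using p by (intro mult_mono) auto
    then show ?thesis using p by simp
  next
    case False
    show ?thesis
    proof (cases "p \<le> 37/100")
      case True
      have "3/10 * (3/10) \<le> p * p" using False by (intro mult_mono) auto
      then have "(1044/1000)\<^sup>2 \<le> R\<^sup>2" unfolding R(1) by (simp add: power2_eq_square)
      then have "R \<ge> 1044/1000" using R by - (rule power2_le_imp_le, auto)
      then have "l \<ge> 304/1000" using True by (simp add: l_def)
      then have "304/1000 * 1 \<le> l * (4934/1000 * p - 42/100)" using False by (intro mult_mono) auto
      then show ?thesis using False by simp
    next
      case False
      then have "0 \<le> l * (4934/1000 * p - 42/100)" using l0 by simp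
      then show ?thesis using False by simp
    qed
  qed
  have "(1 + 42/100 * l) * (p + l) = p + l * (1 + 42/100 * p + 42/100 * l)"
    by (simp add: algebra_simps)
  also have "\<dots> \<le> p + l * (p * (31415/10000) + l * (4934/1000 * p))"
    using key l0 by (intro add_left_mono mult_left_mono) (auto simp: algebra_simps)
  also have "\<dots> \<le> p * (1 + pi * l + (pi * l)\<^sup>2 / 2)"
  proof -
    have "4934/1000 \<le> pi\<^sup>2 / 2"
      using power_mono[OF pi_bounds(1), of 2] by (auto simp: power2_eq_square)
    then have "p * l * l * (4934/1000) \<le> p * l * l * (pi\<^sup>2 / 2)" using p l0 by (intro mult_left_mono) auto
    moreover have "p * l * (31415/10000) \<le> p * l * pi" using p l0 pi_bounds by (intro mult_left_mono) auto
    ultimately show ?thesis by (simp add: power2_eq_square algebra_simps)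
  qed
  also have "\<dots> \<le> p * exp (pi * l)"
    using p l0 exp_lower_Taylor_quadratic[of "pi * l"] by (intro mult_left_mono) auto
  finally have k: "(1 + 42/100 * l) * (p + l) \<le> p * exp (pi * l)" .
  have "(1 - 3 * b) * ((R - p) * b) \<le> (1 + 42/100 * l) * (1 - 3 * a) * ((R - p) * b)"
    using f l0 p by (intro mult_right_mono mult_nonneg_nonneg) (auto simp: l_def b_def)
  also have "\<dots> = (1 - 3 * a) * a * ((1 + 42/100 * l) * (p + l)) * exp (- (pi * l))"
    by (simp add: b_eq l_def algebra_simps)
  also have "\<dots> \<le> (1 - 3 * a) * a * (p * exp (pi * l)) * exp (- (pi * l))"
    using k a by (intro mult_right_mono mult_left_mono) auto
  also have "\<dots> = (1 - 3 * a) * (p * a)" by (simp add: exp_minus)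
  finally show ?thesis .
qed

lemma first_shell_equilateral:
  fixes p :: real
  assumes p: "0 \<le> p" "p \<le> hexq / 2"
  defines "R \<equiv> \<lambda>p. sqrt (1 + p\<^sup>2)"
  defines "a \<equiv> \<lambda>p. exp (- (pi * R p))" and "b \<equiv> \<lambda>p. exp (- (pi * (2 * (R p - p))))"
  shows "3 * (hexa - 3/2 * hexa\<^sup>2) \<le> 2 * (a p - 3/2 * (a p)\<^sup>2) + (b p - 3/2 * (b p)\<^sup>2)"
proof -
  have R: "(R p)\<^sup>2 = 1 + p\<^sup>2" "R p \<ge> 1" by (auto simp: R_def)
  have hexa: "3 * (hexa - 3/2 * hexa\<^sup>2) \<le> 7662/100000"
  proof -
    have "hexa - 3/2 * hexa\<^sup>2 \<le> 266/10000 - 3/2 * (266/10000)\<^sup>2"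
      using hexa_bounds by (intro diff_three_halves_square_mono) auto
    then show ?thesis by (simp add: power2_eq_square)
  qed
  have small: "exp (- (pi * q)) \<le> 1/3" if "q \<ge> 1" for q
  proof -
    have "31415/10000 * 1 \<le> pi * q" using pi_bounds that by (intro mult_mono) auto
    then have "exp (- (pi * q)) \<le> 5/100" by (intro exp_neg_le[OF exp_bound_pi_upper]) auto
    then show ?thesis by simp
  qed
  \<comment> \<open>\<open>c\<close> and \<open>d\<close> bound R p and R p - p from above,
    \<open>A\<close> and \<open>B\<close> are the resulting lower bounds for the two exponentials,
    and 7662/100000 bounds the hexagonal value from above.\<close>
  have main: ?thesis
    if "R p \<le> c" "R p - p \<le> d" "R p - p \<ge> 1/2" "A \<le> exp (- (31416/10000 * c))" "B \<le> exp (- (31416/10000 * (2 * d)))"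
      "7662/100000 \<le> 2 * (A - 3/2 * A\<^sup>2) + (B - 3/2 * B\<^sup>2)" for c d A B
  proof -
    have "pi * R p \<le> 31416/10000 * c" using pi_bounds R that by (intro mult_mono) auto
    then have a1: "A \<le> a p" unfolding a_def using that(4) by (rule_tac exp_neg_ge)
    have "pi * (2 * (R p - p)) \<le> 31416/10000 * (2 * d)" using pi_bounds that by (intro mult_mono) auto
    then have b1: "B \<le> b p" unfolding b_def using that(5) by (rule_tac exp_neg_ge)
    have "a p \<le> 1/3" unfolding a_def by (rule small) (use R in auto)
    then have "A - 3/2 * A\<^sup>2 \<le> a p - 3/2 * (a p)\<^sup>2" by (rule diff_three_halves_square_mono[OF a1])
    moreover have "b p \<le> 1/3" unfolding b_def by (rule small) (use that in auto)
    then have "B - 3/2 * B\<^sup>2 \<le> b p - 3/2 * (b p)\<^sup>2" by (rule diff_three_halves_square_mono[OF b1])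
    ultimately have "2 * (A - 3/2 * A\<^sup>2) + (B - 3/2 * B\<^sup>2) \<le> 2 * (a p - 3/2 * (a p)\<^sup>2) + (b p - 3/2 * (b p)\<^sup>2)"
      by (intro add_mono mult_left_mono) auto
    then show ?thesis by (intro order_trans[OF hexa] order_trans[OF that(6)])
  qed
  consider "p \<le> 1/5" | "1/5 \<le> p" "p \<le> 1/4" | "1/4 \<le> p" by linarith
  then show ?thesis
  proof cases
    case 1
    have "p * p \<le> 1/5 * (1/5)" using 1 p by (intro mult_mono) auto
    then have "(R p)\<^sup>2 \<le> (10199/10000)\<^sup>2" unfolding R(1) by (simp add: power2_eq_square)
    then have c: "R p \<le> 10199/10000" using R by - (rule power2_le_imp_le, auto)
    have "(R p)\<^sup>2 \<le> (1 + p)\<^sup>2" unfolding R(1) using p by (simp add: power2_eq_square algebra_simps)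
    then have "R p \<le> 1 + p" using p by - (rule power2_le_imp_le, auto)
    then show ?thesis
      using c R 1
      by (intro main[of "10199/10000" 1 "405/10000" "185/100000"] exp_neg_ge[OF exp_bound_step1] exp_neg_ge[OF exp_bound_step2])
         (simp_all add: power2_eq_square)
  next
    case 2
    have "p * p \<le> 1/4 * (1/4)" using 2 p by (intro mult_mono) auto
    then have "(R p)\<^sup>2 \<le> (10308/10000)\<^sup>2" unfolding R(1) by (simp add: power2_eq_square)
    then have c: "R p \<le> 10308/10000" using R by - (rule power2_le_imp_le, auto)
    have "(R p)\<^sup>2 \<le> (82/100 + p)\<^sup>2" unfolding R(1) using 2 by (simp add: power2_eq_square algebra_simps)
    then have "R p \<le> 82/100 + p" using p by - (rule power2_le_imp_le, auto)
    then show ?thesis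
      using c R 2
      by (intro main[of "10308/10000" "82/100" "392/10000" "57/10000"] exp_neg_ge[OF exp_bound_step3] exp_neg_ge[OF exp_bound_step4])
         (simp_all add: power2_eq_square)
  next
    case 3
    define L where "L = (\<lambda>p. 2 * (a p - 3/2 * (a p)\<^sup>2) + (b p - 3/2 * (b p)\<^sup>2))"
    have "L (hexq / 2) \<le> L p"
    proof (rule DERIV_nonpos_imp_nonincreasing[OF p(2)])
      fix x assume x: "p \<le> x" "x \<le> hexq / 2"
      have pos: "1 + x\<^sup>2 > 0" by (simp add: add_pos_nonneg)
      have Rx: "R x > 0" using pos by (simp add: R_def)
      have dR: "(R has_real_derivative x / R x) (at x)"
        unfolding R_def using pos by (auto intro!: derivative_eq_intros simp: field_simps)
      have da: "(a has_real_derivative (- (pi * (x / R x)) * a x)) (at x)"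
        unfolding a_def by (auto intro!: derivative_eq_intros dR)
      have db: "(b has_real_derivative (2 * pi * (1 - x / R x) * b x)) (at x)"
        unfolding b_def by (auto intro!: derivative_eq_intros dR simp: algebra_simps)
      have "(L has_real_derivative 2 * ((- (pi * (x / R x)) * a x) * (1 - 3 * a x)) + (2 * pi * (1 - x / R x) * b x) * (1 - 3 * b x)) (at x)"
        unfolding L_def using Rx by (auto intro!: derivative_eq_intros da db simp: field_simps)
      moreover have "2 * ((- (pi * (x / R x)) * a x) * (1 - 3 * a x)) + (2 * pi * (1 - x / R x) * b x) * (1 - 3 * b x)
         = 2 * pi / R x * ((1 - 3 * b x) * ((R x - x) * b x) - (1 - 3 * a x) * (x * a x))"
        using Rx by (simp add: field_simps)
      moreover have "(1 - 3 * b x) * ((R x - x) * b x) \<le> (1 - 3 * a x) * (x * a x)"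
        unfolding a_def b_def R_def by (rule first_shell_decreasing) (use x 3 in auto)
      ultimately show "\<exists>y. (L has_real_derivative y) (at x) \<and> y \<le> 0"
        using Rx by (intro exI conjI) (auto simp: divide_le_0_iff mult_le_0_iff)
    qed
    moreover have "R (hexq / 2) = hexq"
      unfolding R_def by (rule real_sqrt_unique) (use hexq_squared hexq_pos in \<open>auto simp: power_divide\<close>)
    ultimately show ?thesis
      by (simp add: L_def a_def b_def hexa_def)
  qed
qed

text \<open>Expanding x - 3/2 x^2 about \<open>hexa\<close> turns the comparison of sums into 3/2 *
  G \<le> F * (1 - 3 * hexa), with F the first-order sum and G the sum of squares. Since 3 * hexa
  lies between 0 and 1, first F \<ge> 0 follows and then the claim.\<close>

theorem first_shell:
  fixes e p :: real
  assumes p: "0 \<le> p" "p \<le> hexq / 2" and e: "0 \<le> e" "e \<le> 37/100"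
  defines "R \<equiv> sqrt (1 + e\<^sup>2 + p\<^sup>2)"
  assumes Re: "10/13 \<le> R - e"
  defines "a1 \<equiv> exp (- (pi * (R - e)))" and "a2 \<equiv> exp (- (pi * (R + e)))" and "a3 \<equiv> exp (- (pi * (2 * (R - p))))"
  shows "a1 + a2 + a3 - 3 * hexa \<ge> 3/2 * ((a1 - hexa)\<^sup>2 + (a2 - hexa)\<^sup>2 + (a3 - hexa)\<^sup>2)"
proof -
  define F where "F = a1 + a2 + a3 - 3 * hexa"
  define G where "G = (a1 - hexa)\<^sup>2 + (a2 - hexa)\<^sup>2 + (a3 - hexa)\<^sup>2"
  have "3 * (hexa - 3/2 * hexa\<^sup>2) \<le> (a1 - 3/2 * a1\<^sup>2) + (a2 - 3/2 * a2\<^sup>2) + (a3 - 3/2 * a3\<^sup>2)"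
    unfolding a1_def a2_def a3_def R_def
    by (rule order_trans[OF first_shell_equilateral[OF p] first_shell_isosceles[OF p e]]) (use Re in \<open>simp add: R_def\<close>)
  then have "3/2 * G \<le> F * (1 - 3 * hexa)"
    by (simp add: F_def G_def power2_eq_square field_simps)
  moreover have "G \<ge> 0" by (simp add: G_def)
  moreover have h: "0 \<le> hexa" "3 * hexa < 1" using hexa_bounds by auto
  ultimately have "0 \<le> F * (1 - 3 * hexa)" by linarith
  then have "F \<ge> 0" using h by (simp add: zero_le_mult_iff)
  then have "F * (1 - 3 * hexa) \<le> F" using h by (simp add: mult_left_le)
  then show ?thesis using \<open>3/2 * G \<le> F * (1 - 3 * hexa)\<close> unfolding F_def G_def by linarith
qed

text \<open>Turns squared differences of exponentials into squared differences of values of the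
  form. Below \<open>hexq\<close> the tangent of exp suffices; above it the chord over an interval
  of length 1 is used, whence the restriction on \<open>Q\<close>.\<close>

lemma exp_minus_hexa_square_ge:
  fixes Q :: real
  assumes "Q \<le> hexq + 1"
  shows "(exp (- (pi * Q)) - hexa)\<^sup>2 \<ge> 63/100000 * (Q - hexq)\<^sup>2"
proof -
  have h: "2656/100000 \<le> hexa" using hexa_bounds by simp
  have "252/10000 * \<bar>Q - hexq\<bar> \<le> \<bar>exp (- (pi * Q)) - hexa\<bar>"
  proof (cases "Q \<le> hexq")
    case True
    have "hexa * (1 + pi * (hexq - Q)) \<le> hexa * exp (pi * (hexq - Q))"
      using exp_ge_add_one_self[of "pi * (hexq - Q)"] h by (intro mult_left_mono) auto
    also have "\<dots> = exp (- (pi * Q))"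
      by (simp add: hexa_def exp_add[symmetric] algebra_simps)
    finally have 1: "hexa * (pi * (hexq - Q)) \<le> exp (- (pi * Q)) - hexa" by (simp add: algebra_simps)
    have "2656/100000 * (1 * (hexq - Q)) \<le> hexa * (pi * (hexq - Q))"
      using h pi_bounds True by (intro mult_mono) auto
    then show ?thesis using 1 True by simp
  next
    case False
    define d where "d = Q - hexq"
    have d: "0 \<le> d" "d \<le> 1" using False assms by (auto simp: d_def)
    have "exp ((1 - d) *\<^sub>R 0 + d *\<^sub>R (- pi)) \<le> (1 - d) * exp 0 + d * exp (- pi)"
      using convex_onD[OF exp_convex, of d 0 "- pi"] d by simp
    then have c: "exp (- (pi * d)) \<le> (1 - d) + d * exp (- pi)" by (simp add: mult.commute)
    have "exp (- pi) \<le> 5/100" by (rule exp_neg_le[OF exp_bound_pi_upper]) (use pi_bounds in auto)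
    then have "d * exp (- pi) \<le> d * (5/100)" using d by (intro mult_left_mono)
    then have "95/100 * d \<le> 1 - exp (- (pi * d))" using c by simp
    then have "2656/100000 * (95/100 * d) \<le> hexa * (1 - exp (- (pi * d)))"
      using h d by (intro mult_mono) auto
    also have "\<dots> = hexa - exp (- (pi * Q))"
      by (simp add: hexa_def d_def exp_add[symmetric] algebra_simps)
    finally show ?thesis using d by (simp add: d_def)
  qed
  then have "(252/10000 * \<bar>Q - hexq\<bar>)\<^sup>2 \<le> \<bar>exp (- (pi * Q)) - hexa\<bar>\<^sup>2"
    by (intro power_mono) auto
  then have "(252/10000)\<^sup>2 * (Q - hexq)\<^sup>2 \<le> (exp (- (pi * Q)) - hexa)\<^sup>2"
    by (simp only: power_mult_distrib power2_abs)
  moreover have "63/100000 * (Q - hexq)\<^sup>2 \<le> (252/10000)\<^sup>2 * (Q - hexq)\<^sup>2"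
    by (intro mult_right_mono) (auto simp: power2_eq_square)
  ultimately show ?thesis by linarith
qed

section \<open>The remaining vectors\<close>

definition hex_point :: complex where "hex_point = Complex (1/2) (1 / hexq)"

lemma Re_hex_point [simp]: "Re hex_point = 1/2" and Im_hex_point [simp]: "Im hex_point = 1 / hexq"
  by (simp_all add: hex_point_def)

lemma Im_hex_point_pos: "Im hex_point > 0"
  using hexq_pos by simp

text \<open>The norm of m \<rho> + n in the Eisenstein integers. It omits the value 2, so the
  vectors beyond the shell begin at norm 3.\<close>

definition hex_norm :: "int \<times> int \<Rightarrow> int" where
  "hex_norm = (\<lambda>(m, n). m\<^sup>2 + m * n + n\<^sup>2)"

lemma lattice_form_hex_point: "lattice_form hex_point v = hexq * of_int (hex_norm v)"
proof -
  obtain m n where v: "v = (m, n)" by (cases v)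
  have "(1 / hexq)\<^sup>2 = 3 / 4" by (simp add: power_divide hexq_squared)
  then show ?thesis
    unfolding v lattice_form_eq hex_norm_def using hexq_pos
    by (simp add: power2_eq_square field_simps)
qed

definition hex_shell :: "(int \<times> int) set" where
  "hex_shell = {(1, 0), (-1, 0), (0, 1), (0, -1), (1, -1), (-1, 1)}"

definition hex_rest :: "(int \<times> int) set" where
  "hex_rest = {v. hex_norm v \<ge> 3}"

lemma hex_norm_cases: "v = (0, 0) \<or> v \<in> hex_shell \<or> v \<in> hex_rest"
proof (rule ccontr)
  assume contr: "\<not> ?thesis"
  obtain m n where v: "v = (m, n)" by (cases v)
  have N: "m\<^sup>2 + m * n + n\<^sup>2 \<le> 2" using contr by (simp add: hex_rest_def hex_norm_def v)
  have "(2 * m + n)\<^sup>2 \<ge> 0" "(m + 2 * n)\<^sup>2 \<ge> 0" by simp_all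
  then have "3 * n\<^sup>2 \<le> 8" "3 * m\<^sup>2 \<le> 8"
    using N by (simp_all add: power2_eq_square algebra_simps)
  then have "\<bar>n\<bar>\<^sup>2 < 2\<^sup>2" "\<bar>m\<bar>\<^sup>2 < 2\<^sup>2" by simp_all
  then have "\<bar>n\<bar> < 2" "\<bar>m\<bar> < 2"
    using power2_less_imp_less[of "\<bar>n\<bar>" 2] power2_less_imp_less[of "\<bar>m\<bar>" 2] by simp_all
  then have "n \<in> {-1, 0, 1}" "m \<in> {-1, 0, 1}" by auto
  then show False using contr N by (auto simp: v hex_shell_def)
qed

lemma hex_rest_disjoint: "(0, 0) \<notin> hex_rest" "hex_shell \<inter> hex_rest = {}" "(0, 0) \<notin> hex_shell"
  by (auto simp: hex_rest_def hex_shell_def hex_norm_def)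

text \<open>Multiplication of m \<rho> + n by \<rho>^2, a rotation of the hexagonal lattice. For any
  other z it is merely a linear map of order 3 on the indices.\<close>

definition hex_rot :: "int \<times> int \<Rightarrow> int \<times> int" where
  "hex_rot = (\<lambda>(m, n). (n, - (m + n)))"

lemma hex_norm_rot: "hex_norm (hex_rot v) = hex_norm v"
  by (cases v) (simp add: hex_norm_def hex_rot_def power2_eq_square algebra_simps)

lemma bij_betw_hex_rot: "bij_betw hex_rot hex_rest hex_rest"
proof (rule bij_betwI[where g = "\<lambda>v. hex_rot (hex_rot v)"])
  have "hex_rot (hex_rot (hex_rot v)) = v" for v by (cases v) (simp add: hex_rot_def)
  then show "\<And>x. x \<in> hex_rest \<Longrightarrow> hex_rot (hex_rot (hex_rot x)) = x"
    "\<And>x. x \<in> hex_rest \<Longrightarrow> hex_rot (hex_rot (hex_rot x)) = x" by simp_all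
qed (auto simp: hex_rest_def hex_norm_rot)

section \<open>Size of the tail at the hexagonal point\<close>

definition theta_rest :: "real \<Rightarrow> complex \<Rightarrow> real" where
  "theta_rest t z = (\<Sum>\<^sub>\<infinity>v\<in>hex_rest. exp (- (pi * t) * lattice_form z v))"

lemma summable_theta_rest:
  assumes "Im z > 0" "t > 0"
  shows "(\<lambda>v. exp (- (pi * t) * lattice_form z v)) summable_on hex_rest"
proof -
  have "pi * t > 0" using assms by simp
  then show ?thesis by (rule summable_on_subset_banach[OF summable_lattice_theta[OF assms(1)]]) auto
qed

lemma lattice_theta_split:
  assumes "Im z > 0" "t > 0"
  shows "lattice_theta t z = 1 + 2 * (exp (- (pi * t) * ((cmod z)\<^sup>2 / Im z)) + exp (- (pi * t) * (1 / Im z))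
     + exp (- (pi * t) * (((cmod z)\<^sup>2 + 1 - 2 * Re z) / Im z))) + theta_rest t z"
proof -
  let ?f = "\<lambda>v. exp (- (pi * t) * lattice_form z v)"
  have "UNIV = insert (0, 0) hex_shell \<union> hex_rest" using hex_norm_cases by blast
  then have "lattice_theta t z = infsum ?f (insert (0, 0) hex_shell \<union> hex_rest)"
    unfolding lattice_theta_form by simp
  also have "\<dots> = infsum ?f (insert (0, 0) hex_shell) + infsum ?f hex_rest"
    using hex_rest_disjoint summable_theta_rest[OF assms]
    by (intro infsum_Un_disjoint) (auto simp: hex_shell_def)
  also have "infsum ?f (insert (0, 0) hex_shell) = (\<Sum>v\<in>insert (0, 0) hex_shell. ?f v)"
    by (rule infsum_finite) (simp add: hex_shell_def)
  also have "\<dots> = 1 + 2 * (exp (- (pi * t) * ((cmod z)\<^sup>2 / Im z)) + exp (- (pi * t) * (1 / Im z))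
     + exp (- (pi * t) * (((cmod z)\<^sup>2 + 1 - 2 * Re z) / Im z)))"
  proof -
    have f: "?f (0, 0) = 1" "?f (1, 0) = exp (- (pi * t) * ((cmod z)\<^sup>2 / Im z))" "?f (-1, 0) = exp (- (pi * t) * ((cmod z)\<^sup>2 / Im z))"
      "?f (0, 1) = exp (- (pi * t) * (1 / Im z))" "?f (0, -1) = exp (- (pi * t) * (1 / Im z))"
      "?f (1, -1) = exp (- (pi * t) * (((cmod z)\<^sup>2 + 1 - 2 * Re z) / Im z))"
      "?f (-1, 1) = exp (- (pi * t) * (((cmod z)\<^sup>2 + 1 - 2 * Re z) / Im z))"
      unfolding lattice_form_eq cmod_power2 by (simp_all add: power2_eq_square algebra_simps)
    show ?thesis
      unfolding hex_shell_def by (simp add: f[simplified])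
  qed
  finally show ?thesis by (simp add: theta_rest_def)
qed

lemma theta_rest_hex_point:
  "theta_rest t hex_point = (\<Sum>\<^sub>\<infinity>v\<in>hex_rest. exp (- (pi * t) * (hexq * of_int (hex_norm v))))"
  by (simp add: theta_rest_def lattice_form_hex_point)

lemma theta_rest_nonneg: "theta_rest t z \<ge> 0"
  unfolding theta_rest_def by (rule infsum_nonneg) auto

lemma cmod_hex_point: "(cmod hex_point)\<^sup>2 = 1"
  unfolding cmod_power2 by (simp add: power_divide hexq_squared)

lemma lattice_theta_hex_point:
  assumes "t > 0"
  shows "lattice_theta t hex_point = 1 + 6 * exp (- (pi * t) * hexq) + theta_rest t hex_point"
  using lattice_theta_split[OF Im_hex_point_pos assms] by (simp add: cmod_hex_point)

lemma exp_bound_jtheta: "1 / (1/100000) \<le> exp (14136/1000 :: real)"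
  by (rule exp_ge_eighth_power[where h = "1767/1000" and c = "28987017/5000000"]) (simp_all add: power_divide)

lemma jtheta_upper_ge_3_2: "v \<ge> 3/2 \<Longrightarrow> jtheta v 0 \<le> 1 + 2001/1000 * exp (- (pi * v))"
proof -
  assume v: "v \<ge> 3/2"
  have "31415/10000 * (3/2) \<le> pi * v" using v pi_bounds by (intro mult_mono) auto
  then have "exp (- (3 * pi * v)) \<le> 1/100000"
    by (intro exp_neg_le[OF exp_bound_jtheta]) auto
  then have q: "99999/100000 \<le> 1 - exp (- (3 * pi * v))" by simp
  have "2 * exp (- (pi * v)) / (1 - exp (- (3 * pi * v))) \<le> 2 * exp (- (pi * v)) / (99999/100000)"
    by (rule frac_le[OF _ order_refl _ q]) simp_all
  also have "\<dots> \<le> 2001/1000 * exp (- (pi * v))" by simp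
  finally show ?thesis using jtheta_upper[of v] v by simp
qed

lemma hexa_powr: "exp (- (pi * t) * hexq) = hexa powr t"
  by (simp add: hexa_def powr_def mult_ac)

text \<open>At t = 2 the product bound is sharp; the functional equation carries it to t = 1/2,
  where origin and shell are subtracted. The parameter 1/2 leaves half of the decay at t = 1 free to
  absorb polynomial weights.\<close>

lemma theta_rest_half: "theta_rest (1/2) hex_point \<le> 435/10000"
proof -
  define r where "r = exp (- (pi * (1/2) * hexq))"
  have r2: "r\<^sup>2 = hexa" by (simp add: r_def hexa_def power2_eq_square exp_add[symmetric])
  have r0: "r > 0" by (simp add: r_def)
  have "(1629/10000)\<^sup>2 \<le> r\<^sup>2" unfolding r2 using hexa_bounds by (simp add: power2_eq_square)
  then have r_lo: "1629/10000 \<le> r" using r0 by - (rule power2_le_imp_le, auto)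
  have "r\<^sup>2 \<le> (1631/10000)\<^sup>2" unfolding r2 using hexa_bounds by (simp add: power2_eq_square)
  then have r_hi: "r \<le> 1631/10000" by - (rule power2_le_imp_le, auto)
  have h: "2 / hexq = 3/2 * hexq" using hexq_pos hexq_squared by (simp add: power2_eq_square field_simps)
  have "jtheta (2 / hexq) 0 \<le> 1 + 2001/1000 * r ^ 3"
  proof -
    have "exp (- (pi * (3/2 * hexq))) = r ^ 3" by (simp add: r_def exp_of_nat_mult[symmetric] field_simps)
    then show ?thesis using jtheta_upper_ge_3_2[of "2 / hexq"] hexq_bounds unfolding h by simp
  qed
  also have "\<dots> \<le> 1 + 2001/1000 * (1631/10000) ^ 3"
    using r_hi r0 by (intro add_left_mono mult_left_mono power_mono) auto
  also have "\<dots> \<le> 1 + 87/10000" by (simp add: power_divide)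
  finally have t1: "jtheta (2 / hexq) 0 \<le> 1 + 87/10000" .
  have "jtheta (2 * hexq) 0 \<le> 1 + 2001/1000 * r ^ 4"
  proof -
    have "exp (- (pi * (2 * hexq))) = r ^ 4" by (simp add: r_def exp_of_nat_mult[symmetric] field_simps)
    then show ?thesis using jtheta_upper_ge_3_2[of "2 * hexq"] hexq_bounds by simp
  qed
  also have "\<dots> \<le> 1 + 2001/1000 * (1631/10000) ^ 4"
    using r_hi r0 by (intro add_left_mono mult_left_mono power_mono) auto
  also have "\<dots> \<le> 1 + 15/10000" by (simp add: power_divide)
  finally have t2: "jtheta (2 * hexq) 0 \<le> 1 + 15/10000" .
  have "lattice_theta (1/2) hex_point = 2 * lattice_theta 2 hex_point"
    using lattice_theta_functional_equation[OF Im_hex_point_pos, of 2] by simp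
  also have "lattice_theta 2 hex_point \<le> jtheta (2 / hexq) 0 * jtheta (2 * hexq) 0"
    using lattice_theta_le[OF Im_hex_point_pos, of 2] by simp
  also have "\<dots> \<le> (1 + 87/10000) * (1 + 15/10000)"
    using t1 t2 jtheta_pos[of "2 * hexq" 0] hexq_pos by (intro mult_mono) auto
  finally have "lattice_theta (1/2) hex_point \<le> 2 * ((1 + 87/10000) * (1 + 15/10000))" by simp
  then have "theta_rest (1/2) hex_point \<le> 2 * ((1 + 87/10000) * (1 + 15/10000)) - 1 - 6 * r"
    using lattice_theta_hex_point[of "1/2"] by (simp add: r_def)
  then show ?thesis using r_lo by simp
qed

text \<open>In units of c = pi * hexq the exponent t N splits as N/2 + (N - 3)(t - 1/2) + 3/2 + 3 (t
  - 1). The second part absorbs N / 3, two thirds of the last absorb t, and the rest remains on the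
  right.\<close>

lemma exp_hex_norm_le:
  fixes N t :: real
  assumes "N \<ge> 3" "t \<ge> 1"
  shows "t * N * exp (- (pi * t) * (hexq * N)) \<le> (3 * hexa powr (3/2)) * hexa powr (t - 1) * exp (- (pi * (1/2)) * (hexq * N))"
proof -
  define c where "c = pi * hexq"
  have c: "c \<ge> 36/10" using mult_mono[OF pi_bounds(1) hexq_bounds(1)] pi_bounds hexq_bounds by (simp add: c_def)
  have "N / 3 \<le> exp ((N - 3) * (c * (t - 1/2)))"
  proof -
    have "18/10 * (1/2) \<le> c * (t - 1/2)" using c assms by (intro mult_mono) auto
    then have "(N - 3) * (1/3) \<le> (N - 3) * (c * (t - 1/2))" using assms by (intro mult_left_mono) auto
    then have "N / 3 \<le> 1 + (N - 3) * (c * (t - 1/2))" by simp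
    then show ?thesis using exp_ge_add_one_self[of "(N - 3) * (c * (t - 1/2))"] by linarith
  qed
  then have N: "N \<le> 3 * exp ((N - 3) * (c * (t - 1/2)))" by simp
  have "t \<le> exp (2 * c * (t - 1))"
  proof -
    have "1 * (t - 1) \<le> 2 * c * (t - 1)" using c assms by (intro mult_right_mono) auto
    then have "t \<le> 1 + 2 * c * (t - 1)" by simp
    then show ?thesis using exp_ge_add_one_self[of "2 * c * (t - 1)"] by (rule order_trans)
  qed
  then have "t * N \<le> exp (2 * c * (t - 1)) * (3 * exp ((N - 3) * (c * (t - 1/2))))"
    using N assms by (intro mult_mono) auto
  then have "t * N * exp (- (c * t * N)) \<le> exp (2 * c * (t - 1)) * (3 * exp ((N - 3) * (c * (t - 1/2)))) * exp (- (c * t * N))"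
    by (intro mult_right_mono) auto
  also have "\<dots> = 3 * exp (- (3/2 * c)) * exp (- (c * (t - 1))) * exp (- (c * (1/2) * N))"
    by (simp add: exp_add[symmetric] field_simps)
  also have "exp (- (3/2 * c)) = hexa powr (3/2)" by (simp add: hexa_def powr_def c_def)
  also have "exp (- (c * (t - 1))) = hexa powr (t - 1)" by (simp add: hexa_def powr_def c_def mult_ac)
  finally show ?thesis by (simp add: c_def mult_ac)
qed

lemma hexa_powr_3_2: "hexa powr (3/2) \<le> 434/100000"
proof -
  have "hexa powr (3/2) * hexa powr (3/2) = hexa ^ 3"
    using hexa_bounds by (simp add: powr_add[symmetric] powr_numeral)
  also have "\<dots> \<le> (266/10000) ^ 3" using hexa_bounds by (intro power_mono) auto
  also have "\<dots> \<le> (434/100000)\<^sup>2" by (simp add: power2_eq_square power_divide)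
  finally have "(hexa powr (3/2))\<^sup>2 \<le> (434/100000)\<^sup>2" by (simp add: power2_eq_square)
  then show ?thesis by - (rule power2_le_imp_le, auto)
qed

text \<open>This is the first-order coefficient in the comparison of tails; the factor 2 pi / 3
  arises there from averaging over orbits of length 3.\<close>

lemma hex_rest_moment:
  assumes "t \<ge> 1"
  shows "(\<lambda>v. t * of_int (hex_norm v) * exp (- (pi * t) * (hexq * of_int (hex_norm v)))) summable_on hex_rest"
    and "2 * pi / 3 * (\<Sum>\<^sub>\<infinity>v\<in>hex_rest. t * of_int (hex_norm v) * exp (- (pi * t) * (hexq * of_int (hex_norm v))))
            \<le> 12/10000 * hexa powr (t - 1)"
proof -
  let ?f = "\<lambda>v. t * of_int (hex_norm v) * exp (- (pi * t) * (hexq * of_int (hex_norm v)))"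
  let ?g = "\<lambda>v. (3 * hexa powr (3/2)) * hexa powr (t - 1) * exp (- (pi * (1/2)) * (hexq * of_int (hex_norm v)))"
  have le: "?f v \<le> ?g v" if "v \<in> hex_rest" for v
    using that assms by (intro exp_hex_norm_le) (auto simp: hex_rest_def)
  have "(\<lambda>v. exp (- (pi * (1/2)) * (hexq * of_int (hex_norm v)))) summable_on hex_rest"
    using summable_theta_rest[OF Im_hex_point_pos, of "1/2"] by (simp only: lattice_form_hex_point)
  then have g: "?g summable_on hex_rest" by (rule summable_on_cmult_right)
  show f: "?f summable_on hex_rest"
    by (rule summable_on_comparison_test[OF g le]) (use assms in \<open>auto simp: hex_rest_def\<close>)
  have "infsum ?f hex_rest \<le> infsum ?g hex_rest" by (rule infsum_mono[OF f g le])
  also have "infsum ?g hex_rest = (3 * hexa powr (3/2)) * hexa powr (t - 1) * theta_rest (1/2) hex_point"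
    unfolding theta_rest_hex_point by (rule infsum_cmult_right')
  also have "\<dots> \<le> (3 * (434/100000)) * hexa powr (t - 1) * (435/10000)"
    using theta_rest_half hexa_powr_3_2 theta_rest_nonneg[of "1/2" hex_point] by (intro mult_mono) auto
  finally have "2 * pi / 3 * infsum ?f hex_rest \<le> 2 * pi / 3 * ((3 * (434/100000)) * hexa powr (t - 1) * (435/10000))"
    by (intro mult_left_mono) auto
  also have "\<dots> = pi * (2 * (434/100000) * (435/10000)) * hexa powr (t - 1)" by simp
  also have "\<dots> \<le> 12/10000 * hexa powr (t - 1)"
    using pi_bounds by (intro mult_right_mono) auto
  finally show "2 * pi / 3 * infsum ?f hex_rest \<le> 12/10000 * hexa powr (t - 1)" .
qed

text \<open>Since t N \<ge> 3, \<open>exp_hex_norm_le\<close> also bounds the unweighted terms, and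
  the tail adds at most 1/100 of hexa^t to the six terms of the shell.\<close>

lemma lattice_theta_hex_point_le:
  assumes "t \<ge> 1"
  shows "lattice_theta t hex_point \<le> 1 + 601/100 * hexa powr t"
proof -
  let ?f = "\<lambda>v. exp (- (pi * t) * (hexq * of_int (hex_norm v)))"
  let ?g = "\<lambda>v. hexa powr (3/2) * hexa powr (t - 1) * exp (- (pi * (1/2)) * (hexq * of_int (hex_norm v)))"
  have le: "?f v \<le> ?g v" if "v \<in> hex_rest" for v
  proof -
    define N where "N = real_of_int (hex_norm v)"
    have N: "N \<ge> 3" using that by (simp add: N_def hex_rest_def)
    have "1 * 3 \<le> t * N" using assms N by (intro mult_mono) auto
    then have "3 * exp (- (pi * t) * (hexq * N)) \<le> t * N * exp (- (pi * t) * (hexq * N))"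
      by (intro mult_right_mono) auto
    also have "\<dots> \<le> (3 * hexa powr (3/2)) * hexa powr (t - 1) * exp (- (pi * (1/2)) * (hexq * N))"
      by (rule exp_hex_norm_le[OF N assms])
    finally show ?thesis by (simp add: N_def)
  qed
  have s: "(\<lambda>v. exp (- (pi * (1/2)) * (hexq * of_int (hex_norm v)))) summable_on hex_rest"
    using summable_theta_rest[OF Im_hex_point_pos, of "1/2"] by (simp only: lattice_form_hex_point)
  have f: "?f summable_on hex_rest"
    using summable_theta_rest[OF Im_hex_point_pos, of t] assms by (simp only: lattice_form_hex_point)
  have "theta_rest t hex_point \<le> infsum ?g hex_rest"
    unfolding theta_rest_hex_point by (rule infsum_mono[OF f summable_on_cmult_right[OF s] le])
  also have "\<dots> = hexa powr (3/2) * hexa powr (t - 1) * theta_rest (1/2) hex_point"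
    unfolding theta_rest_hex_point by (rule infsum_cmult_right')
  also have "\<dots> \<le> 434/100000 * hexa powr (t - 1) * (435/10000)"
    using theta_rest_half hexa_powr_3_2 theta_rest_nonneg[of "1/2" hex_point] by (intro mult_mono) auto
  also have "\<dots> \<le> 1/100 * hexa * hexa powr (t - 1)"
  proof -
    have "hexa powr (t - 1) * (434/100000 * (435/10000)) \<le> hexa powr (t - 1) * (1/100 * hexa)"
      using hexa_bounds by (intro mult_left_mono) auto
    then show ?thesis by (simp add: mult_ac)
  qed
  also have "\<dots> = 1/100 * hexa powr t"
    using hexa_bounds powr_mult_base[of hexa "t - 1"] by simp
  finally show ?thesis
    using lattice_theta_hex_point[of t] assms hexa_powr[of t] by simp
qed

lemma le_three_exp:
  fixes \<alpha> :: real
  assumes "\<alpha> \<ge> 3"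
  shows "\<alpha> \<le> 3 * exp ((\<alpha> - 3) / 3)"
proof -
  have "\<alpha> / 3 \<le> exp ((\<alpha> - 3) / 3)"
    using exp_ge_add_one_self[of "(\<alpha> - 3) / 3"] by (simp add: diff_divide_distrib)
  then show ?thesis by simp
qed

lemma exp_bound_3: "45/4 \<le> exp (3 :: real)"
  by (rule exp_ge_eighth_power[where h = "3/8" and c = "14549873/10000000"]) (simp_all add: power_divide)

lemma exp_bound_neg2: "893/10000 \<le> exp (- (2) :: real)"
  by (rule exp_ge_eighth_power[where h = "-1/4" and c = "1947001/2500000"]) (simp_all add: power_divide)

text \<open>The term with \<open>C\<close> lets one tangent-line estimate absorb a multiple of the change of \<open>theta_rest \<alpha>\<close> as well;
  the bound on \<open>C\<close> is what keeps \<open>h\<close> convex.\<close>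

lemma exp_difference_tangent:
  fixes t \<alpha> C q Q :: real
  assumes Q: "1 \<le> Q" "1 < q" and t: "1 \<le> t" and C: "0 \<le> C" "C = 0 \<or> t \<le> 2 \<and> 3 \<le> \<alpha> \<and> C \<le> 5/12 * \<alpha>"
  defines "h \<equiv> \<lambda>Q. exp (- (pi * t) * Q) - C * exp (- (pi * \<alpha>) * Q)"
  shows "h Q \<ge> h q + (- (pi * t) * exp (- (pi * t) * q) + C * (pi * \<alpha>) * exp (- (pi * \<alpha>) * q)) * (Q - q)"
proof -
  define h' where "h' = (\<lambda>Q. - (pi * t) * exp (- (pi * t) * Q) + C * (pi * \<alpha>) * exp (- (pi * \<alpha>) * Q))"
  define h'' where "h'' = (\<lambda>Q. (pi * t)\<^sup>2 * exp (- (pi * t) * Q) - C * (pi * \<alpha>)\<^sup>2 * exp (- (pi * \<alpha>) * Q))"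
  have d1: "(h has_real_derivative h' x) (at x)" for x
    unfolding h_def h'_def by (auto intro!: derivative_eq_intros)
  have d2: "(h' has_real_derivative h'' x) (at x)" for x
    unfolding h'_def h''_def by (auto intro!: derivative_eq_intros simp: power2_eq_square)
  have nn: "h'' x \<ge> 0" if "x \<ge> 1" for x
  proof (cases "C = 0")
    case True
    then show ?thesis by (simp add: h''_def)
  next
    case False
    then have c: "t \<le> 2" "3 \<le> \<alpha>" "C \<le> 5/12 * \<alpha>" using C by auto
    \<comment> \<open>It suffices that C \<alpha>^2 \<le> exp (pi (\<alpha> - t) x). The bound works
      because 5/12 * 27 = 45/4 \<le> exp 3 and \<alpha> \<le> 3 (\<alpha> - t), the latter sharp at
      \<alpha> = 3 and t = 2.\<close>
    have "C * \<alpha>\<^sup>2 \<le> 5/12 * \<alpha> * \<alpha>\<^sup>2" using c by (intro mult_right_mono) auto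
    also have "\<dots> = 5/12 * \<alpha> ^ 3" by (simp add: power2_eq_square power3_eq_cube)
    also have "\<dots> \<le> 5/12 * (3 * exp ((\<alpha> - 3) / 3)) ^ 3"
      using le_three_exp[OF c(2)] c by (intro mult_left_mono power_mono) auto
    also have "\<dots> = 45/4 * exp (\<alpha> - 3)"
      by (simp add: power_mult_distrib exp_of_nat_mult[symmetric])
    also have "\<dots> \<le> exp 3 * exp (\<alpha> - 3)"
      using exp_bound_3 by (intro mult_right_mono) auto
    also have "\<dots> \<le> exp (pi * (\<alpha> - t) * x)"
    proof -
      have "3 + (\<alpha> - 3) \<le> 3 * (\<alpha> - t)" using c by simp
      also have "\<dots> \<le> pi * (\<alpha> - t)" using c pi_bounds by (intro mult_right_mono) auto
      also have "pi * (\<alpha> - t) * 1 \<le> pi * (\<alpha> - t) * x" using c that by (intro mult_left_mono) auto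
      finally show ?thesis by (simp add: exp_add[symmetric])
    qed
    finally have "C * \<alpha>\<^sup>2 \<le> exp (pi * (\<alpha> - t) * x)" .
    then have "C * \<alpha>\<^sup>2 * exp (- (pi * \<alpha>) * x) \<le> exp (pi * (\<alpha> - t) * x) * exp (- (pi * \<alpha>) * x)"
      by (intro mult_right_mono) auto
    also have "\<dots> = 1 * exp (- (pi * t) * x)" by (simp add: exp_add[symmetric] algebra_simps)
    also have "\<dots> \<le> t\<^sup>2 * exp (- (pi * t) * x)" using t by (intro mult_right_mono) auto
    finally have "pi\<^sup>2 * (C * \<alpha>\<^sup>2 * exp (- (pi * \<alpha>) * x)) \<le> pi\<^sup>2 * (t\<^sup>2 * exp (- (pi * t) * x))"
      by (intro mult_left_mono) auto
    then show ?thesis by (simp add: h''_def power_mult_distrib mult_ac)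
  qed
  have "convex_on {1..} h"
    by (rule f''_ge0_imp_convex[where f' = h' and f'' = h'']) (use d1 d2 nn in auto)
  then have "h Q - h q \<ge> h' q * (Q - q)"
    by (rule convex_on_imp_above_tangent[where A = "{1..}"])
       (use Q d1 in \<open>auto intro: has_field_derivative_at_within\<close>)
  then show ?thesis by (simp add: h'_def)
qed

text \<open>Half the sum of the form over the shell vectors (1,0), (0,1) and (1,-1).\<close>

definition selling_trace :: "complex \<Rightarrow> real" where
  "selling_trace z = ((cmod z)\<^sup>2 + 1 - Re z) / Im z"

text \<open>Averaging a quadratic form over the group generated by \<open>hex_rot\<close> gives an
  invariant form, hence a multiple of \<open>hex_norm\<close>; the factor can be read off at a
  shortest vector.\<close>

lemma lattice_form_orbit_sum:
  assumes "Im z > 0"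
  shows "lattice_form z v + lattice_form z (hex_rot v) + lattice_form z (hex_rot (hex_rot v))
    = 2 * selling_trace z * of_int (hex_norm v)"
proof -
  obtain m n where v: "v = (m, n)" by (cases v)
  show ?thesis
    unfolding v hex_rot_def hex_norm_def selling_trace_def cmod_power2 prod.case lattice_form_eq
    using assms by (simp add: field_simps power2_eq_square)
qed

text \<open>Summing the tangent-line estimates at the hexagonal values over an orbit of \<open>hex_rot\<close>, the first-order terms
  depend on \<open>z\<close> only through \<open>selling_trace z\<close>, which is minimal at the hexagonal point.\<close>

lemma theta_rest_difference:
  assumes z: "Im z > 0" and S: "3/2 * hexq \<le> selling_trace z"
    and one: "\<And>v. v \<in> hex_rest \<Longrightarrow> lattice_form z v \<ge> 1"
    and t: "1 \<le> t" and \<alpha>: "0 < \<alpha>" and C: "0 \<le> C" "C = 0 \<or> t \<le> 2 \<and> 3 \<le> \<alpha> \<and> C \<le> 5/12 * \<alpha>"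
  shows "theta_rest t z - C * theta_rest \<alpha> z \<ge> theta_rest t hex_point - C * theta_rest \<alpha> hex_point
      - (selling_trace z - 3/2 * hexq) * (12/10000 * hexa powr (t - 1))"
proof -
  define h where "h = (\<lambda>Q. exp (- (pi * t) * Q) - C * exp (- (pi * \<alpha>) * Q))"
  define H where "H = (\<lambda>v. h (lattice_form z v))"
  define K where "K = (\<lambda>v. h (lattice_form hex_point v))"
  define E where "E = (\<lambda>v. t * of_int (hex_norm v) * exp (- (pi * t) * (hexq * of_int (hex_norm v))))"
  define d where "d = selling_trace z - 3/2 * hexq"
  have d: "d \<ge> 0" using S by (simp add: d_def)
  have t0: "t > 0" using t by simp
  have sum_h: "(\<lambda>v. h (lattice_form w v)) summable_on hex_rest"
    and inf_h: "(\<Sum>\<^sub>\<infinity>v\<in>hex_rest. h (lattice_form w v)) = theta_rest t w - C * theta_rest \<alpha> w" if w: "Im w > 0" for w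
  proof -
    have "((\<lambda>v. exp (- (pi * t) * lattice_form w v) + (- C) * exp (- (pi * \<alpha>) * lattice_form w v)) has_sum
        (theta_rest t w + (- C) * theta_rest \<alpha> w)) hex_rest"
      unfolding theta_rest_def
      by (intro has_sum_add has_sum_cmult_right has_sum_infsum summable_theta_rest w t0 \<alpha>)
    then have hs: "((\<lambda>v. h (lattice_form w v)) has_sum (theta_rest t w - C * theta_rest \<alpha> w)) hex_rest"
      by (simp add: h_def)
    show "(\<lambda>v. h (lattice_form w v)) summable_on hex_rest" using hs by (rule has_sum_imp_summable)
    show "(\<Sum>\<^sub>\<infinity>v\<in>hex_rest. h (lattice_form w v)) = theta_rest t w - C * theta_rest \<alpha> w" using hs by (rule infsumI)
  qed
  have rot: "hex_rot v \<in> hex_rest" if "v \<in> hex_rest" for v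
    using that by (simp add: hex_rest_def hex_norm_rot)
  have orbit: "3 * K v - 2 * pi * d * E v \<le> H v + (H (hex_rot v) + H (hex_rot (hex_rot v)))" if v: "v \<in> hex_rest" for v
  proof -
    define N where "N = real_of_int (hex_norm v)"
    define q where "q = hexq * N"
    have N: "N \<ge> 3" using v by (simp add: N_def hex_rest_def)
    have "115470/100000 * 3 \<le> hexq * N" using N hexq_bounds by (intro mult_mono) auto
    then have q1: "q > 1" by (simp add: q_def)
    define h' where "h' = - (pi * t) * exp (- (pi * t) * q) + C * (pi * \<alpha>) * exp (- (pi * \<alpha>) * q)"
    have tangent: "h q + h' * (lattice_form z u - q) \<le> h (lattice_form z u)" if "u \<in> hex_rest" for u
      unfolding h_def h'_def by (rule exp_difference_tangent[OF one[OF that] q1 t C])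
    have "3 * h q + h' * (2 * N * d) = (h q + h' * (lattice_form z v - q)) + ((h q + h' * (lattice_form z (hex_rot v) - q))
        + (h q + h' * (lattice_form z (hex_rot (hex_rot v)) - q)))"
    proof -
      have "2 * N * d = lattice_form z v + lattice_form z (hex_rot v) + lattice_form z (hex_rot (hex_rot v)) - 3 * q"
        unfolding lattice_form_orbit_sum[OF z] by (simp add: d_def q_def N_def algebra_simps)
      then show ?thesis by (simp only:) (simp add: algebra_simps)
    qed
    also have "\<dots> \<le> H v + (H (hex_rot v) + H (hex_rot (hex_rot v)))"
      unfolding H_def by (intro add_mono tangent v rot)
    finally have 1: "3 * h q + h' * (2 * N * d) \<le> H v + (H (hex_rot v) + H (hex_rot (hex_rot v)))" .
    \<comment> \<open>The part of the slope that contains C is nonnegative and is multiplied by d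
      \<ge> 0, so it may be dropped.\<close>
    have "- (pi * t) * exp (- (pi * t) * q) \<le> h'" using C \<alpha> by (simp add: h'_def)
    then have "- (pi * t) * exp (- (pi * t) * q) * (2 * N * d) \<le> h' * (2 * N * d)"
      using N d by (intro mult_right_mono) auto
    moreover have "- (pi * t) * exp (- (pi * t) * q) * (2 * N * d) = - (2 * pi * d * E v)"
      by (simp add: E_def N_def q_def mult_ac)
    moreover have "K v = h q" by (simp add: K_def q_def N_def lattice_form_hex_point)
    ultimately show ?thesis using 1 by linarith
  qed
  have H: "(H has_sum infsum H hex_rest) hex_rest"
    unfolding H_def by (intro has_sum_infsum sum_h z)
  have K: "(K has_sum infsum K hex_rest) hex_rest"
    unfolding K_def by (intro has_sum_infsum sum_h Im_hex_point_pos)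
  have E: "(E has_sum infsum E hex_rest) hex_rest"
    unfolding E_def by (intro has_sum_infsum hex_rest_moment t)
  \<comment> \<open>\<open>hex_rot\<close> permutes \<open>hex_rest\<close>, so the three sums agree
    and no representatives of orbits need to be chosen.\<close>
  have H1: "((\<lambda>v. H (hex_rot v)) has_sum infsum H hex_rest) hex_rest"
    using H has_sum_reindex_bij_betw[OF bij_betw_hex_rot, of H] by simp
  have H2: "((\<lambda>v. H (hex_rot (hex_rot v))) has_sum infsum H hex_rest) hex_rest"
    using H1 has_sum_reindex_bij_betw[OF bij_betw_hex_rot, of "\<lambda>v. H (hex_rot v)"] by simp
  have "((\<lambda>v. 3 * K v + (- (2 * pi * d)) * E v) has_sum (3 * infsum K hex_rest + (- (2 * pi * d)) * infsum E hex_rest)) hex_rest"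
    by (intro has_sum_add has_sum_cmult_right K E)
  moreover have "((\<lambda>v. H v + (H (hex_rot v) + H (hex_rot (hex_rot v)))) has_sum (infsum H hex_rest + (infsum H hex_rest + infsum H hex_rest))) hex_rest"
    by (intro has_sum_add H H1 H2)
  ultimately have "3 * infsum K hex_rest + (- (2 * pi * d)) * infsum E hex_rest \<le> infsum H hex_rest + (infsum H hex_rest + infsum H hex_rest)"
    by (rule has_sum_mono) (use orbit in auto)
  moreover have "d * (2 * pi / 3 * infsum E hex_rest) \<le> d * (12/10000 * hexa powr (t - 1))"
    using hex_rest_moment(2)[OF t] d unfolding E_def by (intro mult_left_mono)
  moreover have "2 * pi * d * infsum E hex_rest = 3 * (d * (2 * pi / 3 * infsum E hex_rest))" by simp
  moreover have "k - w3 \<le> h" if "3 * k + - w2 \<le> h + (h + h)" "w1 \<le> w3" "w2 = 3 * w1" for k w1 w2 w3 h :: real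
    using that by linarith
  ultimately have "infsum K hex_rest - d * (12/10000 * hexa powr (t - 1)) \<le> infsum H hex_rest"
    by (simp only: mult_minus_left)
  then show ?thesis
    unfolding H_def K_def inf_h[OF z] inf_h[OF Im_hex_point_pos] d_def by simp
qed

section \<open>Comparison on the fundamental domain\<close>

text \<open>Taylor's formula with the second derivative replaced by its value at the right end m,
  where it is largest. The proof is the tangent inequality for the convex difference of quadratic
  and power.\<close>

lemma powr_le_second_order:
  fixes a b m \<alpha> :: real
  assumes "0 < a" "a \<le> m" "0 < b" "b < m" "\<alpha> \<ge> 2"
  shows "a powr \<alpha> \<le> b powr \<alpha> + \<alpha> * b powr (\<alpha> - 1) * (a - b) + \<alpha> * (\<alpha> - 1) / 2 * m powr (\<alpha> - 2) * (a - b)\<^sup>2"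
proof -
  define K where "K = \<alpha> * (\<alpha> - 1) * m powr (\<alpha> - 2)"
  define f where "f = (\<lambda>x. K / 2 * (x - b)\<^sup>2 - x powr \<alpha>)"
  define f' where "f' = (\<lambda>x. K * (x - b) - \<alpha> * x powr (\<alpha> - 1))"
  define f'' where "f'' = (\<lambda>x. K - \<alpha> * (\<alpha> - 1) * x powr (\<alpha> - 2))"
  have d1: "(f has_real_derivative f' x) (at x)" if "x > 0" for x
    unfolding f_def f'_def using that by (auto intro!: derivative_eq_intros)
  have d2: "(f' has_real_derivative f'' x) (at x)" if "x > 0" for x
    unfolding f'_def f''_def using that by (auto intro!: derivative_eq_intros)
  have nn: "f'' x \<ge> 0" if "0 < x" "x \<le> m" for x
    unfolding f''_def K_def using that assms by (auto intro!: mult_left_mono powr_mono2)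
  have "convex_on {0<..m} f"
    by (rule f''_ge0_imp_convex[where f' = f' and f'' = f'']) (use d1 d2 nn in auto)
  then have "f a - f b \<ge> f' b * (a - b)"
    by (rule convex_on_imp_above_tangent[where A = "{0<..m}"])
       (use assms d1 in \<open>auto intro: has_field_derivative_at_within\<close>)
  then show ?thesis by (simp add: f_def f'_def K_def algebra_simps)
qed

text \<open>Here the exponent k is paid for: the slope k x^(k-1) is at most 2s x^(2s), hence at most
  2s * 21/20.\<close>

lemma powr_diff_le:
  fixes a b k s :: real
  assumes "1 \<le> a" "a \<le> b" "0 < k" "k \<le> 2 * s" "b powr (2 * s) \<le> 21/20"
  shows "b powr k - a powr k \<le> 21/10 * s * (b - a)"
proof (cases "a = b")
  case False
  then have ab: "a < b" using assms by simp
  have "\<exists>x. a < x \<and> x < b \<and> b powr k - a powr k = (b - a) * (k * x powr (k - 1))"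
    by (rule MVT2[OF ab]) (use assms in \<open>auto intro!: derivative_eq_intros\<close>)
  then obtain x where x: "a < x" "x < b" "b powr k - a powr k = (b - a) * (k * x powr (k - 1))" by blast
  have "x powr (k - 1) \<le> x powr (2 * s)" using x assms by (intro powr_mono) auto
  also have "\<dots> \<le> b powr (2 * s)" using x assms by (intro powr_mono2) auto
  finally have "x powr (k - 1) \<le> 21/20" using assms by simp
  then have "k * x powr (k - 1) \<le> 2 * s * (21/20)" using assms by (intro mult_mono) auto
  then have "(b - a) * (k * x powr (k - 1)) \<le> (b - a) * (2 * s * (21/20))" using ab by (intro mult_left_mono) auto
  then show ?thesis using x(3) by (simp add: mult_ac)
qed (use assms in auto)

text \<open>\<open>893/10000\<close> bounds \<open>exp (- (10 * pi / 13))\<close>, hence every term \<open>exp (- (pi * Q))\<close> with \<open>Q\<close> a value of the form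
  on a nonzero vector when \<open>|z| \<ge> 1\<close> and \<open>Im z \<le> 13/10\<close>.\<close>

lemma powr_terms_le:
  fixes \<alpha> s :: real
  assumes "1 \<le> s" "3 * s \<le> \<alpha>"
  shows "2 * (21/10 * s) * (\<alpha> * hexa powr (\<alpha> - 1) + \<alpha> * (\<alpha> - 1) / 3 * (893/10000) powr (\<alpha> - 2)) \<le> 1 * (1 / hexq) powr s"
proof -
  \<comment> \<open>Every factor is bounded by an exponential in \<open>u = \<alpha> - 3\<close>.
    The rates 1/3 + 1/3 + 1/2 + 1/20 - 2 add up to -47/60, so the numerical check is made at u = 0,
    that is \<alpha> = 3.\<close>
  define u where "u = \<alpha> - 3"
  have u: "u \<ge> 0" "\<alpha> = u + 3" using assms by (auto simp: u_def)
  have s: "s \<le> \<alpha> / 3" using assms by simp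
  have A: "\<alpha> \<le> 3 * exp (u / 3)" using le_three_exp[of \<alpha>] u by simp
  have A1: "\<alpha> - 1 \<le> 2 * exp (u / 2)"
  proof -
    have "2 * (1 + u / 2) \<le> 2 * exp (u / 2)" using exp_ge_add_one_self[of "u / 2"] by (rule mult_left_mono) simp
    then show ?thesis using u by simp
  qed
  have e2: "exp (-2) \<ge> (893/10000 :: real)" using exp_bound_neg2 by simp
  have hp: "hexa powr (\<alpha> - 1) \<le> (266/10000)\<^sup>2 * exp (- (2 * u))"
  proof -
    have "hexa powr (\<alpha> - 1) = hexa\<^sup>2 * hexa powr u"
      using hexa_bounds u powr_add[of hexa 2 u] by (simp add: powr_numeral algebra_simps)
    also have "\<dots> \<le> (266/10000)\<^sup>2 * exp (-2) powr u"
      using hexa_bounds e2 u by (intro mult_mono power_mono powr_mono2) auto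
    finally show ?thesis by (simp add: exp_powr_real mult.commute)
  qed
  have mp: "(893/10000) powr (\<alpha> - 2) \<le> 893/10000 * exp (- (2 * u))"
  proof -
    have "(893/10000) powr (\<alpha> - 2) = 893/10000 * (893/10000) powr u"
      using u powr_add[of "893/10000" 1 u] by (simp add: algebra_simps)
    also have "\<dots> \<le> 893/10000 * exp (-2) powr u"
      using e2 u by (intro mult_left_mono powr_mono2) auto
    finally show ?thesis by (simp add: exp_powr_real mult.commute)
  qed
  have hs: "hexq powr s \<le> 115471/100000 * exp (u / 20)"
  proof -
    have "hexq powr s \<le> hexq powr (1 + u / 3)"
      using s u hexq_bounds by (intro powr_mono) auto
    also have "\<dots> = hexq * hexq powr (u / 3)"
      using hexq_bounds by (simp add: powr_add)
    also have "\<dots> \<le> 115471/100000 * exp (15/100) powr (u / 3)"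
    proof (intro mult_mono powr_mono2)
      have "1 + 15/100 + (15/100)\<^sup>2 / 2 \<le> exp (15/100 :: real)" by (rule exp_lower_Taylor_quadratic) simp
      then show "hexq \<le> exp (15/100)" using hexq_bounds by (simp add: power2_eq_square)
    qed (use hexq_bounds u in auto)
    finally show ?thesis by (simp add: exp_powr_real)
  qed
  have "2 * (21/10 * s) * (\<alpha> * hexa powr (\<alpha> - 1) + \<alpha> * (\<alpha> - 1) / 3 * (893/10000) powr (\<alpha> - 2)) * hexq powr s
     \<le> 2 * (21/10 * (\<alpha> / 3)) * (\<alpha> * ((266/10000)\<^sup>2 * exp (- (2 * u))) + \<alpha> * (\<alpha> - 1) / 3 * (893/10000 * exp (- (2 * u)))) * (115471/100000 * exp (u / 20))"
    using s u hp mp hs assms by (intro mult_mono add_mono) auto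
  also have "\<dots> = (14/10 * (115471/100000)) * (\<alpha> * \<alpha> * (266/10000)\<^sup>2 + \<alpha> * \<alpha> * (\<alpha> - 1) * (893/30000)) * exp (- (39/20 * u))"
  proof -
    have e: "exp (- (39/20 * u)) = exp (- (2 * u)) * exp (u / 20)" by (simp add: exp_add[symmetric])
    show ?thesis unfolding e by (simp add: field_simps)
  qed
  also have "\<dots> \<le> (14/10 * (115471/100000)) * ((3 * exp (u / 3)) * (3 * exp (u / 3)) * (266/10000)\<^sup>2 * exp (u / 2)
      + (3 * exp (u / 3)) * (3 * exp (u / 3)) * (2 * exp (u / 2)) * (893/30000)) * exp (- (39/20 * u))"
  proof -
    have "\<alpha> * \<alpha> \<le> (3 * exp (u / 3)) * (3 * exp (u / 3))" using A u by (intro mult_mono) auto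
    moreover from this have "\<alpha> * \<alpha> * (\<alpha> - 1) \<le> (3 * exp (u / 3)) * (3 * exp (u / 3)) * (2 * exp (u / 2))"
      by (rule mult_mono[OF _ A1]) (use u in auto)
    moreover have "1 \<le> exp (u / 2)" using u by simp
    ultimately have "\<alpha> * \<alpha> * (266/10000)\<^sup>2 * 1 + \<alpha> * \<alpha> * (\<alpha> - 1) * (893/30000)
        \<le> (3 * exp (u / 3)) * (3 * exp (u / 3)) * (266/10000)\<^sup>2 * exp (u / 2)
          + (3 * exp (u / 3)) * (3 * exp (u / 3)) * (2 * exp (u / 2)) * (893/30000)"
      by (intro add_mono[OF mult_mono[OF mult_right_mono] mult_right_mono]) auto
    then show ?thesis by (intro mult_right_mono mult_left_mono) auto
  qed
  also have "\<dots> = (14/10 * (115471/100000)) * (9 * (266/10000)\<^sup>2 + 18 * (893/30000)) * (exp (u / 3) * exp (u / 3) * exp (u / 2) * exp (- (39/20 * u)))"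
    by (simp add: algebra_simps)
  also have "exp (u / 3) * exp (u / 3) * exp (u / 2) * exp (- (39/20 * u)) = exp (- (47/60 * u))"
    by (simp add: exp_add[symmetric] field_simps)
  also have "(14/10 * (115471/100000)) * (9 * (266/10000)\<^sup>2 + 18 * (893/30000)) * exp (- (47/60 * u)) \<le> 1 * 1"
    using u by (intro mult_mono) (auto simp: power2_eq_square)
  finally have "2 * (21/10 * s) * (\<alpha> * hexa powr (\<alpha> - 1) + \<alpha> * (\<alpha> - 1) / 3 * (893/10000) powr (\<alpha> - 2)) * hexq powr s \<le> 1" by (simp only: mult_1)
  then have "2 * (21/10 * s) * (\<alpha> * hexa powr (\<alpha> - 1) + \<alpha> * (\<alpha> - 1) / 3 * (893/10000) powr (\<alpha> - 2)) \<le> 1 / hexq powr s"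
    using hexq_pos by (subst pos_le_divide_eq) auto
  moreover have "(1 / hexq) powr s = 1 / hexq powr s" using hexq_bounds by (simp add: powr_divide)
  ultimately show ?thesis by (simp only: mult_1)
qed

text \<open>The product bound is at most exp (4.002 x) with x = exp (-2.4165 \<alpha>). As s \<le>
  \<alpha> / 3, raising it to the power 2s leaves a multiple of \<alpha> x in the exponent, which is
  bounded by its value at \<alpha> = 3.\<close>

lemma lattice_theta_powr_le:
  fixes \<alpha> s :: real
  assumes "1 \<le> s" "3 * s \<le> \<alpha>" and z: "1 / hexq \<le> Im z" "Im z \<le> 13/10"
  shows "lattice_theta \<alpha> z powr (2 * s) \<le> 21/20"
proof -
  define u where "u = \<alpha> - 3"
  have u: "u \<ge> 0" "\<alpha> = u + 3" using assms by (auto simp: u_def)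
  define x where "x = exp (- (24165/10000 * \<alpha>))"
  have y: "Im z > 0" using z hexq_pos by (meson divide_pos_pos less_le_trans zero_less_one)
  have y1: "10/13 \<le> Im z"
  proof -
    have "10/13 \<le> 1 / hexq" using hexq_bounds by (simp add: field_simps)
    then show ?thesis using z by simp
  qed
  have T: "jtheta v 0 \<le> 1 + 2001/1000 * x" if v: "v \<ge> \<alpha> * (10/13)" for v
  proof -
    have "24165/10000 * \<alpha> \<le> 31415/10000 * (\<alpha> * (10/13))" using u by simp
    also have "\<dots> \<le> pi * v" using v pi_bounds u by (intro mult_mono) auto
    finally have "exp (- (pi * v)) \<le> x" by (simp add: x_def)
    moreover have "v \<ge> 3/2" using v u by simp
    ultimately show ?thesis using jtheta_upper_ge_3_2[of v] by simp
  qed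
  have "\<alpha> * (10/13) \<le> \<alpha> * Im z" using y1 u by (intro mult_left_mono) auto
  then have T1: "jtheta (\<alpha> * Im z) 0 \<le> 1 + 2001/1000 * x" by (rule T)
  have "10/13 \<le> 1 / Im z" using z y by (simp add: field_simps)
  then have "\<alpha> * (10/13) \<le> \<alpha> * (1 / Im z)" using u by (intro mult_left_mono) auto
  then have "\<alpha> * (10/13) \<le> \<alpha> / Im z" by simp
  then have T2: "jtheta (\<alpha> / Im z) 0 \<le> 1 + 2001/1000 * x" by (rule T)
  have \<alpha>0: "\<alpha> > 0" using u by simp
  have "lattice_theta \<alpha> z \<le> jtheta (\<alpha> * Im z) 0 * jtheta (\<alpha> / Im z) 0"
    by (rule lattice_theta_le[OF y \<alpha>0])
  also have "\<dots> \<le> (1 + 2001/1000 * x) * (1 + 2001/1000 * x)"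
    using T1 T2 jtheta_pos[of "\<alpha> / Im z" 0] y \<alpha>0 by (intro mult_mono) (auto simp: x_def)
  also have "\<dots> \<le> exp (2001/1000 * x) * exp (2001/1000 * x)"
    using exp_ge_add_one_self[of "2001/1000 * x"] by (intro mult_mono) (auto simp: x_def)
  finally have "lattice_theta \<alpha> z \<le> exp (4002/1000 * x)" by (simp add: exp_add[symmetric])
  then have "lattice_theta \<alpha> z powr (2 * s) \<le> exp (4002/1000 * x) powr (2 * s)"
    using lattice_theta_ge_1[OF y \<alpha>0] assms by (intro powr_mono2) auto
  also have "\<dots> = exp (8004/1000 * s * x)" by (simp add: exp_powr_real mult_ac)
  also have "\<dots> \<le> exp (2668/1000 * (\<alpha> * x))"
  proof -
    have "s * x \<le> \<alpha> / 3 * x" using assms by (intro mult_right_mono) (auto simp: x_def)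
    then show ?thesis by simp
  qed
  also have "\<dots> \<le> exp (2668/1000 * (3 * (893/10000) ^ 3))"
  proof -
    have "exp (- (24165/10000)) \<le> (893/10000 :: real)" by (rule exp_neg_le[OF exp_bound_1013]) auto
    then have "exp (- (24165/10000)) ^ 3 \<le> (893/10000 :: real) ^ 3" by (intro power_mono) auto
    then have "exp (- (3 * 24165/10000)) \<le> (893/10000 :: real) ^ 3" by (simp add: exp_of_nat_mult[symmetric])
    moreover have "exp (- (24165/10000 * u)) \<le> exp (- (u / 3))" using u by simp
    moreover have "x = exp (- (3 * 24165/10000)) * exp (- (24165/10000 * u))"
      unfolding x_def u(2) exp_add[symmetric] by (rule arg_cong[where f = exp]) (simp add: algebra_simps)
    ultimately have "x \<le> (893/10000 :: real) ^ 3 * exp (- (u / 3))"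
      by (simp only:) (rule mult_mono, auto)
    then have "\<alpha> * x \<le> (3 * exp (u / 3)) * ((893/10000 :: real) ^ 3 * exp (- (u / 3)))"
      using le_three_exp[of \<alpha>] u by (intro mult_mono) (auto simp: x_def)
    also have "\<dots> = 3 * (893/10000) ^ 3" by (simp add: exp_minus)
    finally show ?thesis by simp
  qed
  also have "\<dots> \<le> 21/20"
  proof -
    have "exp (2668/1000 * (3 * (893/10000) ^ 3)) \<le> exp (1/100 :: real)" by (simp add: power_divide)
    also have "\<dots> \<le> 1 + 1/100 + (1/100)\<^sup>2" by (rule exp_bound) auto
    finally show ?thesis by (simp add: power2_eq_square)
  qed
  finally show ?thesis .
qed

lemma nn_integral_mellin_lower:
  assumes s: "1 \<le> s" "s \<le> 12" and a: "a > 0" and AB: "0 \<le> A" "0 \<le> B"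
  shows "ennreal (A * (exp (- a) * (pi / a) powr s) + 17/10 * B)
     \<le> (\<integral>\<^sup>+t. ennreal (mellin_weight s t * (indicator {1..} t * (A * exp (- a * t) + B * indicator {1..2} t))) \<partial>lborel)"
proof -
  have "ennreal (A * (exp (- a) * (pi / a) powr s) + 17/10 * B)
      = ennreal A * ennreal (exp (- a) * (pi / a) powr s) + ennreal B * ennreal (17/10)"
    using AB by (simp add: ennreal_mult[symmetric] ennreal_plus[symmetric] mult.commute del: ennreal_plus)
  also have "\<dots> \<le> ennreal A * (\<integral>\<^sup>+t. ennreal (mellin_weight s t * (indicator {1..} t * exp (- a * t))) \<partial>lborel)
      + ennreal B * (\<integral>\<^sup>+t. ennreal (mellin_weight s t * indicator {1..2} t) \<partial>lborel)"
    by (intro add_mono mult_left_mono nn_integral_mellin_exp_tail nn_integral_mellin_weight_1_2 s a) auto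
  also have "\<dots> = (\<integral>\<^sup>+t. (ennreal A * ennreal (mellin_weight s t * (indicator {1..} t * exp (- a * t)))
      + ennreal B * ennreal (mellin_weight s t * indicator {1..2} t)) \<partial>lborel)"
    by (subst nn_integral_add, measurable, subst (1 2) nn_integral_cmult, measurable)
  also have "\<dots> = (\<integral>\<^sup>+t. ennreal (mellin_weight s t * (indicator {1..} t * (A * exp (- a * t) + B * indicator {1..2} t))) \<partial>lborel)"
  proof (rule nn_integral_cong)
    fix t :: real
    have m: "mellin_weight s t \<ge> 0" using s by (intro mellin_weight_nonneg) auto
    show "ennreal A * ennreal (mellin_weight s t * (indicator {1..} t * exp (- a * t)))
      + ennreal B * ennreal (mellin_weight s t * indicator {1..2} t)
      = ennreal (mellin_weight s t * (indicator {1..} t * (A * exp (- a * t) + B * indicator {1..2} t)))"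
      using m AB
      by (auto simp: indicator_def ennreal_mult[symmetric] ennreal_plus[symmetric] algebra_simps simp del: ennreal_plus)
  qed
  finally show ?thesis .
qed

text \<open>Bernoulli's inequality, from convexity of exp between 0 and t * ln (a / b).\<close>

lemma powr_ge_tangent:
  fixes a b t :: real
  assumes "0 < a" "0 < b" "t \<ge> 1"
  shows "b powr t + t * b powr (t - 1) * (a - b) \<le> a powr t"
proof -
  define w u where "w = a / b" and "u = ln (a / b)"
  have w: "w > 0" "w = exp u" using assms by (auto simp: w_def u_def)
  have "exp ((1 - 1 / t) *\<^sub>R 0 + (1 / t) *\<^sub>R (t * u)) \<le> (1 - 1 / t) * exp 0 + 1 / t * exp (t * u)"
    using assms by (intro convex_onD[OF exp_convex]) auto
  then have "w \<le> 1 - 1 / t + exp (t * u) / t" using assms w by simp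
  then have "t * w \<le> t * (1 - 1 / t + exp (t * u) / t)" using assms by (intro mult_left_mono) auto
  also have "\<dots> = t - 1 + exp (t * u)" using assms by (simp add: field_simps)
  also have "exp (t * u) = w powr t" using w by (simp add: exp_powr_real mult.commute)
  finally have *: "1 + t * (w - 1) \<le> w powr t" by (simp add: algebra_simps)
  have a: "a = b * w" using assms by (simp add: w_def)
  have "b powr t * (1 + t * (w - 1)) \<le> b powr t * w powr t" using * by (intro mult_left_mono) auto
  also have "\<dots> = a powr t" unfolding a using assms w by (simp add: powr_mult)
  also have "b powr t * (1 + t * (w - 1)) = b powr t + t * b powr (t - 1) * (a - b)"
  proof -
    have "b powr t = b * b powr (t - 1)" using assms powr_mult_base[of b "t - 1"] by simp
    then show ?thesis unfolding a by (simp add: algebra_simps)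
  qed
  finally show ?thesis .
qed

lemma hexq_gt_1: "hexq > 1" using hexq_bounds by simp

text \<open>Provides the condition Q \<ge> 1 of the tangent-line estimate. By |z| \<ge> 1 the form
  times Im z is at least M^2 + 2 M N x + N^2 \<ge> 2, which exceeds 13/10.\<close>

lemma lattice_form_hex_rest_ge_1:
  assumes z: "0 \<le> Re z" "Re z \<le> 1/2" "1 \<le> cmod z" "0 < Im z" "Im z \<le> 13/10" and v: "v \<in> hex_rest"
  shows "lattice_form z v \<ge> 1"
proof -
  obtain m n where mn: "v = (m, n)" by (cases v)
  define M N x where "M = real_of_int m" and "N = real_of_int n" and "x = Re z"
  have "m\<^sup>2 + m * n + n\<^sup>2 \<ge> 3" using v by (simp add: mn hex_rest_def hex_norm_def)
  then have "real_of_int (m\<^sup>2 + m * n + n\<^sup>2) \<ge> 3" by linarith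
  then have H: "M\<^sup>2 + M * N + N\<^sup>2 \<ge> 3" by (simp add: M_def N_def)
  have n2: "(Re z)\<^sup>2 + (Im z)\<^sup>2 \<ge> 1"
    using power_mono[OF z(3), of 2] by (simp add: cmod_power2)
  have "M\<^sup>2 * 1 + 2 * (M * N) * x + N\<^sup>2 \<le> M\<^sup>2 * ((Re z)\<^sup>2 + (Im z)\<^sup>2) + 2 * (M * N) * x + N\<^sup>2"
    using n2 by (intro add_right_mono mult_left_mono) auto
  also have "\<dots> = (N + M * x)\<^sup>2 + M\<^sup>2 * (Im z)\<^sup>2"
    by (simp add: x_def power2_eq_square algebra_simps)
  also have "\<dots> = lattice_form z v * Im z"
    unfolding mn lattice_form_eq using z(4) by (simp add: M_def N_def x_def)
  finally have 1: "M\<^sup>2 + 2 * (M * N) * x + N\<^sup>2 \<le> lattice_form z v * Im z" by simp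
  have "2 \<le> M\<^sup>2 + 2 * (M * N) * x + N\<^sup>2"
  proof (cases "M * N \<ge> 0")
    case True
    have "(M - N)\<^sup>2 \<ge> 0" by simp
    then have "M * N \<le> (M\<^sup>2 + N\<^sup>2) / 2" by (simp add: power2_eq_square algebra_simps)
    then have "2 \<le> M\<^sup>2 + N\<^sup>2" using H by simp
    moreover have "0 \<le> 2 * (M * N) * x" using True z(1) by (simp add: x_def)
    ultimately show ?thesis by linarith
  next
    case False
    have "M * N * 1 \<le> M * N * (2 * x)" using False z(2) by (intro mult_left_mono_neg) (auto simp: x_def)
    then show ?thesis using H by (simp add: mult_ac)
  qed
  then have "2 \<le> lattice_form z v * Im z" using 1 by linarith
  moreover have "lattice_form z v * Im z \<le> lattice_form z v * (13/10)"
    using z lattice_form_nonneg[OF z(4)] by (intro mult_left_mono) auto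
  ultimately show ?thesis by simp
qed

section \<open>The strict inequality for Im z \<le> 13/10\<close>

theorem strict_minimum_low:
  assumes s: "1 < s" "s \<le> 12" and \<alpha>: "3 * s \<le> \<alpha>" and k: "0 < k" "k \<le> 2 * s"
    and z: "0 \<le> Re z" "Re z \<le> 1/2" "1 \<le> cmod z" "0 < Im z" "Im z \<le> 13/10" "z \<noteq> hex_point"
  shows "epstein_zeta s hex_point - lattice_theta \<alpha> hex_point powr k < epstein_zeta s z - lattice_theta \<alpha> z powr k"
proof -
  define x y n2 where "x = Re z" and "y = Im z" and "n2 = (cmod z)\<^sup>2"
  have y: "y > 0" "y \<le> 13/10" using z by (auto simp: y_def)
  have x: "0 \<le> x" "x \<le> 1/2" using z by (auto simp: x_def)
  have n2: "n2 = x\<^sup>2 + y\<^sup>2" "n2 \<ge> 1"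
    using power_mono[OF z(3), of 2] by (auto simp: n2_def x_def y_def cmod_power2)
  have xx: "x\<^sup>2 \<le> 1/4" using power_mono[OF x(2) x(1), of 2] by (simp add: power2_eq_square)
  have y2: "y\<^sup>2 \<ge> 3/4" using n2 xx by simp
  have y_lo: "1 / hexq \<le> y"
  proof -
    have "(1 / hexq)\<^sup>2 \<le> y\<^sup>2" using y2 by (simp add: power_divide hexq_squared)
    then show ?thesis using y by - (rule power2_le_imp_le, auto)
  qed
  \<comment> \<open>The relation R^2 = 1 + e^2 + p^2 expresses determinant 1 of the form: (R - e)(R
    + e) - p^2 = 1.\<close>
  define p e R where "p = x / y" and "e = (n2 - 1) / (2 * y)" and "R = sqrt (1 + e\<^sup>2 + p\<^sup>2)"
  have R: "R = (n2 + 1) / (2 * y)"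
  proof -
    have "((n2 + 1) / (2 * y))\<^sup>2 = 1 + e\<^sup>2 + p\<^sup>2"
      unfolding e_def p_def using y n2(1) by (simp add: power2_eq_square field_simps)
    then show ?thesis unfolding R_def using y n2(2) by (intro real_sqrt_unique) auto
  qed
  have R2: "R\<^sup>2 = 1 + e\<^sup>2 + p\<^sup>2" by (simp add: R_def add_nonneg_nonneg)
  have Q: "R - e = 1 / y" "R + e = n2 / y" "2 * (R - p) = (n2 + 1 - 2 * x) / y"
    unfolding R e_def p_def using y by (simp_all add: field_simps)
  have p: "0 \<le> p" "p \<le> hexq / 2"
  proof -
    show "0 \<le> p" using x y by (simp add: p_def)
    have "3 * x\<^sup>2 \<le> y\<^sup>2" using xx y2 by simp
    then have "p\<^sup>2 \<le> (hexq / 2)\<^sup>2" using y by (simp add: p_def power_divide hexq_squared field_simps)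
    then show "p \<le> hexq / 2" using hexq_pos by - (rule power2_le_imp_le, auto)
  qed
  have e: "0 \<le> e" "e \<le> 37/100"
  proof -
    show "0 \<le> e" using n2 y by (simp add: e_def)
    have "y * y \<le> 13/10 * y" using y by (intro mult_right_mono) auto
    then have "n2 - 1 \<le> 74/100 * y" using n2(1) xx y unfolding power2_eq_square by linarith
    then show "e \<le> 37/100" using y by (simp add: e_def field_simps)
  qed
  have Re: "10/13 \<le> R - e" unfolding Q using y by (simp add: field_simps)
  define a1 a2 a3 where "a1 = exp (- (pi * (R - e)))" and "a2 = exp (- (pi * (R + e)))" and "a3 = exp (- (pi * (2 * (R - p))))"
  define F where "F = a1 + a2 + a3 - 3 * hexa"
  define G where "G = (a1 - hexa)\<^sup>2 + (a2 - hexa)\<^sup>2 + (a3 - hexa)\<^sup>2"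
  have FG: "3/2 * G \<le> F"
    unfolding F_def G_def a1_def a2_def a3_def R_def by (rule first_shell[OF p e Re[unfolded R_def]])
  define V where "V = (R - e - hexq)\<^sup>2 + (R + e - hexq)\<^sup>2 + (2 * (R - p) - hexq)\<^sup>2"
  \<comment> \<open>The constant lies just below (hexq + 1) / 2, as 2 (R - p) \<le> hexq + 1
    requires.\<close>
  have Qle: "R \<le> p + 10765/10000"
  proof -
    have "e * e \<le> 37/100 * (37/100)" using e by (intro mult_mono) auto
    then have "R\<^sup>2 \<le> (p + 10765/10000)\<^sup>2" unfolding R2 using p(1) by (simp add: power2_eq_square algebra_simps)
    then show ?thesis using p by - (rule power2_le_imp_le, auto)
  qed
  have "R + e \<le> hexq + 1" "R - e \<le> hexq + 1" "2 * (R - p) \<le> hexq + 1"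
    using Qle p e hexq_bounds by auto
  then have "63/100000 * V \<le> G"
    using exp_minus_hexa_square_ge[of "R - e"] exp_minus_hexa_square_ge[of "R + e"] exp_minus_hexa_square_ge[of "2 * (R - p)"]
    by (simp add: V_def G_def a1_def a2_def a3_def)
  then have FV: "945/1000000 * V \<le> F" using FG by simp
  \<comment> \<open>The strictness of the final inequality originates here: V vanishes only at the
    hexagonal point.\<close>
  have V_pos: "V > 0"
  proof (rule ccontr)
    assume "\<not> V > 0"
    moreover have "(R - e - hexq)\<^sup>2 \<ge> 0" "(R + e - hexq)\<^sup>2 \<ge> 0" "(2 * (R - p) - hexq)\<^sup>2 \<ge> 0" by simp_all
    ultimately have "(R - e - hexq)\<^sup>2 = 0" "(R + e - hexq)\<^sup>2 = 0" unfolding V_def by linarith+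
    then have "1 / y = hexq" "n2 / y = hexq" unfolding Q by auto
    then have yy: "y = 1 / hexq" and "n2 = 1" using y hexq_pos by (auto simp: field_simps)
    then have "x\<^sup>2 = (1/2)\<^sup>2" using n2(1) by (simp add: power_divide hexq_squared)
    then have "x = 1/2" using x by (simp add: power2_eq_iff_nonneg)
    then have "z = hex_point" using yy by (simp add: complex_eq_iff x_def y_def)
    then show False using z(6) by simp
  qed
  have F_pos: "F > 0" using FV V_pos by (meson less_le_trans mult_pos_pos zero_less_divide_iff zero_less_numeral)
  define S where "S = selling_trace z"
  define d where "d = S - 3/2 * hexq"
  have S: "S = 2 * R - p"
    unfolding S_def selling_trace_def R p_def x_def[symmetric] y_def[symmetric] n2_def[symmetric]
    using y by (simp add: field_simps)
  have S2: "S\<^sup>2 - 3 = (R - 2 * p)\<^sup>2 + 3 * e\<^sup>2"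
    unfolding S using R2 by (simp add: power2_eq_square algebra_simps)
  have "S\<^sup>2 - (3/2 * hexq)\<^sup>2 = S\<^sup>2 - 3" unfolding power_mult_distrib hexq_squared by (simp add: power_divide)
  then have d_eq: "d * (S + 3/2 * hexq) = S\<^sup>2 - 3" by (simp add: d_def power2_eq_square algebra_simps)
  have "0 \<le> 2 * (R - p)" unfolding Q using n2 x y by (intro divide_nonneg_pos) auto
  then have "R \<ge> p" by simp
  then have S0: "S \<ge> 0" using p by (simp add: S)
  have "0 \<le> S\<^sup>2 - 3" unfolding S2 by simp
  then have "0 \<le> d * (S + 3/2 * hexq)" using d_eq by simp
  then have d0: "d \<ge> 0" using S0 hexq_pos by (simp add: zero_le_mult_iff)
  \<comment> \<open>The excess d of the trace is of second order: (S - 3/2 hexq)(S + 3/2 hexq) is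
    the sum of squares in \<open>S2\<close>, hence at most 3/2 * V, and 3464/1000 is a lower bound
    for 3 * hexq.\<close>
  have dV: "d \<le> 434/1000 * V"
  proof -
    define A B where "A = R - hexq" and "B = 2 * (R - p) - hexq"
    have "0 \<le> (2 * A + B)\<^sup>2" by simp
    then have "(B - A)\<^sup>2 \<le> 3 * A\<^sup>2 + 3/2 * B\<^sup>2" by (simp add: power2_eq_square algebra_simps)
    moreover have "V = 2 * A\<^sup>2 + 2 * e\<^sup>2 + B\<^sup>2" by (simp add: V_def A_def B_def power2_eq_square algebra_simps)
    moreover have "R - 2 * p = B - A" by (simp add: A_def B_def)
    ultimately have "S\<^sup>2 - 3 \<le> 3/2 * V" unfolding S2 by simp
    then have "d * (S + 3/2 * hexq) \<le> 3/2 * V" using d_eq by simp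
    moreover have "d * (3464/1000) \<le> d * (S + 3/2 * hexq)"
      using d0 hexq_bounds by (intro mult_left_mono) (auto simp: d_def)
    ultimately show ?thesis using V_pos by simp
  qed
  \<comment> \<open>The gain 2F of the shell at t = 1 less the possible loss in the tail. Since
    434/1000 * 12/10000 is below 945/1000000, more than F remains.\<close>
  define Y where "Y = 2 * F - d * (12/10000)"
  have Y: "Y > F" using dV FV V_pos F_pos by (simp add: Y_def)
  have \<alpha>3: "\<alpha> \<ge> 3" "\<alpha> > 0" using s \<alpha> by auto
  define X where "X = \<alpha> * hexa powr (\<alpha> - 1) + \<alpha> * (\<alpha> - 1) / 3 * (893/10000) powr (\<alpha> - 2)"
  \<comment> \<open>\<open>M\<close> is the cost per unit increase of \<theta>(\<alpha>,z).
    \<open>C\<close> is chosen so that the mass 17/10 of [1,2] returns M * Bp; then C = 21/17 s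
    \<le> 7/17 \<alpha>, which is below 5/12 \<alpha>.\<close>
  define M where "M = 21/10 * s"
  define C where "C = M / (17/10)"
  define Br where "Br = theta_rest \<alpha> z - theta_rest \<alpha> hex_point"
  define Bp where "Bp = max 0 Br"
  have C: "0 \<le> C" "C \<le> 5/12 * \<alpha>" using s \<alpha> by (auto simp: C_def M_def)
  have shell: "lattice_theta t z - lattice_theta t hex_point
      = 2 * (a1 powr t + a2 powr t + a3 powr t - 3 * hexa powr t) + (theta_rest t z - theta_rest t hex_point)" if t: "t > 0" for t
  proof -
    have "exp (- (pi * t) * (n2 / y)) = a2 powr t" "exp (- (pi * t) * (1 / y)) = a1 powr t"
      "exp (- (pi * t) * ((n2 + 1 - 2 * x) / y)) = a3 powr t"
      unfolding Q[symmetric] a1_def a2_def a3_def by (simp_all add: exp_powr_real mult_ac)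
    then show ?thesis
      using lattice_theta_split[OF z(4) t] lattice_theta_hex_point[OF t] hexa_powr[of t]
      by (simp add: x_def[symmetric] y_def[symmetric] n2_def[symmetric])
  qed
  have apos: "0 < a1" "0 < a2" "0 < a3" "0 < hexa" by (simp_all add: a1_def a2_def a3_def hexa_def)
  have shell_lower: "hexa powr (t - 1) * F \<le> a1 powr t + a2 powr t + a3 powr t - 3 * hexa powr t" if t: "t \<ge> 1" for t
  proof -
    have "1 * (hexa powr (t - 1) * F) \<le> t * (hexa powr (t - 1) * F)"
      using t F_pos by (intro mult_right_mono) auto
    also have "\<dots> = t * hexa powr (t - 1) * (a1 - hexa) + t * hexa powr (t - 1) * (a2 - hexa) + t * hexa powr (t - 1) * (a3 - hexa)"
      by (simp add: F_def algebra_simps)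
    also have "\<dots> \<le> a1 powr t + a2 powr t + a3 powr t - 3 * hexa powr t"
      using powr_ge_tangent[OF apos(1) apos(4) t] powr_ge_tangent[OF apos(2) apos(4) t] powr_ge_tangent[OF apos(3) apos(4) t]
      by linarith
    finally show ?thesis by simp
  qed
  \<comment> \<open>The growth \<open>Bp\<close> of the tail at \<alpha> is claimed only for 1 \<le>
    t \<le> 2, where the tangent-line estimate admits C > 0; elsewhere that estimate is applied with
    C = 0.\<close>
  define g where "g = (\<lambda>t. Y / hexa * exp (- (pi * hexq) * t) + C * Bp * indicator {1..2} t)"
  have g_eq: "g t = hexa powr (t - 1) * Y + C * Bp * indicator {1..2} t" for t
  proof -
    have "exp (- (pi * hexq) * t) = hexa powr t" using hexa_powr[of t] by (simp add: mult_ac)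
    also have "\<dots> = hexa * hexa powr (t - 1)" using apos powr_mult_base[of hexa "t - 1"] by simp
    finally show ?thesis using apos by (simp add: g_def)
  qed
  have diff: "g t \<le> lattice_theta t z - lattice_theta t hex_point" if t: "t \<ge> 1" for t
  proof -
    have rest: "theta_rest t z - theta_rest t hex_point \<ge> C' * Br - d * (12/10000 * hexa powr (t - 1))"
      if "0 \<le> C'" "C' = 0 \<or> t \<le> 2 \<and> 3 \<le> \<alpha> \<and> C' \<le> 5/12 * \<alpha>" for C'
      using theta_rest_difference[OF z(4) _ lattice_form_hex_rest_ge_1[OF z(1-5)] t \<alpha>3(2) that] d0
      by (simp add: d_def S_def Br_def algebra_simps)
    have "C * Bp * indicator {1..2} t - d * (12/10000 * hexa powr (t - 1)) \<le> theta_rest t z - theta_rest t hex_point"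
    proof (cases "t \<le> 2 \<and> Br \<ge> 0")
      case True
      then show ?thesis using rest[of C] C \<alpha>3 t by (simp add: Bp_def)
    next
      case False
      then have "C * Bp * indicator {1..2} t = 0" by (auto simp: Bp_def)
      then show ?thesis using rest[of 0] by (simp only:) simp
    qed
    moreover have "hexa powr (t - 1) * Y = 2 * (hexa powr (t - 1) * F) - d * (12/10000 * hexa powr (t - 1))"
      by (simp add: Y_def algebra_simps)
    moreover note shell_lower[OF t]
    moreover have "h + c \<le> 2 * v + r" if "c - w \<le> r" "h = 2 * f - w" "f \<le> v" for c f h r v w :: real
      using that by linarith
    ultimately show ?thesis
      unfolding g_eq shell[OF less_le_trans[OF zero_less_one t]] by blast
  qed
  have g0: "0 \<le> g t" for t
    unfolding g_eq using Y F_pos C by (auto simp: Bp_def intro!: add_nonneg_nonneg mult_nonneg_nonneg)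
  define I where "I = Y / hexa * (exp (- (pi * hexq)) * (pi / (pi * hexq)) powr s) + 17/10 * (C * Bp)"
  have I: "I = Y * (1 / hexq) powr s + M * Bp"
    using apos by (simp add: I_def C_def hexa_def)
  have "I \<ge> 0" unfolding I using Y F_pos s by (auto simp: M_def Bp_def)
  moreover have "ennreal I \<le> (\<integral>\<^sup>+t. ennreal (mellin_weight s t * (indicator {1..} t * g t)) \<partial>lborel)"
    unfolding I_def g_def
    by (rule nn_integral_mellin_lower) (use s hexq_pos Y F_pos apos C in \<open>auto simp: Bp_def\<close>)
  moreover have "g \<in> borel_measurable borel" unfolding g_def by measurable
  ultimately have zeta: "epstein_zeta s hex_point + I \<le> epstein_zeta s z"
    by (intro epstein_zeta_diff_ge[OF z(4) Im_hex_point_pos s(1) diff g0]) auto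
  have th1: "1 \<le> lattice_theta \<alpha> hex_point" by (rule lattice_theta_ge_1[OF Im_hex_point_pos \<alpha>3(2)])
  have th2: "lattice_theta \<alpha> hex_point \<le> lattice_theta \<alpha> z" using diff[of \<alpha>] g0[of \<alpha>] \<alpha>3 by simp
  have "lattice_theta \<alpha> z powr k - lattice_theta \<alpha> hex_point powr k \<le> M * (lattice_theta \<alpha> z - lattice_theta \<alpha> hex_point)"
    unfolding M_def
    by (rule powr_diff_le[OF th1 th2 k lattice_theta_powr_le]) (use s \<alpha> y_lo y in \<open>auto simp: y_def\<close>)
  also have "\<dots> \<le> M * (2 * (X * F) + Bp)"
  proof -
    have m: "exp (- (pi * q)) \<le> 893/10000" if "10/13 \<le> q" for q
    proof -
      have "31415/10000 * (10/13) \<le> pi * q" using pi_bounds that by (intro mult_mono) auto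
      then show ?thesis by (intro exp_neg_le[OF exp_bound_1013]) auto
    qed
    have q2: "10/13 \<le> R + e" using Re e by simp
    have "R + e \<le> 2 * (R - p)" unfolding Q using x y by (intro divide_right_mono) auto
    then have q3: "10/13 \<le> 2 * (R - p)" using q2 by simp
    have hm: "hexa < 893/10000" using hexa_bounds by simp
    define A B where "A = \<alpha> * hexa powr (\<alpha> - 1)" and "B = \<alpha> * (\<alpha> - 1) / 2 * (893/10000) powr (\<alpha> - 2)"
    have up: "a powr \<alpha> \<le> hexa powr \<alpha> + A * (a - hexa) + B * (a - hexa)\<^sup>2"
      if "0 < a" "a \<le> 893/10000" for a
      unfolding A_def B_def by (rule powr_le_second_order) (use that apos hm \<alpha>3 in auto)
    have "a1 \<le> 893/10000" "a2 \<le> 893/10000" "a3 \<le> 893/10000"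
      unfolding a1_def a2_def a3_def using m Re q2 q3 by blast+
    then have "a1 powr \<alpha> + a2 powr \<alpha> + a3 powr \<alpha> - 3 * hexa powr \<alpha> \<le> A * F + B * G"
      using up[OF apos(1)] up[OF apos(2)] up[OF apos(3)] by (simp add: F_def G_def algebra_simps)
    \<comment> \<open>Replacing G by 2/3 * F turns the Taylor factor \<alpha>(\<alpha> - 1)/2 into
      the \<alpha>(\<alpha> - 1)/3 of \<open>X\<close>.\<close>
    also have "\<dots> \<le> A * F + B * (2/3 * F)"
      using FG \<alpha>3 by (intro add_left_mono mult_left_mono) (auto simp: B_def)
    also have "\<dots> = X * F" by (simp add: X_def A_def B_def field_simps)
    finally have "lattice_theta \<alpha> z - lattice_theta \<alpha> hex_point \<le> 2 * (X * F) + Bp"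
      unfolding shell[OF \<alpha>3(2)] by (simp add: Br_def Bp_def)
    then show ?thesis using s by (intro mult_left_mono) (auto simp: M_def)
  qed
  also have "\<dots> = 2 * M * X * F + M * Bp" by (simp add: algebra_simps)
  \<comment> \<open>The shell costs at most (1 / hexq)^s * F, while \<zeta> gains (1 / hexq)^s * Y
    with Y > F; the terms M * Bp cancel.\<close>
  also have "\<dots> \<le> 1 * (1 / hexq) powr s * F + M * Bp"
    using powr_terms_le[of s \<alpha>] s \<alpha> F_pos unfolding M_def[symmetric] X_def[symmetric]
    by (intro add_right_mono mult_right_mono) auto
  also have "\<dots> < I"
    unfolding I using Y hexq_pos by (simp add: mult.commute)
  finally show ?thesis using zeta by linarith
qed

section \<open>The strict inequality for Im z \<ge> 13/10\<close>

lemma exp_bound_352: "1 / (352/1000) \<le> exp (31415/30000 :: real)"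
  by (rule exp_ge_eighth_power[where h = "6283/48000" and c = "1139849/1000000"]) (simp_all add: power_divide)

lemma exp_bound_7: "1 / (7/1000) \<le> exp (4994/1000 :: real)"
  by (rule exp_ge_eighth_power[where h = "2497/4000" and c = "18667551/10000000"]) (simp_all add: power_divide)

lemma exp_bound_208: "1 / (208/1000) \<le> exp (31415/20000 :: real)"
  by (rule exp_ge_eighth_power[where h = "6283/32000" and c = "243389/200000"]) (simp_all add: power_divide)

lemma exp_bound_892: "892/10000 \<le> exp (- (24167/10000) :: real)"
  by (rule exp_ge_eighth_power[where h = "-24167/80000" and c = "7392723/10000000"]) (simp_all add: power_divide)

lemma exp_bound_035: "35/100 \<le> exp (- (10472/10000) :: real)"
  by (rule exp_ge_eighth_power[where h = "-1309/10000" and c = "4386527/5000000"]) (simp_all add: power_divide)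

text \<open>In essence s (8/10)^(s-1) \<le> 3. With v = (s - 1)/5 this follows from 8/10 \<le> exp
  (-1/5) and 1 + 5v \<le> 3 (1 + v + v^2/2).\<close>

lemma mult_powr_le_three_powr:
  fixes B y s :: real
  assumes "s \<ge> 1" "0 < y" "0 < B" "B \<le> 8/10 * y"
  shows "s * B powr (s - 1) \<le> 3 * y powr (s - 1)"
proof -
  define v where "v = (s - 1) / 5"
  have v: "v \<ge> 0" "s = 1 + 5 * v" using assms(1) by (simp_all add: v_def field_simps)
  have "s \<le> 3 * (1 + v + v\<^sup>2 / 2)"
  proof -
    have "0 \<le> (v - 2/3)\<^sup>2" by simp
    then show ?thesis using v(2) by (simp add: power2_eq_square algebra_simps)
  qed
  also have "\<dots> \<le> 3 * exp v" using exp_lower_Taylor_quadratic[OF v(1)] by simp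
  finally have "s * B powr (s - 1) \<le> 3 * exp v * (8/10 * y) powr (s - 1)"
    using assms by (intro mult_mono powr_mono2) auto
  also have "\<dots> = 3 * (exp v * (8/10) powr (s - 1)) * y powr (s - 1)"
    unfolding powr_mult by (simp only: mult_ac)
  also have "\<dots> \<le> 3 * 1 * y powr (s - 1)"
  proof (intro mult_right_mono mult_left_mono)
    have "8/10 \<le> exp (- (1/5) :: real)" using exp_ge_add_one_self[of "- (1/5) :: real"] by simp
    then have "(8/10) powr (s - 1) \<le> exp (- (1/5)) powr (s - 1)" using assms by (intro powr_mono2) auto
    also have "\<dots> = exp (- v)"
      unfolding exp_powr_real by (rule arg_cong[where f = exp]) (simp add: v_def)
    finally have "exp v * (8/10) powr (s - 1) \<le> exp v * exp (- v)" by (intro mult_left_mono) auto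
    then show "exp v * (8/10) powr (s - 1) \<le> 1" by (simp add: exp_minus)
  qed auto
  finally show ?thesis by simp
qed

text \<open>\<open>\<beta>\<close> is the rectangular bound for \<theta>(3,z). For y \<le> 3 it is
  governed by X^3, the leading exponential of the factor at 3/y; that of the factor at 3y is smaller
  by exp (-3 pi (y - 1/y)) \<le> 7/1000.\<close>

lemma jtheta_product_small_height:
  fixes y :: real
  assumes y: "13/10 \<le> y" "y \<le> 3"
  defines "\<beta> \<equiv> jtheta (3 * y) 0 * jtheta (3 / y) 0" and "X \<equiv> exp (- (pi / y))"
  shows "\<beta>\<^sup>2 - 1 \<le> 422/100 * X ^ 3" and "\<beta>\<^sup>2 \<le> 8/10 * y"
proof -
  have y0: "y > 0" using y by simp
  have X0: "X > 0" by (simp add: X_def)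
  have X3: "X ^ 3 \<le> 44/1000"
  proof -
    have "31415/10000 / 3 \<le> pi / y" using pi_bounds y by (intro frac_le) auto
    then have "X \<le> 352/1000" unfolding X_def by (intro exp_neg_le[OF exp_bound_352]) auto
    then have "X ^ 3 \<le> (352/1000) ^ 3" using X0 by (intro power_mono) auto
    then show ?thesis by (simp add: power_divide)
  qed
  have T1: "jtheta (3 / y) 0 \<le> 1 + 2001/1000 * X ^ 3"
  proof -
    have "X ^ 9 = (X ^ 3) ^ 3" by (simp add: power_mult[symmetric])
    also have "\<dots> \<le> (44/1000) ^ 3" using X3 X0 by (intro power_mono) auto
    finally have q: "9999/10000 \<le> 1 - X ^ 9" by (simp add: power_divide)
    have e1: "exp (- (pi * (3 / y))) = X ^ 3" unfolding X_def exp_of_nat_mult[symmetric] by simp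
    have e2: "exp (- (3 * pi * (3 / y))) = X ^ 9" unfolding X_def exp_of_nat_mult[symmetric] by simp
    have "jtheta (3 / y) 0 \<le> 1 + 2 * X ^ 3 / (1 - X ^ 9)"
      using jtheta_upper[of "3 / y"] y0 unfolding e1 e2 by simp
    also have "2 * X ^ 3 / (1 - X ^ 9) \<le> 2 * X ^ 3 / (9999/10000)"
      by (rule frac_le[OF _ order_refl _ q]) (use X0 in simp_all)
    also have "\<dots> \<le> 2001/1000 * X ^ 3" using X0 by simp
    finally show ?thesis by simp
  qed
  have T2: "jtheta (3 * y) 0 \<le> 1 + 15/1000 * X ^ 3"
  proof -
    have "1 / y \<le> 10/13" using y by (simp add: field_simps)
    then have "y - 1 / y \<ge> 53/100" using y by simp
    then have "9424/1000 * (53/100) \<le> 3 * pi * (y - 1 / y)" using pi_bounds by (intro mult_mono) auto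
    then have "exp (- (3 * pi * (y - 1 / y))) \<le> 7/1000"
      by (intro exp_neg_le[OF exp_bound_7]) auto
    then have "exp (- (3 * pi * (y - 1 / y))) * X ^ 3 \<le> 7/1000 * X ^ 3" using X0 by (intro mult_right_mono) auto
    moreover have "exp (- (pi * (3 * y))) = exp (- (3 * pi * (y - 1 / y))) * X ^ 3"
      unfolding X_def exp_of_nat_mult[symmetric] exp_add[symmetric] using y0 by (simp add: field_simps)
    ultimately have "exp (- (pi * (3 * y))) \<le> 7/1000 * X ^ 3" by simp
    moreover have "0 \<le> X ^ 3" using X0 by simp
    moreover have "jtheta (3 * y) 0 \<le> 1 + 2001/1000 * exp (- (pi * (3 * y)))" using jtheta_upper_ge_3_2[of "3 * y"] y by simp
    ultimately show ?thesis by linarith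
  qed
  have b0: "0 \<le> \<beta>" using jtheta_pos[of "3 * y" 0] jtheta_pos[of "3 / y" 0] y0 by (simp add: \<beta>_def)
  have "\<beta> \<le> (1 + 15/1000 * X ^ 3) * (1 + 2001/1000 * X ^ 3)"
    unfolding \<beta>_def using T1 T2 jtheta_pos[of "3 / y" 0] y0 X0 by (intro mult_mono) auto
  also have "\<dots> = 1 + X ^ 3 * (2016/1000 + 30015/1000000 * X ^ 3)" by (simp add: field_simps)
  also have "\<dots> \<le> 1 + X ^ 3 * (202/100)" using X3 X0 by (intro add_left_mono mult_left_mono) auto
  finally have b1: "\<beta> \<le> 1 + X ^ 3 * (202/100)" .
  have "\<beta>\<^sup>2 \<le> (1 + X ^ 3 * (202/100))\<^sup>2" using b0 b1 by (intro power_mono) auto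
  also have "\<dots> = 1 + X ^ 3 * (404/100 + 40804/10000 * X ^ 3)" by (simp add: power2_eq_square algebra_simps)
  also have "\<dots> \<le> 1 + X ^ 3 * (422/100)" using X3 X0 by (intro add_left_mono mult_left_mono) auto
  finally have b2: "\<beta>\<^sup>2 \<le> 1 + X ^ 3 * (422/100)" .
  then show "\<beta>\<^sup>2 - 1 \<le> 422/100 * X ^ 3" by simp
  show "\<beta>\<^sup>2 \<le> 8/10 * y"
  proof (cases "y \<le> 2")
    case True
    have "31415/10000 / 2 \<le> pi / y" using pi_bounds y True by (intro frac_le) auto
    then have "X \<le> 208/1000" unfolding X_def by (intro exp_neg_le[OF exp_bound_208]) auto
    then have "X ^ 3 \<le> (208/1000) ^ 3" using X0 by (intro power_mono) auto
    then have "X ^ 3 \<le> 9/1000" by (simp add: power_divide)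
    then show ?thesis using b2 y by simp
  next
    case False
    then show ?thesis using b2 X3 by simp
  qed
qed

text \<open>The factor at 3/y is inverted to sqrt (y / 3) times a factor close to 1, so the square
  is close to y / 3.\<close>

lemma jtheta_product_large_height:
  fixes y :: real
  assumes y: "3 \<le> y"
  shows "(jtheta (3 * y) 0 * jtheta (3 / y) 0)\<^sup>2 \<le> 4/10 * y"
proof -
  have T: "jtheta v 0 \<le> 1 + 88/1000" if "v \<ge> 1" for v
  proof -
    have "31415/10000 * 1 \<le> pi * v" using pi_bounds that by (intro mult_mono) auto
    then have e1: "exp (- (pi * v)) \<le> 433/10000" by (intro exp_neg_le[OF exp_bound_pi]) auto
    have "exp (- (3 * pi * v)) = exp (- (pi * v)) ^ 3" by (simp add: exp_of_nat_mult[symmetric])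
    also have "\<dots> \<le> (433/10000) ^ 3" using e1 by (intro power_mono) auto
    finally have q: "999/1000 \<le> 1 - exp (- (3 * pi * v))" by (simp add: power_divide)
    have "2 * exp (- (pi * v)) / (1 - exp (- (3 * pi * v))) \<le> 2 * (433/10000) / (999/1000)"
      by (rule frac_le[OF _ _ _ q]) (use e1 in auto)
    then show ?thesis using jtheta_upper[of v] that by simp
  qed
  have "jtheta (3 * y) 0 \<le> 1 + 1/1000"
  proof -
    have "31415/10000 * 9 \<le> pi * (3 * y)" using pi_bounds y by (intro mult_mono) auto
    then have "exp (- (pi * (3 * y))) \<le> 1/100000" by (intro exp_neg_le[OF exp_bound_jtheta]) auto
    then show ?thesis using jtheta_upper_ge_3_2[of "3 * y"] y by simp
  qed
  moreover have "jtheta (3 / y) 0 \<le> (1 + 88/1000) * sqrt (y / 3)"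
  proof -
    have "jtheta (3 / y) 0 = jtheta (y / 3) 0 * sqrt (y / 3)"
      using jtheta_inverse[of "3 / y"] y by (simp add: real_sqrt_divide field_simps)
    also have "\<dots> \<le> (1 + 88/1000) * sqrt (y / 3)" using T[of "y / 3"] y by (intro mult_right_mono) auto
    finally show ?thesis .
  qed
  ultimately have "jtheta (3 * y) 0 * jtheta (3 / y) 0 \<le> (1 + 1/1000) * ((1 + 88/1000) * sqrt (y / 3))"
    using jtheta_pos[of "3 / y" 0] y by (intro mult_mono) auto
  then have "(jtheta (3 * y) 0 * jtheta (3 / y) 0)\<^sup>2 \<le> ((1 + 1/1000) * ((1 + 88/1000) * sqrt (y / 3)))\<^sup>2"
    using jtheta_pos[of "3 / y" 0] jtheta_pos[of "3 * y" 0] y by (intro power_mono) auto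
  also have "\<dots> = ((1 + 1/1000) * (1 + 88/1000))\<^sup>2 / 3 * y"
    using y by (simp only: power_mult_distrib) simp
  also have "\<dots> \<le> 4/10 * y" using y by (intro mult_right_mono) (auto simp: power2_eq_square)
  finally show ?thesis .
qed

text \<open>The left side bounds the increase of \<theta>^k, the right side is the gain of \<zeta>.
  For y \<le> 3 Bernoulli's inequality linearises in \<beta>^2 - 1 and leaves a cubic inequality in
  X; for y > 3, (4/10)^s \<le> 4/10 is enough.\<close>

lemma jtheta_product_powr_less:
  fixes y s :: real
  assumes y: "13/10 \<le> y" and s: "1 \<le> s"
  defines "\<beta> \<equiv> jtheta (3 * y) 0 * jtheta (3 / y) 0"
  shows "(\<beta>\<^sup>2) powr s - 1 < (2 * exp (- (pi / y)) - 601/100 * hexa) * y powr s"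
proof (cases "y \<le> 3")
  case True
  define X where "X = exp (- (pi / y))"
  have y0: "y > 0" using y by simp
  have X0: "X > 0" by (simp add: X_def)
  have b0: "\<beta>\<^sup>2 > 0" using jtheta_pos[of "3 * y" 0] jtheta_pos[of "3 / y" 0] y0 by (simp add: \<beta>_def)
  note small = jtheta_product_small_height[OF y True, folded \<beta>_def X_def]
  have Xlo: "892/10000 \<le> X"
  proof -
    have "pi / y \<le> 31416/10000 / (13/10)" using pi_bounds y by (intro frac_le) auto
    then show ?thesis unfolding X_def by (intro exp_neg_ge[OF exp_bound_892]) auto
  qed
  have Xhi: "X \<le> 352/1000"
  proof -
    have "31415/10000 / 3 \<le> pi / y" using pi_bounds y True by (intro frac_le) auto
    then show ?thesis unfolding X_def by (intro exp_neg_le[OF exp_bound_352]) auto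
  qed
  have "(\<beta>\<^sup>2) powr s + s * (\<beta>\<^sup>2) powr (s - 1) * (1 - \<beta>\<^sup>2) \<le> 1 powr s"
    by (rule powr_ge_tangent) (use b0 s in auto)
  then have "(\<beta>\<^sup>2) powr s - 1 \<le> s * (\<beta>\<^sup>2) powr (s - 1) * (\<beta>\<^sup>2 - 1)" by (simp add: algebra_simps)
  also have "\<dots> \<le> s * (\<beta>\<^sup>2) powr (s - 1) * (422/100 * X ^ 3)"
    using small(1) s by (intro mult_left_mono) auto
  also have "\<dots> \<le> 3 * y powr (s - 1) * (422/100 * X ^ 3)"
    using mult_powr_le_three_powr[OF s y0 b0 small(2)] X0 by (intro mult_right_mono) auto
  also have "\<dots> = (1 / y) * (1266/100 * X ^ 3) * y powr s"
    using y0 powr_mult_base[of y "s - 1"] by (simp add: field_simps)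
  also have "\<dots> < (2 * X - 601/100 * hexa) * y powr s"
  proof (rule mult_strict_right_mono)
    have "1 / y \<le> 10/13" using y by (simp add: field_simps)
    then have "(1 / y) * (1266/100 * X ^ 3) \<le> 10/13 * (1266/100 * X ^ 3)" using X0 by (intro mult_right_mono) auto
    also have "\<dots> \<le> 974/100 * X ^ 3" using X0 by simp
    also have "\<dots> < 2 * X - 16/100"
    proof -
      \<comment> \<open>On an interval from l to h the factor 2 - 974/100 X^2 is evaluated at h and
        the factor X at l; three intervals are fine enough.\<close>
      have main: "974/100 * X ^ 3 < 2 * X - 16/100" if "l \<le> X" "X \<le> h" "0 \<le> l" "974/100 * h\<^sup>2 < 2" "16/100 < (2 - 974/100 * h\<^sup>2) * l" for l h
      proof -
        have "X\<^sup>2 \<le> h\<^sup>2" using that X0 by (intro power_mono) auto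
        then have "(2 - 974/100 * h\<^sup>2) * l \<le> (2 - 974/100 * X\<^sup>2) * X"
          using that X0 Xlo by (intro mult_mono') auto
        then have "16/100 < (2 - 974/100 * X\<^sup>2) * X" using that(5) by linarith
        then show ?thesis by (simp add: power2_eq_square power3_eq_cube algebra_simps)
      qed
      consider "X \<le> 12/100" | "12/100 \<le> X" "X \<le> 1/4" | "1/4 \<le> X" by linarith
      then show ?thesis
        by cases (use main[of "892/10000" "12/100"] main[of "12/100" "1/4"] main[of "1/4" "352/1000"] Xlo Xhi in \<open>auto simp: power2_eq_square\<close>)
    qed
    also have "\<dots> \<le> 2 * X - 601/100 * hexa" using hexa_bounds by simp
    finally show "(1 / y) * (1266/100 * X ^ 3) < 2 * X - 601/100 * hexa" .
  qed (use y0 in simp)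
  finally show ?thesis by (simp add: X_def)
next
  case False
  then have y3: "3 \<le> y" by simp
  have "(\<beta>\<^sup>2) powr s \<le> (4/10 * y) powr s"
    unfolding \<beta>_def using jtheta_product_large_height[OF y3] s by (intro powr_mono2) auto
  also have "\<dots> = (4/10) powr s * y powr s" by (rule powr_mult)
  also have "\<dots> \<le> 4/10 * y powr s"
    using powr_mono'[of 1 s "4/10"] s by (intro mult_right_mono) auto
  also have "\<dots> \<le> (2 * exp (- (pi / y)) - 601/100 * hexa) * y powr s"
  proof (rule mult_right_mono)
    have "pi / y \<le> 31416/10000 / 3" using pi_bounds y3 by (intro frac_le) auto
    then have "35/100 \<le> exp (- (pi / y))" by (intro exp_neg_ge[OF exp_bound_035]) auto
    then show "4/10 \<le> 2 * exp (- (pi / y)) - 601/100 * hexa" using hexa_bounds by simp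
  qed simp
  finally show ?thesis by simp
qed

theorem strict_minimum_high:
  assumes s: "1 < s" "s \<le> 12" and \<alpha>: "3 * s \<le> \<alpha>" and k: "0 < k" "k \<le> 2 * s"
    and z: "13/10 \<le> Im z"
  shows "epstein_zeta s hex_point - lattice_theta \<alpha> hex_point powr k < epstein_zeta s z - lattice_theta \<alpha> z powr k"
proof -
  define y where "y = Im z"
  have y: "y > 0" "13/10 \<le> y" "Im z > 0" using z by (auto simp: y_def)
  \<comment> \<open>The gain at t = 1: the two vectors against the bound 601/100 * hexa^t for the
    hexagonal series without its constant term. As hexa \<le> exp (-pi / y), the ratio
    \<open>\<kappa>\<close> remains valid for all t \<ge> 1.\<close>
  define c where "c = 2 * exp (- (pi / y)) - 601/100 * hexa"
  define \<kappa> where "\<kappa> = c / exp (- (pi / y))"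
  have "892/10000 \<le> exp (- (pi / y))"
  proof -
    have "pi / y \<le> 31416/10000 / (13/10)" using pi_bounds y by (intro frac_le) auto
    then show ?thesis by (intro exp_neg_ge[OF exp_bound_892]) auto
  qed
  then have c: "c > 0" using hexa_bounds by (simp add: c_def)
  have \<kappa>: "\<kappa> > 0" using c by (simp add: \<kappa>_def)
  have hexa_le: "hexa \<le> exp (- (pi / y))"
  proof -
    have "1 / y \<le> 1" using y by simp
    then have "pi * (1 / y) \<le> pi * hexq" using hexq_gt_1 by (intro mult_left_mono) auto
    then show ?thesis by (simp add: hexa_def)
  qed
  have diff: "\<kappa> * exp (- (pi / y) * t) \<le> lattice_theta t z - lattice_theta t hex_point" if t: "t \<ge> 1" for t
  proof -
    have "(\<Sum>v\<in>{(0, 0), (0, 1), (0, -1)}. exp (- (pi * t) * lattice_form z v)) \<le> lattice_theta t z"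
      by (rule lattice_theta_ge_partial) (use t y in auto)
    then have 1: "1 + 2 * exp (- (pi / y) * t) \<le> lattice_theta t z"
      by (simp add: lattice_form_eq y_def mult_ac)
    define r where "r = hexa / exp (- (pi / y))"
    have r: "0 < r" "r \<le> 1" using hexa_le hexa_bounds by (auto simp: r_def)
    have "hexa powr t = exp (- (pi / y) * t) * r powr t"
      using hexa_bounds by (simp add: r_def powr_divide exp_powr_real)
    also have "\<dots> \<le> exp (- (pi / y) * t) * r powr 1"
      using r t by (intro mult_left_mono powr_mono') auto
    finally have 2: "hexa powr t \<le> exp (- (pi / y) * t) * r" using r by simp
    have \<kappa>_eq: "\<kappa> = 2 - 601/100 * r" by (simp add: \<kappa>_def c_def r_def field_simps)
    have "\<kappa> * exp (- (pi / y) * t) = 2 * exp (- (pi / y) * t) - 601/100 * (exp (- (pi / y) * t) * r)"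
      unfolding \<kappa>_eq by (simp add: field_simps)
    then show ?thesis using 1 2 lattice_theta_hex_point_le[OF t] by linarith
  qed
  define I where "I = \<kappa> * (exp (- (pi / y)) * (pi / (pi / y)) powr s) + 17/10 * 0"
  have I: "I = c * y powr s" by (simp add: I_def \<kappa>_def)
  have "ennreal I \<le> (\<integral>\<^sup>+t. ennreal (mellin_weight s t * (indicator {1..} t * (\<kappa> * exp (- (pi / y) * t) + 0 * indicator {1..2} t))) \<partial>lborel)"
    unfolding I_def by (rule nn_integral_mellin_lower) (use s y \<kappa> in auto)
  then have I2: "ennreal I \<le> (\<integral>\<^sup>+t. ennreal (mellin_weight s t * (indicator {1..} t * (\<kappa> * exp (- (pi / y) * t)))) \<partial>lborel)"
    by simp
  have zeta: "epstein_zeta s hex_point + I \<le> epstein_zeta s z"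
    by (rule epstein_zeta_diff_ge[OF y(3) Im_hex_point_pos s(1) diff _ _ _ I2]) (use \<kappa> c y in \<open>auto simp: I\<close>)
  have \<alpha>3: "\<alpha> \<ge> 3" using s \<alpha> by simp
  have "1 \<le> lattice_theta \<alpha> hex_point" using lattice_theta_ge_1[OF Im_hex_point_pos] \<alpha>3 by simp
  then have "1 \<le> lattice_theta \<alpha> hex_point powr k" using k by (intro ge_one_powr_ge_zero) auto
  \<comment> \<open>Monotonicity reduces to the worst case: \<alpha> is lowered to 3 and k raised to
    2s.\<close>
  moreover have "lattice_theta \<alpha> z powr k \<le> ((jtheta (3 * y) 0 * jtheta (3 / y) 0)\<^sup>2) powr s"
  proof -
    have "lattice_theta \<alpha> z \<le> lattice_theta 3 z" using lattice_theta_antimono[OF y(3) _ \<alpha>3] by simp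
    also have "\<dots> \<le> jtheta (3 * y) 0 * jtheta (3 / y) 0"
      using lattice_theta_le[OF y(3), of 3] by (simp add: y_def)
    finally have le: "lattice_theta \<alpha> z \<le> jtheta (3 * y) 0 * jtheta (3 / y) 0" .
    have ge: "1 \<le> lattice_theta \<alpha> z" using lattice_theta_ge_1[OF y(3)] \<alpha>3 by simp
    have "lattice_theta \<alpha> z powr k \<le> lattice_theta \<alpha> z powr (2 * s)" using ge k by (intro powr_mono) auto
    also have "\<dots> \<le> (jtheta (3 * y) 0 * jtheta (3 / y) 0) powr (2 * s)" using ge le s by (intro powr_mono2) auto
    also have "\<dots> = ((jtheta (3 * y) 0 * jtheta (3 / y) 0)\<^sup>2) powr s"
      using ge le by (simp add: powr_powr[symmetric] powr_numeral)
    finally show ?thesis .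
  qed
  moreover have "((jtheta (3 * y) 0 * jtheta (3 / y) 0)\<^sup>2) powr s - 1 < c * y powr s"
    unfolding c_def using jtheta_product_powr_less[OF y(2), of s] s by simp
  ultimately show ?thesis using zeta I by linarith
qed

section \<open>Modular invariance and conclusion\<close>

lemma lattice_sums_cong_bij:
  assumes z: "Im z > 0" "Im w > 0"
    and g: "bij g" "g (0, 0) = (0, 0)" "\<And>v. lattice_form w v = lattice_form z (g v)"
  shows "lattice_theta t w = lattice_theta t z" and "epstein_zeta s w = epstein_zeta s z"
proof -
  show "lattice_theta t w = lattice_theta t z"
    unfolding lattice_theta_form g(3)
    by (rule infsum_reindex_bij_betw[OF g(1), of "\<lambda>v. exp (- (pi * t) * lattice_form z v)"])
  have "bij_betw g (UNIV - {(0, 0)}) (UNIV - {(0, 0)})"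
    using bij_betw_DiffI[OF g(1), of "{(0, 0)}" "{(0, 0)}"] g(2) by (simp add: bij_betw_def)
  from infsum_reindex_bij_betw[OF this, of "\<lambda>v. lattice_form z v powr (- s)"]
  show "epstein_zeta s w = epstein_zeta s z"
    unfolding epstein_zeta_form[OF z(1)] epstein_zeta_form[OF z(2)] g(3) .
qed

text \<open>The lattice of w is that of z divided by c z + d, and the form does not change under
  scaling of the lattice; only the indices change, by an invertible integral matrix.\<close>

lemma modular_transform:
  fixes a b c d :: int
  assumes z: "Im z > 0" and det: "a * d - b * c = 1"
  defines "w \<equiv> (of_int a * z + of_int b) / (of_int c * z + of_int d)"
  shows "of_int c * z + of_int d \<noteq> 0" and "Im w = Im z / (cmod (of_int c * z + of_int d))\<^sup>2" and "Im w > 0"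
    and "lattice_form w (m, n) = lattice_form z (m * a + n * c, m * b + n * d)"
    and "lattice_theta t w = lattice_theta t z" and "epstein_zeta s w = epstein_zeta s z"
proof -
  let ?u = "of_int c * z + of_int d"
  show u: "?u \<noteq> 0"
  proof
    assume u0: "?u = 0"
    then have "Im ?u = 0" "Re ?u = 0" by simp_all
    then have "c = 0" "d = 0" using z by auto
    then show False using det by simp
  qed
  have det': "real_of_int a * of_int d - of_int b * of_int c = 1"
    using arg_cong[OF det, of real_of_int] by simp
  have "Im w = (of_int a * of_int d - of_int b * of_int c) * Im z / (cmod ?u)\<^sup>2"
    unfolding w_def Im_divide cmod_power2 by (simp add: algebra_simps)
  then show im: "Im w = Im z / (cmod ?u)\<^sup>2" using det' by simp
  then show im_pos: "Im w > 0" using z u by simp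
  show form: "lattice_form w (m, n) = lattice_form z (m * a + n * c, m * b + n * d)" for m n
  proof -
    have "of_int m * w + of_int n = (of_int (m * a + n * c) * z + of_int (m * b + n * d)) / ?u"
      unfolding w_def using u by (simp add: field_simps)
    then show ?thesis
      unfolding lattice_form_def prod.case im using u by (simp add: norm_divide power_divide)
  qed
  define g where "g = (\<lambda>(m, n). (m * a + n * c, m * b + n * d))"
  have "bij g"
  proof (rule o_bij[where g = "\<lambda>(m, n). (m * d - n * c, n * a - m * b)"])
    have 1: "(m * a + n * c) * d - (m * b + n * d) * c = m" "(m * b + n * d) * a - (m * a + n * c) * b = n"
      "(m * d - n * c) * a + (n * a - m * b) * c = m" "(m * d - n * c) * b + (n * a - m * b) * d = n" for m n
    proof -
      have "(m * a + n * c) * d - (m * b + n * d) * c = m * (a * d - b * c)" by (simp add: algebra_simps)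
      then show "(m * a + n * c) * d - (m * b + n * d) * c = m" using det by simp
      have "(m * b + n * d) * a - (m * a + n * c) * b = n * (a * d - b * c)" by (simp add: algebra_simps)
      then show "(m * b + n * d) * a - (m * a + n * c) * b = n" using det by simp
      have "(m * d - n * c) * a + (n * a - m * b) * c = m * (a * d - b * c)" by (simp add: algebra_simps)
      then show "(m * d - n * c) * a + (n * a - m * b) * c = m" using det by simp
      have "(m * d - n * c) * b + (n * a - m * b) * d = n * (a * d - b * c)" by (simp add: algebra_simps)
      then show "(m * d - n * c) * b + (n * a - m * b) * d = n" using det by simp
    qed
    show "(\<lambda>(m, n). (m * d - n * c, n * a - m * b)) \<circ> g = id" "g \<circ> (\<lambda>(m, n). (m * d - n * c, n * a - m * b)) = id"
      by (auto simp: g_def fun_eq_iff 1)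
  qed
  then show "lattice_theta t w = lattice_theta t z" "epstein_zeta s w = epstein_zeta s z"
    using lattice_sums_cong_bij[OF z im_pos, of g] form by (auto simp: g_def)
qed

lemma reflection_invariant:
  assumes z: "Im z > 0"
  shows "lattice_theta t (- cnj z) = lattice_theta t z" and "epstein_zeta s (- cnj z) = epstein_zeta s z"
proof -
  define g :: "int \<times> int \<Rightarrow> int \<times> int" where "g = (\<lambda>(m, n). (- m, n))"
  have "bij g" by (rule o_bij[where g = g]) (auto simp: g_def fun_eq_iff)
  moreover have "lattice_form (- cnj z) v = lattice_form z (g v)" for v
    by (cases v) (simp add: lattice_form_eq g_def)
  ultimately show "lattice_theta t (- cnj z) = lattice_theta t z" "epstein_zeta s (- cnj z) = epstein_zeta s z"
    using lattice_sums_cong_bij[OF z, of "- cnj z" g] z by (auto simp: g_def)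
qed

text \<open>By positive definiteness only finitely many vectors have a value at most that of (0,
  1).\<close>

lemma lattice_form_minimal_vector:
  assumes z: "Im z > 0"
  obtains v where "v \<noteq> (0, 0)" "\<And>u. u \<noteq> (0, 0) \<Longrightarrow> lattice_form z v \<le> lattice_form z u"
proof -
  obtain C where C: "C > 0" "\<And>m n. lattice_form z (m, n) \<ge> C * ((of_int m)\<^sup>2 + (of_int n)\<^sup>2)"
    using lattice_form_ge[OF z] by metis
  define A where "A = {v. v \<noteq> (0, 0) \<and> lattice_form z v \<le> lattice_form z (0, 1)}"
  define B where "B = lattice_form z (0, 1) / C"
  have "A \<subseteq> {- \<lceil>B\<rceil>..\<lceil>B\<rceil>} \<times> {- \<lceil>B\<rceil>..\<lceil>B\<rceil>}"
  proof
    fix v assume v: "v \<in> A"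
    obtain m n where mn: "v = (m, n)" by (cases v)
    have "C * ((of_int m)\<^sup>2 + (of_int n)\<^sup>2) \<le> lattice_form z (0, 1)"
      using C(2)[of m n] v by (simp add: A_def mn)
    then have le: "(of_int m)\<^sup>2 + (of_int n)\<^sup>2 \<le> B" using C(1) by (simp add: B_def field_simps)
    have abs_le: "\<bar>k\<bar> \<le> \<lceil>B\<rceil>" if "(of_int k)\<^sup>2 \<le> B" for k :: int
    proof -
      have "\<bar>k\<bar> \<le> k\<^sup>2"
        by (metis abs_ge_zero abs_mult_self_eq int_one_le_iff_zero_less linorder_not_less
            mult_le_cancel_left1 order_refl power2_eq_square zero_less_abs_iff)
      then have "real_of_int \<bar>k\<bar> \<le> of_int (k\<^sup>2)" by (simp only: of_int_le_iff)
      then have "real_of_int \<bar>k\<bar> \<le> B" using that by simp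
      then show ?thesis by linarith
    qed
    have "(real_of_int m)\<^sup>2 \<le> B" "(real_of_int n)\<^sup>2 \<le> B"
      using le zero_le_power2[of "real_of_int m"] zero_le_power2[of "real_of_int n"] by linarith+
    then have "\<bar>m\<bar> \<le> \<lceil>B\<rceil>" "\<bar>n\<bar> \<le> \<lceil>B\<rceil>" by (auto intro: abs_le)
    then show "v \<in> {- \<lceil>B\<rceil>..\<lceil>B\<rceil>} \<times> {- \<lceil>B\<rceil>..\<lceil>B\<rceil>}" by (auto simp: mn)
  qed
  then have fin: "finite A" by (rule finite_subset) auto
  have A01: "(0, 1) \<in> A" by (simp add: A_def)
  then have ne: "A \<noteq> {}" by blast
  define v where "v = arg_min_on (lattice_form z) A"
  have v: "v \<in> A" "\<And>u. u \<in> A \<Longrightarrow> lattice_form z v \<le> lattice_form z u"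
    using arg_min_if_finite[OF fin ne, of "lattice_form z"] by (auto simp: v_def not_less)
  show ?thesis
  proof
    show "v \<noteq> (0, 0)" using v by (simp add: A_def)
    show "lattice_form z v \<le> lattice_form z u" if "u \<noteq> (0, 0)" for u
    proof (cases "u \<in> A")
      case False
      then have "lattice_form z (0, 1) \<le> lattice_form z u" using that by (simp add: A_def)
      then show ?thesis using v(2)[OF A01] by linarith
    qed (rule v(2))
  qed
qed

text \<open>A minimal vector is primitive, hence the bottom row of a matrix of determinant 1. A
  translation gives |Re w| \<le> 1/2, and minimality against the top row gives |w| \<ge> 1.\<close>

lemma modular_reduction:
  assumes z: "Im z > 0"
  obtains a b c d :: int and w where "a * d - b * c = 1" "w = (of_int a * z + of_int b) / (of_int c * z + of_int d)"
    "\<bar>Re w\<bar> \<le> 1/2" "1 \<le> cmod w"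
proof -
  obtain v where v: "v \<noteq> (0, 0)" "\<And>u. u \<noteq> (0, 0) \<Longrightarrow> lattice_form z v \<le> lattice_form z u"
    using lattice_form_minimal_vector[OF z] by metis
  obtain c d where cd: "v = (c, d)" by (cases v)
  define g where "g = gcd c d"
  have g0: "g > 0" using v(1) by (simp add: g_def cd)
  have "g = 1"
  proof (rule ccontr)
    assume "g \<noteq> 1"
    then have g2: "g \<ge> 2" using g0 by simp
    define c' d' where "c' = c div g" and "d' = d div g"
    have c': "c = g * c'" "d = g * d'" by (simp_all add: c'_def d'_def g_def)
    have "lattice_form z (c, d) = (of_int g)\<^sup>2 * lattice_form z (c', d')"
      unfolding lattice_form_eq c' by (simp add: power_mult_distrib algebra_simps power2_eq_square)
    moreover have "(c', d') \<noteq> (0, 0)" using v(1) by (auto simp: cd c')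
    then have "lattice_form z (c', d') > 0" "lattice_form z (c, d) \<le> lattice_form z (c', d')"
      using lattice_form_pos[OF z] v(2) by (auto simp: cd)
    ultimately have "(of_int g)\<^sup>2 * lattice_form z (c', d') \<le> 1 * lattice_form z (c', d')" "lattice_form z (c', d') > 0" by auto
    then have "(real_of_int g)\<^sup>2 \<le> 1" by (simp only: mult_le_cancel_right_pos)
    moreover have "(2::real)\<^sup>2 \<le> (of_int g)\<^sup>2" using g2 by (intro power_mono) auto
    ultimately show False by simp
  qed
  then obtain p q where pq: "p * c + q * d = 1" using bezout_int[of c d] by (auto simp: g_def)
  \<comment> \<open>Adding k times the bottom row to the top row translates w by k.\<close>
  define k where "k = - round (Re ((of_int q * z + of_int (- p)) / (of_int c * z + of_int d)))"
  define a b where "a = q + k * c" and "b = - p + k * d"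
  define w where "w = (of_int a * z + of_int b) / (of_int c * z + of_int d)"
  have det: "a * d - b * c = 1" using pq by (simp add: a_def b_def algebra_simps)
  have cz: "of_int c * z + of_int d \<noteq> 0" by (rule modular_transform(1)[OF z det])
  have "w = (of_int q * z + of_int (- p)) / (of_int c * z + of_int d) + of_int k"
    unfolding w_def a_def b_def using cz by (simp add: field_simps)
  then have "Re w = Re ((of_int q * z + of_int (- p)) / (of_int c * z + of_int d)) + of_int k" by simp
  then have re: "\<bar>Re w\<bar> \<le> 1/2"
    using of_int_round_abs_le[of "Re ((of_int q * z + of_int (- p)) / (of_int c * z + of_int d))"]
    unfolding k_def by (simp add: abs_minus_commute)
  have "(a, b) \<noteq> (0, 0)" using det by auto
  then have "lattice_form z (c, d) \<le> lattice_form z (a, b)" using v(2) by (simp add: cd)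
  then have "(cmod (of_int c * z + of_int d))\<^sup>2 \<le> (cmod (of_int a * z + of_int b))\<^sup>2"
    using z by (simp add: lattice_form_def divide_le_cancel)
  then have "cmod (of_int c * z + of_int d) \<le> cmod (of_int a * z + of_int b)" by - (rule power2_le_imp_le, auto)
  then have "1 \<le> cmod w" unfolding w_def using cz by (simp add: norm_divide)
  then show ?thesis using that[OF det w_def re] by simp
qed

lemma exp_pi_third: "exp (\<i> * pi / 3) = hex_point"
proof -
  have "1 / hexq = sqrt 3 / 2" by (simp add: hexq_def)
  then show ?thesis
    using cis_conv_exp[of "pi / 3"] by (simp add: complex_eq_iff Re_exp Im_exp cos_60 sin_60)
qed

text \<open>The excluded points are the two lower corners of the domain; reflection in the imaginary
  axis moves the left half to the right and exchanges them.\<close>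

lemma strict_on_fundamental_domain:
  assumes s: "1 < s" "s \<le> 12" and \<alpha>: "3 * s \<le> \<alpha>" and k: "0 < k" "k \<le> 2 * s"
    and z: "Im z > 0" "\<bar>Re z\<bar> \<le> 1/2" "1 \<le> cmod z" and ne: "z \<noteq> hex_point" "z \<noteq> hex_point - 1"
  shows "epstein_zeta s hex_point - lattice_theta \<alpha> hex_point powr k < epstein_zeta s z - lattice_theta \<alpha> z powr k"
proof -
  have main: "epstein_zeta s hex_point - lattice_theta \<alpha> hex_point powr k < epstein_zeta s w - lattice_theta \<alpha> w powr k"
    if "Im w > 0" "0 \<le> Re w" "Re w \<le> 1/2" "1 \<le> cmod w" "w \<noteq> hex_point" for w
    using strict_minimum_low[OF s \<alpha> k that(2,3,4,1) _ that(5)] strict_minimum_high[OF s \<alpha> k, of w] by linarith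
  show ?thesis
  proof (cases "Re z \<ge> 0")
    case True
    then show ?thesis using main[of z] z ne by simp
  next
    case False
    have "- cnj z \<noteq> hex_point"
    proof
      assume "- cnj z = hex_point"
      then have "Re (- cnj z) = Re hex_point" "Im (- cnj z) = Im hex_point" by (simp_all only:)
      then have "Re z = -1/2" "Im z = 1 / hexq" by simp_all
      then have "z = hex_point - 1" by (simp add: complex_eq_iff)
      then show False using ne by simp
    qed
    then show ?thesis
      using main[of "- cnj z"] False z by (simp add: reflection_invariant[OF z(1)])
  qed
qed

lemma hex_point_minimal:
  assumes s: "1 < s" "s \<le> 12" and \<alpha>: "3 * s \<le> \<alpha>" and k: "0 < k" "k \<le> 2 * s" and z: "Im z > 0"
  defines "f \<equiv> \<lambda>z. epstein_zeta s z - lattice_theta \<alpha> z powr k"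
  shows "f hex_point \<le> f z" and "f z \<le> f hex_point \<Longrightarrow> modular_equiv hex_point z"
proof -
  obtain a b c d :: int and w where det: "a * d - b * c = 1" and w: "w = (of_int a * z + of_int b) / (of_int c * z + of_int d)"
    and dom: "\<bar>Re w\<bar> \<le> 1/2" "1 \<le> cmod w"
    using modular_reduction[OF z] by metis
  note M = modular_transform[OF z det, folded w]
  have fw: "f w = f z" by (simp add: f_def M)
  \<comment> \<open>Equality can occur only when w is one of the corners, a translate of \<rho>;
    inverting the matrix then expresses z by \<rho>.\<close>
  have shift: "modular_equiv hex_point z \<and> f z = f hex_point" if "w = hex_point + of_int n" for n
  proof
    have det1: "(1::int) * 1 - n * 0 = 1" by simp
    have "lattice_theta t (hex_point + of_int n) = lattice_theta t hex_point"
      "epstein_zeta s (hex_point + of_int n) = epstein_zeta s hex_point" for t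
      using modular_transform(5,6)[OF Im_hex_point_pos det1] by simp_all
    then have "f w = f hex_point" by (simp add: f_def that)
    then show "f z = f hex_point" using fw by simp
    let ?u = "of_int c * z + of_int d"
    have wu: "w * ?u = of_int a * z + of_int b" using M(1) by (simp add: w)
    have det': "of_int a * of_int d - of_int b * of_int c = (1::complex)"
      using arg_cong[OF det, of "of_int :: int \<Rightarrow> complex"] by simp
    have den: "(of_int a - of_int c * w) * ?u = 1"
    proof -
      have "(of_int a - of_int c * w) * ?u = of_int a * ?u - of_int c * (w * ?u)" by (simp add: algebra_simps)
      also have "\<dots> = of_int a * of_int d - of_int b * of_int c" unfolding wu by (simp add: algebra_simps)
      finally show ?thesis using det' by simp
    qed
    have num: "(of_int d * w - of_int b) * ?u = z"
    proof -
      have "(of_int d * w - of_int b) * ?u = of_int d * (w * ?u) - of_int b * ?u" by (simp add: algebra_simps)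
      also have "\<dots> = (of_int a * of_int d - of_int b * of_int c) * z" unfolding wu by (simp add: algebra_simps)
      finally show ?thesis using det' by simp
    qed
    have "z = (of_int d * w - of_int b) / (of_int a - of_int c * w)"
    proof -
      have n0: "of_int a - of_int c * w \<noteq> 0" using den by auto
      have "of_int d * w - of_int b = (of_int d * w - of_int b) * ((of_int a - of_int c * w) * ?u)" using den by simp
      also have "\<dots> = (of_int a - of_int c * w) * ((of_int d * w - of_int b) * ?u)" by (simp add: algebra_simps)
      also have "\<dots> = (of_int a - of_int c * w) * z" by (simp only: num)
      finally show ?thesis using n0 by (simp add: field_simps)
    qed
    also have "\<dots> = (of_int d * hex_point + of_int (d * n - b)) / (of_int (- c) * hex_point + of_int (a - c * n))"
      unfolding that by (simp add: algebra_simps)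
    finally have "z = (of_int d * hex_point + of_int (d * n - b)) / (of_int (- c) * hex_point + of_int (a - c * n))" .
    moreover have "d * (a - c * n) - (d * n - b) * (- c) = 1" using det by (simp add: algebra_simps)
    ultimately show "modular_equiv hex_point z" unfolding modular_equiv_def by blast
  qed
  have "w = hex_point + of_int 0 \<or> w = hex_point + of_int (-1) \<or> f hex_point < f w"
    using strict_on_fundamental_domain[OF s \<alpha> k M(3) dom] by (auto simp: f_def)
  then consider "modular_equiv hex_point z" "f z = f hex_point" | "f hex_point < f z"
    using shift fw by metis
  note cases = this
  show "f hex_point \<le> f z" using cases by cases auto
  show "modular_equiv hex_point z" if "f z \<le> f hex_point" using cases that by cases auto
qed

section \<open>Behaviour towards the cusp\<close>

text \<open>The row m = 0 alone suffices: inverted, it is sqrt (y / \<alpha>) times a series whose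
  term at 0 equals 1.\<close>

lemma lattice_theta_imaginary_axis_ge:
  assumes "\<alpha> > 0" "y > 0"
  shows "sqrt (y / \<alpha>) \<le> lattice_theta \<alpha> (\<i> * of_real y)"
proof -
  have "\<alpha> > 0" "Im (\<i> * of_real y) > 0" using assms by auto
  note rows = lattice_theta_rows[OF this(2,1), simplified]
  have "1 = (\<Sum>\<^sub>\<infinity>n\<in>{0::int}. exp (- (pi * (y / \<alpha>)) * (of_int n + 0)\<^sup>2))" by simp
  also have "\<dots> \<le> jtheta (y / \<alpha>) 0"
    unfolding jtheta_def by (rule infsum_mono2[OF _ summable_jtheta]) (use assms in auto)
  finally have "sqrt (y / \<alpha>) * 1 \<le> sqrt (y / \<alpha>) * jtheta (y / \<alpha>) 0"
    using assms by (intro mult_left_mono) auto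
  also have "\<dots> = jtheta (\<alpha> / y) 0"
    using jtheta_inverse[of "\<alpha> / y"] assms by (simp add: real_sqrt_divide field_simps)
  also have "\<dots> = (\<Sum>\<^sub>\<infinity>m\<in>{0::int}. exp (- (pi * (\<alpha> * y)) * (of_int m)\<^sup>2) * jtheta (\<alpha> / y) (of_int m * 0))" by simp
  also have "\<dots> \<le> (\<Sum>\<^sub>\<infinity>m. exp (- (pi * (\<alpha> * y)) * (of_int m)\<^sup>2) * jtheta (\<alpha> / y) (of_int m * 0))"
    by (rule infsum_mono2) (use rows(2) assms jtheta_pos[of "\<alpha> / y"] in \<open>auto simp: less_imp_le\<close>)
  also have "\<dots> = lattice_theta \<alpha> (\<i> * of_real y)" using rows(1) by simp
  finally show ?thesis by simp
qed

text \<open>For y \<ge> 1 the form at iy is at least 1/y times the form at i.\<close>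

lemma epstein_zeta_imaginary_axis_le:
  assumes "s > 1" "y \<ge> 1"
  shows "epstein_zeta s (\<i> * of_real y) \<le> y powr s * epstein_zeta s \<i>"
proof -
  have y: "Im (\<i> * of_real y) > 0" and i: "Im \<i> > 0" using assms by auto
  have "epstein_zeta s (\<i> * of_real y) \<le> (\<Sum>\<^sub>\<infinity>v\<in>UNIV - {(0, 0)}. y powr s * lattice_form \<i> v powr (- s))"
    unfolding epstein_zeta_form[OF y]
  proof (rule infsum_mono)
    show "(\<lambda>v. lattice_form (\<i> * of_real y) v powr (- s)) summable_on UNIV - {(0, 0)}"
      by (rule summable_epstein_zeta[OF y assms(1)])
    show "(\<lambda>v. y powr s * lattice_form \<i> v powr (- s)) summable_on UNIV - {(0, 0)}"
      by (rule summable_on_cmult_right[OF summable_epstein_zeta[OF i assms(1)]])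
    fix v :: "int \<times> int"
    assume "v \<in> UNIV - {(0, 0)}"
    then have pos: "lattice_form \<i> v > 0" using lattice_form_pos[OF i] by auto
    obtain m n where v: "v = (m, n)" by (cases v)
    have "(of_int m)\<^sup>2 * 1 \<le> (real_of_int m)\<^sup>2 * y\<^sup>2" using assms by (intro mult_left_mono) auto
    then have "lattice_form \<i> v / y \<le> lattice_form (\<i> * of_real y) v"
      unfolding v lattice_form_eq using assms by (simp add: divide_right_mono)
    then have "lattice_form (\<i> * of_real y) v powr (- s) \<le> (lattice_form \<i> v / y) powr (- s)"
      using pos assms by (intro powr_mono2') auto
    also have "\<dots> = y powr s * lattice_form \<i> v powr (- s)"
      using pos assms by (simp add: powr_divide powr_minus_divide)
    finally show "lattice_form (\<i> * of_real y) v powr (- s) \<le> y powr s * lattice_form \<i> v powr (- s)" .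
  qed
  also have "\<dots> = y powr s * epstein_zeta s \<i>"
    unfolding epstein_zeta_form[OF i] by (rule infsum_cmult_right')
  finally show ?thesis .
qed

text \<open>\<open>T\<close> is the size that y^(k/2 - s) must reach for the growth y^(k/2) of
  \<theta>^k to exceed the bound K y^s for \<zeta> by more than |b|.\<close>

lemma imaginary_axis_unbounded_below:
  assumes s: "1 < s" and \<alpha>: "0 < \<alpha>" and k: "2 * s < k"
  obtains y where "y > 0" "epstein_zeta s (\<i> * of_real y) - lattice_theta \<alpha> (\<i> * of_real y) powr k < b"
proof -
  define \<delta> where "\<delta> = k / 2 - s"
  have \<delta>: "\<delta> > 0" using k by (simp add: \<delta>_def)
  define K where "K = epstein_zeta s \<i>"
  have K: "K \<ge> 0" unfolding K_def by (rule epstein_zeta_nonneg)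
  define T where "T = max 1 (\<alpha> powr (k / 2) * (K + 1 + \<bar>b\<bar>))"
  define y where "y = T powr (1 / \<delta>)"
  have y: "y \<ge> 1" using \<delta> by (simp add: y_def T_def ge_one_powr_ge_zero)
  have "y powr \<delta> = T" using \<delta> by (simp add: y_def powr_powr T_def)
  then have "\<alpha> powr (k / 2) * (K + 1 + \<bar>b\<bar>) \<le> y powr \<delta>" by (simp add: T_def)
  then have 1: "K + 1 + \<bar>b\<bar> \<le> y powr \<delta> / \<alpha> powr (k / 2)" using \<alpha> by (simp add: field_simps)
  have "(y / \<alpha>) powr (k / 2) = sqrt (y / \<alpha>) powr k"
    using y \<alpha> by (simp add: powr_half_sqrt[symmetric] powr_powr)
  also have "\<dots> \<le> lattice_theta \<alpha> (\<i> * of_real y) powr k"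
    using lattice_theta_imaginary_axis_ge[OF \<alpha>, of y] y \<alpha> k s by (intro powr_mono2) auto
  finally have th: "(y / \<alpha>) powr (k / 2) \<le> lattice_theta \<alpha> (\<i> * of_real y) powr k" .
  have "y powr s * (K + 1 + \<bar>b\<bar>) \<le> y powr s * (y powr \<delta> / \<alpha> powr (k / 2))"
    using 1 by (intro mult_left_mono) auto
  also have "\<dots> = (y / \<alpha>) powr (k / 2)"
    using y \<alpha> by (simp add: powr_divide powr_add[symmetric] \<delta>_def)
  finally have "y powr s * (K + 1 + \<bar>b\<bar>) \<le> lattice_theta \<alpha> (\<i> * of_real y) powr k" using th by linarith
  moreover have "epstein_zeta s (\<i> * of_real y) \<le> y powr s * K"
    unfolding K_def by (rule epstein_zeta_imaginary_axis_le[OF s y])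
  moreover have "1 * (1 + \<bar>b\<bar>) \<le> y powr s * (1 + \<bar>b\<bar>)"
    using y s by (intro mult_right_mono ge_one_powr_ge_zero) auto
  moreover have "y powr s * (K + 1 + \<bar>b\<bar>) = y powr s * K + y powr s * (1 + \<bar>b\<bar>)" by (simp add: algebra_simps)
  moreover have "e - t \<le> - c" if "p \<le> t" "e \<le> q" "1 * c \<le> r" "p = q + r" for e t c p q r :: real
    using that by linarith
  ultimately have "epstein_zeta s (\<i> * of_real y) - lattice_theta \<alpha> (\<i> * of_real y) powr k \<le> - (1 + \<bar>b\<bar>)" by blast
  then have "epstein_zeta s (\<i> * of_real y) - lattice_theta \<alpha> (\<i> * of_real y) powr k < b" by linarith
  then show ?thesis using that[of y] y by simp
qed

theorem corollary1p2:
  fixes s \<alpha> k :: real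
  assumes "1 < s" and "s \<le> 12" and "\<alpha> \<ge> 3 * s"
  shows "let f = (\<lambda>z. epstein_zeta s z - lattice_theta \<alpha> z powr k) in
           (0 < k \<and> k \<le> 2 * s \<longrightarrow>
              is_arg_min f (\<lambda>z. z \<in> upper_half_plane) (exp (\<i> * pi / 3)) \<and>
              (\<forall>w. is_arg_min f (\<lambda>z. z \<in> upper_half_plane) w \<longrightarrow>
                   modular_equiv (exp (\<i> * pi / 3)) w)) \<and>
           (2 * s < k \<longrightarrow>
              \<not> (\<exists>w. is_arg_min f (\<lambda>z. z \<in> upper_half_plane) w))"
proof -
  define f where "f = (\<lambda>z. epstein_zeta s z - lattice_theta \<alpha> z powr k)"
  have hex: "hex_point \<in> upper_half_plane" using Im_hex_point_pos by (simp add: upper_half_plane_def)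
  have "is_arg_min f (\<lambda>z. z \<in> upper_half_plane) hex_point \<and>
      (\<forall>w. is_arg_min f (\<lambda>z. z \<in> upper_half_plane) w \<longrightarrow> modular_equiv hex_point w)" if k: "0 < k" "k \<le> 2 * s"
  proof (intro conjI allI impI)
    have min: "f hex_point \<le> f z" "f z \<le> f hex_point \<Longrightarrow> modular_equiv hex_point z" if "Im z > 0" for z
      unfolding f_def using hex_point_minimal[OF assms(1,2,3) k that] by auto
    show "is_arg_min f (\<lambda>z. z \<in> upper_half_plane) hex_point"
      unfolding is_arg_min_def using hex min(1) by (force simp: upper_half_plane_def not_less)
    fix w assume w: "is_arg_min f (\<lambda>z. z \<in> upper_half_plane) w"
    then have "f w \<le> f hex_point" "Im w > 0"
      using hex unfolding is_arg_min_def by (force simp: upper_half_plane_def not_less)+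
    then show "modular_equiv hex_point w" using min(2) by blast
  qed
  moreover have "\<not> (\<exists>w. is_arg_min f (\<lambda>z. z \<in> upper_half_plane) w)" if k: "2 * s < k"
  proof
    assume "\<exists>w. is_arg_min f (\<lambda>z. z \<in> upper_half_plane) w"
    then obtain w where w: "is_arg_min f (\<lambda>z. z \<in> upper_half_plane) w" by blast
    have "\<alpha> > 0" using assms by simp
    then obtain y where "y > 0" "f (\<i> * of_real y) < f w"
      using imaginary_axis_unbounded_below[OF assms(1) _ k, of \<alpha> "f w"] unfolding f_def by metis
    then show False using w unfolding is_arg_min_def by (auto simp: upper_half_plane_def)
  qed
  ultimately show ?thesis unfolding Let_def f_def[symmetric] exp_pi_third by blast
qed

end
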